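(* Let $d\geq 2$ be an integer. Then $$\mathrm{Ext}^{d-1}_{\mathcal{F}(\mathsf{gr};\mathbb{Z})}(\mathfrak{a}, S^{d}\circ\mathfrak{a}) \cong \mathbb{Z}/2$$ and $$\mathrm{Ext}^{d-2}_{\mathcal{F}(\mathsf{gr};\mathbb{Z})}(\mathfrak{a}, S^{d}\circ\mathfrak{a}) \cong \begin{cases}\mathbb{Z}/3 & \text{if } d\in\{3,4\},\\ 0 & \text{otherwise.}\end{cases}$$
   Context: $\mathsf{gr}$ is the category of finitely generated free groups and group homomorphisms, and $\mathcal{F}(\mathsf{gr};\mathbb{Z})$ is the abelian category of functors from $\mathsf{gr}$ to the category $\mathsf{Ab}$ of abelian groups; Ext-groups are taken in this category. $\mathfrak{a}\in\mathcal{F}(\mathsf{gr};\mathbb{Z})$ is the abelianization functor $G\mapsto G/[G,G]$. $S^d$ is the $d$-th symmetric power functor on finitely generated free abelian groups, $S^d(A)=(A^{\otimes d})_{\mathfrak{S}_d}$ (coinvariants under the symmetric group $\mathfrak{S}_d$), and $S^d\circ\mathfrak{a}$ is its composite with abelianization. *)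

theory Defs
  imports "HOL-Algebra.Algebra" "HOL-Algebra.Free_Abelian_Groups"
    "HOL-Combinatorics.Permutations"
begin

section \<open>Finitely generated free groups\<close>

text \<open>A letter \<open>(i, True)\<close> is the \<open>i\<close>-th generator, \<open>(i, False)\<close> its inverse.
  The free group of rank \<open>n\<close> is realised on the reduced words in the first \<open>n\<close> generators.\<close>

type_synonym letter = "nat \<times> bool"
type_synonym word = "letter list"

definition inv_letter :: "letter \<Rightarrow> letter" where
  "inv_letter x = (fst x, \<not> snd x)"

definition reduced :: "word \<Rightarrow> bool" where
  "reduced = successively (\<lambda>x y. y \<noteq> inv_letter x)"

fun cons_reduce :: "letter \<Rightarrow> word \<Rightarrow> word" where
  "cons_reduce x [] = [x]"
| "cons_reduce x (y # w) = (if y = inv_letter x then w else x # y # w)"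

definition free_group :: "nat \<Rightarrow> word monoid" where
  "free_group n =
    \<lparr>carrier = {w. reduced w \<and> fst ` set w \<subseteq> {..<n}},
     monoid.mult = foldr cons_reduce, one = []\<rparr>"

text \<open>The category \<open>gr\<close> is represented by its skeleton: the object \<open>n\<close> is the free group of
  rank \<open>n\<close>. Morphisms are all group homomorphisms, taken extensional so that equality of
  morphisms is equality of functions.\<close>

definition gr_hom :: "nat \<Rightarrow> nat \<Rightarrow> (word \<Rightarrow> word) set" where
  "gr_hom m n = hom (free_group m) (free_group n) \<inter> extensional (carrier (free_group m))"

definition gr_id :: "nat \<Rightarrow> word \<Rightarrow> word" where
  "gr_id n = (\<lambda>w \<in> carrier (free_group n). w)"

definition gr_comp :: "nat \<Rightarrow> (word \<Rightarrow> word) \<Rightarrow> (word \<Rightarrow> word) \<Rightarrow> word \<Rightarrow> word" where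
  "gr_comp m g f = compose (carrier (free_group m)) g f"


section \<open>Functors from \<open>gr\<close> to abelian groups\<close>

record 'a gr_functor =
  obj :: "nat \<Rightarrow> 'a monoid"
  mor :: "nat \<Rightarrow> nat \<Rightarrow> (word \<Rightarrow> word) \<Rightarrow> 'a \<Rightarrow> 'a"

definition is_gr_functor :: "'a gr_functor \<Rightarrow> bool" where
  "is_gr_functor F \<longleftrightarrow>
    (\<forall>n. comm_group (obj F n)) \<and>
    (\<forall>m n. \<forall>f \<in> gr_hom m n. mor F m n f \<in> hom (obj F m) (obj F n)) \<and>
    (\<forall>n. \<forall>x \<in> carrier (obj F n). mor F n n (gr_id n) x = x) \<and>
    (\<forall>l m n. \<forall>f \<in> gr_hom l m. \<forall>g \<in> gr_hom m n. \<forall>x \<in> carrier (obj F l).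
       mor F l n (gr_comp l g f) x = mor F m n g (mor F l m f x))"

definition nat_trans :: "'a gr_functor \<Rightarrow> 'b gr_functor \<Rightarrow> (nat \<Rightarrow> 'a \<Rightarrow> 'b) set" where
  "nat_trans F G = {\<eta>.
    (\<forall>n. \<eta> n \<in> hom (obj F n) (obj G n) \<inter> extensional (carrier (obj F n))) \<and>
    (\<forall>m n. \<forall>f \<in> gr_hom m n. \<forall>x \<in> carrier (obj F m).
       \<eta> n (mor F m n f x) = mor G m n f (\<eta> m x))}"

definition Hom_group :: "'a gr_functor \<Rightarrow> 'b gr_functor \<Rightarrow> (nat \<Rightarrow> 'a \<Rightarrow> 'b) monoid" where
  "Hom_group F G =
    \<lparr>carrier = nat_trans F G,
     monoid.mult = (\<lambda>\<eta> \<theta> n. \<lambda>x \<in> carrier (obj F n). \<eta> n x \<otimes>\<^bsub>obj G n\<^esub> \<theta> n x),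
     one = (\<lambda>n. \<lambda>x \<in> carrier (obj F n). \<one>\<^bsub>obj G n\<^esub>)\<rparr>"


section \<open>The functors \<open>\<aa>\<close> and \<open>S\<^sup>d \<circ> \<aa>\<close>\<close>

text \<open>The map \<open>G Mod M \<rightarrow> H Mod N\<close> induced by a homomorphism \<open>f\<close> from \<open>G\<close> to \<open>H\<close>
  with \<open>f ` M \<subseteq> N\<close>.\<close>

definition quot_map :: "'b monoid \<Rightarrow> 'b set \<Rightarrow> ('a \<Rightarrow> 'b) \<Rightarrow> 'a set \<Rightarrow> 'b set" where
  "quot_map H N f C = N <#>\<^bsub>H\<^esub> (f ` C)"

definition abelianization :: "'a monoid \<Rightarrow> 'a set monoid" where
  "abelianization G = G Mod derived G (carrier G)"

definition ab_functor :: "word set gr_functor" where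
  "ab_functor =
    \<lparr>obj = (\<lambda>n. abelianization (free_group n)),
     mor = (\<lambda>m n f. quot_map (free_group n) (derived (free_group n) (carrier (free_group n))) f)\<rparr>"

definition tuples :: "nat \<Rightarrow> 'a monoid \<Rightarrow> 'a list set" where
  "tuples d A = {xs. length xs = d \<and> set xs \<subseteq> carrier A}"

definition multilinear_gens :: "nat \<Rightarrow> 'a monoid \<Rightarrow> ('a list \<Rightarrow>\<^sub>0 int) set" where
  "multilinear_gens d A =
    {frag_of (xs[i := x \<otimes>\<^bsub>A\<^esub> y]) - frag_of (xs[i := x]) - frag_of (xs[i := y]) | xs i x y.
       xs \<in> tuples d A \<and> i < d \<and> x \<in> carrier A \<and> y \<in> carrier A}"

definition multilinear_rels :: "nat \<Rightarrow> 'a monoid \<Rightarrow> ('a list \<Rightarrow>\<^sub>0 int) set" where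
  "multilinear_rels d A = generate (free_Abelian_group (tuples d A)) (multilinear_gens d A)"

definition tensor_power :: "nat \<Rightarrow> 'a monoid \<Rightarrow> ('a list \<Rightarrow>\<^sub>0 int) set monoid" where
  "tensor_power d A = free_Abelian_group (tuples d A) Mod multilinear_rels d A"

definition tensor_map ::
  "nat \<Rightarrow> 'b monoid \<Rightarrow> ('a list \<Rightarrow> 'b list) \<Rightarrow> ('a list \<Rightarrow>\<^sub>0 int) set \<Rightarrow> ('b list \<Rightarrow>\<^sub>0 int) set" where
  "tensor_map d B \<phi> =
    quot_map (free_Abelian_group (tuples d B)) (multilinear_rels d B)
      (frag_extend (\<lambda>xs. frag_of (\<phi> xs)))"

definition coinvariant_rels :: "nat \<Rightarrow> 'a monoid \<Rightarrow> ('a list \<Rightarrow>\<^sub>0 int) set set" where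
  "coinvariant_rels d A = generate (tensor_power d A)
    {tensor_map d A (permute_list \<sigma>) t \<otimes>\<^bsub>tensor_power d A\<^esub> inv\<^bsub>tensor_power d A\<^esub> t | \<sigma> t.
       \<sigma> permutes {..<d} \<and> t \<in> carrier (tensor_power d A)}"

definition sym_power :: "nat \<Rightarrow> 'a monoid \<Rightarrow> ('a list \<Rightarrow>\<^sub>0 int) set set monoid" where
  "sym_power d A = tensor_power d A Mod coinvariant_rels d A"

definition sym_map ::
  "nat \<Rightarrow> 'b monoid \<Rightarrow> ('a \<Rightarrow> 'b) \<Rightarrow> ('a list \<Rightarrow>\<^sub>0 int) set set \<Rightarrow> ('b list \<Rightarrow>\<^sub>0 int) set set" where
  "sym_map d B f = quot_map (tensor_power d B) (coinvariant_rels d B) (tensor_map d B (map f))"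

definition sym_functor :: "nat \<Rightarrow> 'a gr_functor \<Rightarrow> ('a list \<Rightarrow>\<^sub>0 int) set set gr_functor" where
  "sym_functor d F =
    \<lparr>obj = (\<lambda>n. sym_power d (obj F n)),
     mor = (\<lambda>m n f. sym_map d (obj F n) (mor F m n f))\<rparr>"


section \<open>The standard free resolution of a functor\<close>

definition free_lift :: "('b, 'm) monoid_scheme \<Rightarrow> ('a \<Rightarrow> 'b) \<Rightarrow> ('a \<Rightarrow>\<^sub>0 int) \<Rightarrow> 'b" where
  "free_lift G f c = finprod G (\<lambda>a. f a [^]\<^bsub>G\<^esub> Poly_Mapping.lookup c a) (Poly_Mapping.keys c)"

text \<open>Given a set of generators with ranks, the corresponding free functor is
  \<open>\<Oplus>\<^sub>g \<int>[gr(rank g, -)]\<close>; the summand of \<open>g\<close> has at \<open>n\<close> the basis of all \<open>(g, h)\<close> with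
  \<open>h : rank g \<rightarrow> n\<close>, which stands for \<open>h\<close> applied to the generator \<open>g\<close>.

  In degree \<open>0\<close> there is one generator \<open>Elt n x\<close> of rank \<open>n\<close> for each element \<open>x\<close> of \<open>F(n)\<close>.
  In degree \<open>k + 1\<close> there is one generator \<open>Cyc n L\<close> of rank \<open>n\<close> for each formal combination
  \<open>L\<close> of basis elements in degree \<open>k\<close> at \<open>n\<close> whose value is a cycle, and that cycle is its
  boundary. Different \<open>L\<close> may represent the same cycle: the resolution is redundant, but all its
  terms have the same type.\<close>

datatype 'a gen = Elt nat 'a | Cyc nat "(int \<times> 'a gen \<times> (word \<Rightarrow> word)) list"

fun rank :: "'a gen \<Rightarrow> nat" where
  "rank (Elt n x) = n"
| "rank (Cyc n L) = n"

type_synonym 'a chain = "('a gen \<times> (word \<Rightarrow> word)) \<Rightarrow>\<^sub>0 int"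

definition cells :: "'a gen set \<Rightarrow> nat \<Rightarrow> ('a gen \<times> (word \<Rightarrow> word)) set" where
  "cells B n = {(g, h). g \<in> B \<and> h \<in> gr_hom (rank g) n}"

definition push :: "(word \<Rightarrow> word) \<Rightarrow> 'a chain \<Rightarrow> 'a chain" where
  "push f = frag_extend (\<lambda>(g, h). frag_of (g, gr_comp (rank g) f h))"

definition free_functor :: "'a gen set \<Rightarrow> 'a chain gr_functor" where
  "free_functor B =
    \<lparr>obj = (\<lambda>n. free_Abelian_group (cells B n)), mor = (\<lambda>m n f. push f)\<rparr>"

definition lincomb :: "(int \<times> 'a gen \<times> (word \<Rightarrow> word)) list \<Rightarrow> 'a chain" where
  "lincomb L = sum_list (map (\<lambda>(c, g, h). frag_cmul c (frag_of (g, h))) L)"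

fun gen_boundary :: "'a gen \<Rightarrow> 'a chain" where
  "gen_boundary (Elt n x) = 0"
| "gen_boundary (Cyc n L) = lincomb L"

definition boundary :: "'a chain \<Rightarrow> 'a chain" where
  "boundary = frag_extend (\<lambda>(g, h). push h (gen_boundary g))"

fun gen_value :: "'a gen \<Rightarrow> 'a" where
  "gen_value (Elt n x) = x"

definition augmentation :: "'a gr_functor \<Rightarrow> nat \<Rightarrow> 'a chain \<Rightarrow> 'a" where
  "augmentation F n =
    free_lift (obj F n) (\<lambda>(g, h). mor F (rank g) n h (gen_value g))"

fun res_gens :: "'a gr_functor \<Rightarrow> nat \<Rightarrow> 'a gen set" where
  "res_gens F 0 = {Elt n x | n x. x \<in> carrier (obj F n)}"
| "res_gens F (Suc k) = {Cyc n L | n L.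
     (\<forall>(c, g, h) \<in> set L. (g, h) \<in> cells (res_gens F k) n) \<and>
     (if k = 0 then augmentation F n (lincomb L) = \<one>\<^bsub>obj F n\<^esub> else boundary (lincomb L) = 0)}"

definition resolution :: "'a gr_functor \<Rightarrow> nat \<Rightarrow> 'a chain gr_functor" where
  "resolution F k = free_functor (res_gens F k)"


section \<open>Ext groups\<close>

text \<open>Ext is the cohomology of \<open>Hom (resolution F -, G)\<close>. That the resolution is termwise
  projective and exact is shown in \<open>free_functor_projective\<close>, \<open>augmentation_surj\<close>,
  \<open>resolution_exact_0\<close> and \<open>resolution_exact_Suc\<close>; any other projective resolution gives
  an isomorphic group.\<close>

definition cocycles :: "nat \<Rightarrow> 'a gr_functor \<Rightarrow> 'b gr_functor \<Rightarrow> (nat \<Rightarrow> 'a chain \<Rightarrow> 'b) set" where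
  "cocycles k F G = {\<phi> \<in> nat_trans (resolution F k) G.
     \<forall>n. \<forall>c \<in> carrier (obj (resolution F (Suc k)) n). \<phi> n (boundary c) = \<one>\<^bsub>obj G n\<^esub>}"

definition coboundary ::
  "nat \<Rightarrow> 'a gr_functor \<Rightarrow> (nat \<Rightarrow> 'a chain \<Rightarrow> 'b) \<Rightarrow> nat \<Rightarrow> 'a chain \<Rightarrow> 'b" where
  "coboundary k F \<phi> = (\<lambda>n. \<lambda>c \<in> carrier (obj (resolution F (Suc k)) n). \<phi> n (boundary c))"

fun coboundaries :: "nat \<Rightarrow> 'a gr_functor \<Rightarrow> 'b gr_functor \<Rightarrow> (nat \<Rightarrow> 'a chain \<Rightarrow> 'b) set" where
  "coboundaries 0 F G = {\<one>\<^bsub>Hom_group (resolution F 0) G\<^esub>}"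
| "coboundaries (Suc k) F G = coboundary k F ` nat_trans (resolution F k) G"

definition Ext :: "nat \<Rightarrow> 'a gr_functor \<Rightarrow> 'b gr_functor \<Rightarrow> (nat \<Rightarrow> 'a chain \<Rightarrow> 'b) set monoid" where
  "Ext k F G = (Hom_group (resolution F k) G)\<lparr>carrier := cocycles k F G\<rparr> Mod coboundaries k F G"


section \<open>Free groups and the category \<open>gr\<close>\<close>

lemma inv_letter_inv [simp]: "inv_letter (inv_letter x) = x"
  by (simp add: inv_letter_def)

lemma inv_letter_neq [simp]: "inv_letter x \<noteq> x"
  by (cases x) (auto simp: inv_letter_def)

lemma fst_inv_letter [simp]: "fst (inv_letter x) = fst x"
  by (simp add: inv_letter_def)

lemma inv_letter_eq_iff: "inv_letter x = y \<longleftrightarrow> x = inv_letter y"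
  by auto

lemma reduced_Nil [simp]: "reduced []"
  by (simp add: reduced_def)

lemma reduced_Cons: "reduced (x # w) \<longleftrightarrow> (w = [] \<or> hd w \<noteq> inv_letter x) \<and> reduced w"
  by (auto simp: reduced_def successively_Cons)

lemma reduced_cons_reduce: "reduced w \<Longrightarrow> reduced (cons_reduce x w)"
  by (cases w) (auto simp: reduced_Cons)

lemma reduced_foldr: "reduced w \<Longrightarrow> reduced (foldr cons_reduce u w)"
  by (induction u) (auto simp: reduced_cons_reduce)

lemma cons_reduce_cancel: "reduced w \<Longrightarrow> cons_reduce x (cons_reduce (inv_letter x) w) = w"
proof (cases w)
  case (Cons y v)
  then show "reduced w \<Longrightarrow> ?thesis" by (cases v) (auto simp: reduced_Cons)
qed auto

lemma set_cons_reduce: "set (cons_reduce x w) \<subseteq> insert x (set w)"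
  by (cases w) auto

lemma set_foldr_cons_reduce: "set (foldr cons_reduce u w) \<subseteq> set u \<union> set w"
proof (induction u)
  case (Cons a u)
  then show ?case using set_cons_reduce[of a "foldr cons_reduce u w"] by auto
qed auto

lemma foldr_cons_reduce_assoc1:
  "reduced w \<Longrightarrow> foldr cons_reduce (cons_reduce x u) w = cons_reduce x (foldr cons_reduce u w)"
  by (cases u) (auto simp: cons_reduce_cancel reduced_foldr)

lemma foldr_cons_reduce_assoc:
  "reduced w \<Longrightarrow> foldr cons_reduce (foldr cons_reduce u v) w
    = foldr cons_reduce u (foldr cons_reduce v w)"
  by (induction u) (auto simp: foldr_cons_reduce_assoc1)

lemma foldr_cons_reduce_Nil: "reduced w \<Longrightarrow> foldr cons_reduce w [] = w"
proof (induction w)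
  case (Cons a w)
  then show ?case by (cases w) (auto simp: reduced_Cons)
qed auto

lemma foldr_cons_reduce_inv:
  "reduced w \<Longrightarrow> foldr cons_reduce (rev (map inv_letter u)) (foldr cons_reduce u w) = w"
proof (induction u)
  case (Cons a u)
  then show ?case
    using cons_reduce_cancel[of "foldr cons_reduce u w" "inv_letter a"] by (simp add: reduced_foldr)
qed auto

lemma reduced_inv: "reduced w \<Longrightarrow> reduced (rev (map inv_letter w))"
  unfolding reduced_def
  by (simp add: successively_map) (erule successively_mono, auto simp: inv_letter_def prod_eq_iff)

lemma group_free_group: "group (free_group n)"
proof (rule groupI)
  fix x assume "x \<in> carrier (free_group n)"
  then have x: "reduced x" "fst ` set x \<subseteq> {..<n}" by (auto simp: free_group_def)
  show "\<exists>y\<in>carrier (free_group n). y \<otimes>\<^bsub>free_group n\<^esub> x = \<one>\<^bsub>free_group n\<^esub>"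
  proof (rule bexI)
    show "rev (map inv_letter x) \<in> carrier (free_group n)"
      using x by (auto simp: free_group_def reduced_inv)
    show "rev (map inv_letter x) \<otimes>\<^bsub>free_group n\<^esub> x = \<one>\<^bsub>free_group n\<^esub>"
      using foldr_cons_reduce_inv[of "[]" x] x by (simp add: free_group_def foldr_cons_reduce_Nil)
  qed
qed (use set_foldr_cons_reduce in \<open>fastforce simp: free_group_def reduced_foldr foldr_cons_reduce_assoc\<close>)+

lemma free_group_universal:
  assumes "group H" and a: "\<And>i. i < n \<Longrightarrow> a i \<in> carrier H"
  shows "\<exists>!h. h \<in> hom (free_group n) H \<inter> extensional (carrier (free_group n)) \<and>
           (\<forall>i<n. h [(i, True)] = a i)"
proof -
  interpret H: group H by fact
  define val where "val x = (if snd x then a (fst x) else inv\<^bsub>H\<^esub> a (fst x))" for x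
  define h where "h w = foldr (\<lambda>x y. val x \<otimes>\<^bsub>H\<^esub> y) w \<one>\<^bsub>H\<^esub>" for w
  have val: "val x \<in> carrier H" if "fst x < n" for x
    using a that by (auto simp: val_def)
  have valinv: "val x \<otimes>\<^bsub>H\<^esub> val (inv_letter x) = \<one>\<^bsub>H\<^esub>" if "fst x < n" for x
    using a that by (auto simp: val_def inv_letter_def)
  have hc: "h w \<in> carrier H" if "fst ` set w \<subseteq> {..<n}" for w
    using that by (induction w) (auto simp: h_def val)
  have h1: "h (cons_reduce x w) = val x \<otimes>\<^bsub>H\<^esub> h w" if "fst x < n" "fst ` set w \<subseteq> {..<n}" for x w
  proof (cases w)
    case (Cons y v)
    have "fst y < n" "h v \<in> carrier H" using that Cons hc by auto
    then show ?thesis using that Cons valinv[OF that(1)] val[of y] val[of x]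
      by (auto simp: h_def simp flip: H.m_assoc)
  qed (auto simp: h_def)
  have h2: "h (foldr cons_reduce u w) = h u \<otimes>\<^bsub>H\<^esub> h w"
    if "fst ` set u \<subseteq> {..<n}" "fst ` set w \<subseteq> {..<n}" for u w
    using that(1)
  proof (induction u)
    case Nil then show ?case using hc that by (simp add: h_def)
  next
    case (Cons x u)
    have "fst ` set (foldr cons_reduce u w) \<subseteq> {..<n}"
      using Cons.prems that set_foldr_cons_reduce[of u w] by (fastforce simp: image_subset_iff)
    moreover have "h (x # u) = val x \<otimes>\<^bsub>H\<^esub> h u" by (simp add: h_def)
    ultimately show ?case using Cons h1 val hc that by (auto simp: H.m_assoc)
  qed
  let ?h = "restrict h (carrier (free_group n))"
  have hh: "?h \<in> hom (free_group n) H"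
    using set_foldr_cons_reduce
    by (fastforce simp: hom_def free_group_def hc h2 reduced_foldr)
  have ha: "?h [(i, True)] = a i" if "i < n" for i
    using a that by (auto simp: h_def val_def free_group_def reduced_def)
  interpret F: group "free_group n" by (rule group_free_group)
  have uniq: "k = ?h" if k: "k \<in> hom (free_group n) H" "k \<in> extensional (carrier (free_group n))"
    and ka: "\<And>i. i < n \<Longrightarrow> k [(i, True)] = a i" for k
  proof
    fix w
    interpret k: group_hom "free_group n" H k by (simp add: group_hom_def group_hom_axioms_def k F.group_axioms H.group_axioms)
    have letter: "k [x] = val x" if "fst x < n" for x
    proof (cases "snd x")
      case True then show ?thesis using ka[of "fst x"] that by (cases x) (auto simp: val_def)
    next
      case False
      have c: "[(fst x, True)] \<in> carrier (free_group n)" "[x] \<in> carrier (free_group n)"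
        using that by (auto simp: free_group_def reduced_def)
      have "[(fst x, True)] \<otimes>\<^bsub>free_group n\<^esub> [x] = \<one>\<^bsub>free_group n\<^esub>"
        using False by (cases x) (auto simp: free_group_def inv_letter_def)
      then have "[x] = inv\<^bsub>free_group n\<^esub> [(fst x, True)]"
        using c by (metis F.inv_equality F.inv_inv F.inv_closed)
      then have "k [x] = inv\<^bsub>H\<^esub> a (fst x)" using c ka[OF that] by (metis k.hom_inv)
      then show ?thesis using False by (simp add: val_def)
    qed
    have "k w = h w" if "w \<in> carrier (free_group n)" for w
      using that
    proof (induction w)
      case Nil then show ?case using k.hom_one by (simp add: h_def free_group_def)
    next
      case (Cons x w)
      have c: "[x] \<in> carrier (free_group n)" "w \<in> carrier (free_group n)" "fst x < n"
        using Cons.prems by (auto simp: free_group_def reduced_Cons)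
      have "x # w = [x] \<otimes>\<^bsub>free_group n\<^esub> w"
        using Cons.prems by (cases w) (auto simp: free_group_def reduced_Cons)
      then have "k (x # w) = k [x] \<otimes>\<^bsub>H\<^esub> k w" using c by (metis k.hom_mult)
      then show ?case using Cons.IH c letter by (simp add: h_def)
    qed
    then show "k w = ?h w" using k(2) by (auto simp: extensional_def)
  qed
  show ?thesis
  proof (rule ex1I[of _ ?h])
    show "?h \<in> hom (free_group n) H \<inter> extensional (carrier (free_group n)) \<and>
           (\<forall>i<n. ?h [(i, True)] = a i)"
      using hh ha by auto
  qed (use uniq in blast)
qed

lemma gr_homD:
  assumes "f \<in> gr_hom m n"
  shows "f \<in> hom (free_group m) (free_group n)" "f \<in> extensional (carrier (free_group m))"
    "f \<in> carrier (free_group m) \<rightarrow> carrier (free_group n)"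
  using assms by (auto simp: gr_hom_def hom_def)

lemma gr_id [simp]: "gr_id n \<in> gr_hom n n"
  using group.is_monoid[OF group_free_group, of n]
  by (auto simp: gr_hom_def gr_id_def hom_def monoid.m_closed)

lemma gr_comp [simp]: "f \<in> gr_hom l m \<Longrightarrow> g \<in> gr_hom m n \<Longrightarrow> gr_comp l g f \<in> gr_hom l n"
  using group.hom_compose[OF group_free_group, of f l "free_group m" g "free_group n"]
  by (auto simp: gr_hom_def gr_comp_def compose_def hom_def Pi_def group.is_monoid group_free_group monoid.m_closed)

lemma gr_comp_assoc: "f \<in> gr_hom k l \<Longrightarrow> 
   gr_comp k h (gr_comp k g f) = gr_comp k (gr_comp l h g) f"
  by (auto simp: gr_comp_def gr_hom_def compose_def hom_def fun_eq_iff)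

lemma gr_comp_id_left: "f \<in> gr_hom m n \<Longrightarrow> gr_comp m (gr_id n) f = f"
  by (auto simp: gr_comp_def gr_id_def gr_hom_def compose_def hom_def fun_eq_iff extensional_def)

lemma gr_comp_id_right: "f \<in> gr_hom m n \<Longrightarrow> gr_comp m f (gr_id m) = f"
  by (auto simp: gr_comp_def gr_id_def gr_hom_def compose_def hom_def fun_eq_iff extensional_def)


section \<open>Functoriality of \<open>\<aa>\<close> and \<open>S\<^sup>d \<circ> \<aa>\<close>\<close>

lemma quot_map_coset:
  assumes "group G" "group H" "subgroup M G" "subgroup N H" "f \<in> hom G H" "f ` M \<subseteq> N"
    "x \<in> carrier G"
  shows "quot_map H N f (M #>\<^bsub>G\<^esub> x) = N #>\<^bsub>H\<^esub> f x"
proof -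
  interpret f: group_hom G H f using assms by (simp add: group_hom_def group_hom_axioms_def)
  interpret M: subgroup M G by fact
  interpret N: subgroup N H by fact
  have fx: "f x \<in> carrier H" using assms by simp
  have "N <#>\<^bsub>H\<^esub> (f ` (M #>\<^bsub>G\<^esub> x)) \<subseteq> N #>\<^bsub>H\<^esub> f x"
  proof
    fix y assume "y \<in> N <#>\<^bsub>H\<^esub> (f ` (M #>\<^bsub>G\<^esub> x))"
    then obtain n m where nm: "n \<in> N" "m \<in> M" "y = n \<otimes>\<^bsub>H\<^esub> f (m \<otimes>\<^bsub>G\<^esub> x)"
      by (auto simp: set_mult_def r_coset_def)
    then have fm: "f m \<in> N" "m \<in> carrier G" using assms by auto
    then have "y = (n \<otimes>\<^bsub>H\<^esub> f m) \<otimes>\<^bsub>H\<^esub> f x"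
      using nm fx assms(7) by (simp add: f.H.m_assoc)
    moreover have "n \<otimes>\<^bsub>H\<^esub> f m \<in> N" using nm fm by simp
    ultimately show "y \<in> N #>\<^bsub>H\<^esub> f x" unfolding r_coset_def by blast
  qed
  moreover have "N #>\<^bsub>H\<^esub> f x \<subseteq> N <#>\<^bsub>H\<^esub> (f ` (M #>\<^bsub>G\<^esub> x))"
  proof -
    have "x \<in> M #>\<^bsub>G\<^esub> x" using assms by (metis f.G.rcos_self)
    then show ?thesis unfolding set_mult_def r_coset_def[of H] by blast
  qed
  ultimately show ?thesis by (simp add: quot_map_def)
qed

lemma quot_map_hom:
  assumes "M \<lhd> G" "N \<lhd> H" "f \<in> hom G H" "f ` M \<subseteq> N"
  shows "quot_map H N f \<in> hom (G Mod M) (H Mod N)"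
proof -
  interpret M: normal M G by fact
  interpret N: normal N H by fact
  have c: "quot_map H N f (M #>\<^bsub>G\<^esub> x) = N #>\<^bsub>H\<^esub> f x" if "x \<in> carrier G" for x
    using assms that by (intro quot_map_coset)
      (auto simp: M.is_group N.is_group M.subgroup_axioms N.subgroup_axioms)
  have f: "f x \<in> carrier H" if "x \<in> carrier G" for x using assms that by (auto simp: hom_def)
  show ?thesis
    using assms(3)
    by (auto simp: hom_def carrier_FactGroup c f M.rcos_sum N.rcos_sum)
qed

lemma quot_map_comp:
  assumes "M \<lhd> G" "N \<lhd> H" "P \<lhd> K" "f \<in> hom G H" "f ` M \<subseteq> N" "g \<in> hom H K" "g ` N \<subseteq> P"
    and h: "\<And>x. x \<in> carrier G \<Longrightarrow> h x = g (f x)" and C: "C \<in> carrier (G Mod M)"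
  shows "quot_map K P h C = quot_map K P g (quot_map H N f C)"
proof -
  interpret M: normal M G by fact
  interpret N: normal N H by fact
  interpret P: normal P K by fact
  obtain x where x: "x \<in> carrier G" "C = M #>\<^bsub>G\<^esub> x" using C by (auto simp: carrier_FactGroup)
  have f: "f x \<in> carrier H" using assms x by (auto simp: hom_def)
  have hh: "h \<in> hom G K"
    by (rule homI) (simp_all add: h hom_in_carrier[OF assms(4)] hom_in_carrier[OF assms(6)]
        hom_mult[OF assms(4)] hom_mult[OF assms(6)])
  have "h ` M \<subseteq> P" using assms M.subset by (auto simp: h)
  then have "quot_map K P h C = P #>\<^bsub>K\<^esub> h x"
    unfolding x(2) using x hh
    by (intro quot_map_coset) (auto simp: M.is_group P.is_group M.subgroup_axioms P.subgroup_axioms)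
  moreover have "quot_map H N f C = N #>\<^bsub>H\<^esub> f x"
    unfolding x(2) using x assms
    by (intro quot_map_coset) (auto simp: M.is_group N.is_group M.subgroup_axioms N.subgroup_axioms)
  moreover have "quot_map K P g (N #>\<^bsub>H\<^esub> f x) = P #>\<^bsub>K\<^esub> g (f x)"
    using f assms
    by (intro quot_map_coset) (auto simp: P.is_group N.is_group P.subgroup_axioms N.subgroup_axioms)
  ultimately show ?thesis using x h by simp
qed

lemma quot_map_id:
  assumes "M \<lhd> G" and h: "\<And>x. x \<in> carrier G \<Longrightarrow> h x = x" and C: "C \<in> carrier (G Mod M)"
  shows "quot_map G M h C = C"
proof -
  interpret M: normal M G by fact
  obtain x where x: "x \<in> carrier G" "C = M #>\<^bsub>G\<^esub> x" using C by (auto simp: carrier_FactGroup)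
  have "h \<in> hom G G" "h ` M \<subseteq> M" using h M.subset by (auto simp: hom_def)
  then show ?thesis unfolding x(2) using x(1) h[OF x(1)]
    by (subst quot_map_coset) (auto simp: M.is_group M.subgroup_axioms)
qed

lemma hom_image_generate:
  assumes "group G" "group H" "f \<in> hom G H" "S \<subseteq> carrier G" "T \<subseteq> carrier H" "f ` S \<subseteq> generate H T"
  shows "f ` generate G S \<subseteq> generate H T"
proof
  interpret f: group_hom G H f using assms by (simp add: group_hom_def group_hom_axioms_def)
  interpret T: subgroup "generate H T" H using assms f.H.generate_is_subgroup by blast
  fix y assume "y \<in> f ` generate G S"
  then obtain x where x: "x \<in> generate G S" "y = f x" by auto
  from x(1) have "f x \<in> generate H T"
  proof induction
    case (inv h) then show ?case using assms by (metis f.hom_inv T.m_inv_closed image_subset_iff subsetD)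
  next
    case (eng h1 h2) 
    then have "h1 \<in> carrier G" "h2 \<in> carrier G" using f.G.generate_in_carrier[OF assms(4)] by auto
    then show ?case using eng by (simp add: generate.eng)
  qed (use assms in \<open>auto simp: generate.one\<close>)
  then show "y \<in> generate H T" using x by simp
qed

lemma derived_image:
  assumes "group G" "group H" "f \<in> hom G H"
  shows "f ` derived G (carrier G) \<subseteq> derived H (carrier H)"
  unfolding derived_def
proof (rule hom_image_generate)
  interpret f: group_hom G H f using assms by (simp add: group_hom_def group_hom_axioms_def)
  show "derived_set G (carrier G) \<subseteq> carrier G" by auto
  show "derived_set H (carrier H) \<subseteq> carrier H" by auto
  show "f ` derived_set G (carrier G) \<subseteq> generate H (derived_set H (carrier H))"
  proof
    fix y assume "y \<in> f ` derived_set G (carrier G)"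
    then obtain a b where "a \<in> carrier G" "b \<in> carrier G"
      "y = f (a \<otimes>\<^bsub>G\<^esub> b \<otimes>\<^bsub>G\<^esub> inv\<^bsub>G\<^esub> a \<otimes>\<^bsub>G\<^esub> inv\<^bsub>G\<^esub> b)" by auto
    then show "y \<in> generate H (derived_set H (carrier H))"
      by (intro generate.incl) (auto, metis f.hom_closed)
  qed
qed (use assms in auto)

lemma is_gr_functor_ab: "is_gr_functor ab_functor"
proof -
  let ?F = free_group
  let ?D = "\<lambda>n. derived (?F n) (carrier (?F n))"
  have n: "?D n \<lhd> ?F n" for n using group.derived_self_is_normal[OF group_free_group] .
  have h: "f \<in> hom (?F l) (?F m)" "f ` ?D l \<subseteq> ?D m" if "f \<in> gr_hom l m" for f l m
    using gr_homD[OF that] derived_image[OF group_free_group group_free_group] by auto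
  have "comm_group (?F n Mod ?D n)" for n
    using group.derived_quot_is_comm_group[OF group_free_group] by blast
  then show ?thesis
    unfolding is_gr_functor_def ab_functor_def abelianization_def gr_functor.simps
  proof (intro conjI allI ballI)
    show "quot_map (?F n) (?D n) f \<in> hom (?F m Mod ?D m) (?F n Mod ?D n)"
      if "f \<in> gr_hom m n" for m n f by (rule quot_map_hom[OF n n h[OF that]])
    show "quot_map (?F n) (?D n) (gr_id n) x = x" if "x \<in> carrier (?F n Mod ?D n)" for n x
      by (rule quot_map_id[OF n _ that]) (simp add: gr_id_def)
    show "quot_map (?F n) (?D n) (gr_comp l g f) x
        = quot_map (?F n) (?D n) g (quot_map (?F m) (?D m) f x)"
      if "f \<in> gr_hom l m" "g \<in> gr_hom m n" "x \<in> carrier (?F l Mod ?D l)" for l m n f g x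
      by (rule quot_map_comp[OF n n n h[OF that(1)] h[OF that(2)] _ that(3)])
        (simp add: gr_comp_def compose_def)
  qed
qed

lemma tuples_update: "xs \<in> tuples d A \<Longrightarrow> x \<in> carrier A \<Longrightarrow> xs[i := x] \<in> tuples d A"
  using set_update_subset_insert[of xs i x] by (auto simp: tuples_def)

lemma multilinear_gens_carrier:
  assumes "group A"
  shows "multilinear_gens d A \<subseteq> carrier (free_Abelian_group (tuples d A))"
proof -
  interpret group A by fact
  show ?thesis
    unfolding multilinear_gens_def
    by (auto dest!: subsetD[OF keys_diff] simp: tuples_update)
qed

lemma normal_multilinear_rels:
  "group A \<Longrightarrow> multilinear_rels d A \<lhd> free_Abelian_group (tuples d A)"
  unfolding multilinear_rels_def
  by (intro comm_group.subgroup_imp_normal abelian_free_Abelian_group group.generate_is_subgroup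
      multilinear_gens_carrier) auto

lemma frag_map_hom:
  assumes "\<phi> ` S \<subseteq> T"
  shows "frag_extend (\<lambda>xs. frag_of (\<phi> xs)) \<in> hom (free_Abelian_group S) (free_Abelian_group T)"
proof (rule homI)
  fix c assume "c \<in> carrier (free_Abelian_group S)"
  then have "Poly_Mapping.keys c \<subseteq> S" by simp
  then show "frag_extend (\<lambda>xs. frag_of (\<phi> xs)) c \<in> carrier (free_Abelian_group T)"
    using keys_frag_extend[of "\<lambda>xs. frag_of (\<phi> xs)" c] assms by fastforce
qed (simp add: frag_extend_add)

lemma frag_map_comp:
  "frag_extend (\<lambda>xs. frag_of (\<psi> (\<phi> xs))) c
     = frag_extend (\<lambda>xs. frag_of (\<psi> xs)) (frag_extend (\<lambda>xs. frag_of (\<phi> xs)) c)"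
  by (rule frag_induction[of c UNIV]) (auto simp: frag_extend_diff)

lemma frag_map_id:
  assumes "Poly_Mapping.keys c \<subseteq> S" "\<And>x. x \<in> S \<Longrightarrow> \<phi> x = x"
  shows "frag_extend (\<lambda>xs. frag_of (\<phi> xs)) c = c"
  using assms(1) by (induction c rule: frag_induction) (auto simp: frag_extend_diff assms(2))

lemma multilinear_rels_image:
  assumes "group A" "group B" and t: "\<phi> ` tuples d A \<subseteq> tuples d B"
    and g: "frag_extend (\<lambda>xs. frag_of (\<phi> xs)) ` multilinear_gens d A \<subseteq> multilinear_gens d B"
  shows "frag_extend (\<lambda>xs. frag_of (\<phi> xs)) ` multilinear_rels d A \<subseteq> multilinear_rels d B"
  unfolding multilinear_rels_def
  by (rule hom_image_generate[OF _ _ frag_map_hom[OF t]])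
    (use assms in \<open>auto simp: multilinear_gens_carrier intro!: generate.incl\<close>)

lemma map_multilinear:
  assumes "group A" "group B" and f: "f \<in> hom A B"
  shows "map f ` tuples d A \<subseteq> tuples d B"
    "frag_extend (\<lambda>xs. frag_of (map f xs)) ` multilinear_rels d A \<subseteq> multilinear_rels d B"
proof -
  show t: "map f ` tuples d A \<subseteq> tuples d B"
    using f by (auto simp: tuples_def hom_def subset_iff Pi_iff)
  show "frag_extend (\<lambda>xs. frag_of (map f xs)) ` multilinear_rels d A \<subseteq> multilinear_rels d B"
  proof (rule multilinear_rels_image[OF assms(1,2) t], safe)
    fix c assume "c \<in> multilinear_gens d A"
    then obtain xs i x y where c: "c = frag_of (xs[i := x \<otimes>\<^bsub>A\<^esub> y]) - frag_of (xs[i := x]) - frag_of (xs[i := y])"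
      "xs \<in> tuples d A" "i < d" "x \<in> carrier A" "y \<in> carrier A" by (auto simp: multilinear_gens_def)
    have "frag_extend (\<lambda>xs. frag_of (map f xs)) c = frag_of ((map f xs)[i := f x \<otimes>\<^bsub>B\<^esub> f y]) - frag_of ((map f xs)[i := f x]) - frag_of ((map f xs)[i := f y])"
      using f c by (simp add: frag_extend_diff map_update hom_mult)
    moreover have "map f xs \<in> tuples d B" using t c by auto
    ultimately show "frag_extend (\<lambda>xs. frag_of (map f xs)) c \<in> multilinear_gens d B"
      using c hom_in_carrier[OF f] unfolding multilinear_gens_def by blast
  qed
qed

lemma permute_list_update:
  assumes "\<sigma> permutes {..<d}" "length xs = d" "i < d"
  shows "permute_list \<sigma> (xs[i := x]) = (permute_list \<sigma> xs)[inv_into UNIV \<sigma> i := x]"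
proof (rule nth_equalityI)
  fix j assume "j < length (permute_list \<sigma> (xs[i := x]))"
  then have j: "j < d" using assms by simp
  then have "\<sigma> j < d" using permutes_in_image[OF assms(1), of j] by simp
  moreover have "\<sigma> j = i \<longleftrightarrow> j = inv_into UNIV \<sigma> i" using assms(1) by (metis permutes_inverses)
  moreover have "permute_list \<sigma> (xs[i := x]) ! j = (xs[i := x]) ! \<sigma> j" "permute_list \<sigma> xs ! j = xs ! \<sigma> j"
    using assms j by (simp_all add: permute_list_nth)
  ultimately show "permute_list \<sigma> (xs[i := x]) ! j = (permute_list \<sigma> xs)[inv_into UNIV \<sigma> i := x] ! j"
    using assms j by (auto simp: nth_list_update)
qed simp

lemma permute_multilinear:
  assumes "group A" and s: "\<sigma> permutes {..<d}"
  shows "permute_list \<sigma> ` tuples d A \<subseteq> tuples d A"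
    "frag_extend (\<lambda>xs. frag_of (permute_list \<sigma> xs)) ` multilinear_rels d A \<subseteq> multilinear_rels d A"
proof -
  show t: "permute_list \<sigma> ` tuples d A \<subseteq> tuples d A"
    using s by (auto simp: tuples_def)
  show "frag_extend (\<lambda>xs. frag_of (permute_list \<sigma> xs)) ` multilinear_rels d A \<subseteq> multilinear_rels d A"
  proof (rule multilinear_rels_image[OF assms(1,1) t], safe)
    fix c assume "c \<in> multilinear_gens d A"
    then obtain xs i x y where c: "c = frag_of (xs[i := x \<otimes>\<^bsub>A\<^esub> y]) - frag_of (xs[i := x]) - frag_of (xs[i := y])"
      "xs \<in> tuples d A" "i < d" "x \<in> carrier A" "y \<in> carrier A" by (auto simp: multilinear_gens_def)
    let ?ys = "permute_list \<sigma> xs" and ?j = "inv_into UNIV \<sigma> i"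
    have "frag_extend (\<lambda>xs. frag_of (permute_list \<sigma> xs)) c = frag_of (?ys[?j := x \<otimes>\<^bsub>A\<^esub> y]) - frag_of (?ys[?j := x]) - frag_of (?ys[?j := y])"
      using c s by (simp add: frag_extend_diff permute_list_update tuples_def)
    moreover have "?ys \<in> tuples d A" using t c by auto
    moreover have "?j < d" using permutes_in_image[OF permutes_inv[OF s], of i] c(3) by simp
    ultimately show "frag_extend (\<lambda>xs. frag_of (permute_list \<sigma> xs)) c \<in> multilinear_gens d A"
      using c unfolding multilinear_gens_def by blast
  qed
qed

lemma comm_group_tensor_power: "group A \<Longrightarrow> comm_group (tensor_power d A)"
  unfolding tensor_power_def
  by (intro comm_group.abelian_FactGroup abelian_free_Abelian_group normal_imp_subgroup normal_multilinear_rels)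

lemma group_tensor_power: "group A \<Longrightarrow> group (tensor_power d A)"
  using comm_group_tensor_power comm_group.axioms(2) by blast

lemma tensor_map_hom:
  assumes "group A" "group B" "\<phi> ` tuples d A \<subseteq> tuples d B"
    "frag_extend (\<lambda>xs. frag_of (\<phi> xs)) ` multilinear_rels d A \<subseteq> multilinear_rels d B"
  shows "tensor_map d B \<phi> \<in> hom (tensor_power d A) (tensor_power d B)"
  unfolding tensor_map_def tensor_power_def
  by (rule quot_map_hom) (use assms frag_map_hom in \<open>auto simp: normal_multilinear_rels\<close>)

lemma tensor_map_comp:
  assumes "group A" "group B" "group C" "\<phi> ` tuples d A \<subseteq> tuples d B"
    "frag_extend (\<lambda>xs. frag_of (\<phi> xs)) ` multilinear_rels d A \<subseteq> multilinear_rels d B"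
    "\<psi> ` tuples d B \<subseteq> tuples d C"
    "frag_extend (\<lambda>xs. frag_of (\<psi> xs)) ` multilinear_rels d B \<subseteq> multilinear_rels d C"
    and \<chi>: "\<And>xs. xs \<in> tuples d A \<Longrightarrow> \<chi> xs = \<psi> (\<phi> xs)"
    and t: "t \<in> carrier (tensor_power d A)"
  shows "tensor_map d C \<chi> t = tensor_map d C \<psi> (tensor_map d B \<phi> t)"
  unfolding tensor_map_def
proof (rule quot_map_comp[OF normal_multilinear_rels normal_multilinear_rels normal_multilinear_rels
      frag_map_hom assms(5) frag_map_hom assms(7) _ t[unfolded tensor_power_def]])
  fix c assume "c \<in> carrier (free_Abelian_group (tuples d A))"
  then have "Poly_Mapping.keys c \<subseteq> tuples d A" by simp
  then have "frag_extend (\<lambda>xs. frag_of (\<chi> xs)) c = frag_extend (\<lambda>xs. frag_of (\<psi> (\<phi> xs))) c"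
    by (auto intro!: frag_extend_eq simp: \<chi>)
  then show "frag_extend (\<lambda>xs. frag_of (\<chi> xs)) c
     = frag_extend (\<lambda>xs. frag_of (\<psi> xs)) (frag_extend (\<lambda>xs. frag_of (\<phi> xs)) c)"
    by (simp add: frag_map_comp)
qed (use assms in auto)

lemma coinvariant_gens_carrier:
  assumes A: "group A" and s: "\<sigma> permutes {..<d}" and t: "t \<in> carrier (tensor_power d A)"
  shows "tensor_map d A (permute_list \<sigma>) t \<otimes>\<^bsub>tensor_power d A\<^esub> inv\<^bsub>tensor_power d A\<^esub> t
    \<in> carrier (tensor_power d A)"
proof -
  interpret T: group "tensor_power d A" by (rule group_tensor_power[OF A])
  show ?thesis
    using hom_in_carrier[OF tensor_map_hom[OF A A permute_multilinear[OF A s]] t] t by simp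
qed

lemma normal_coinvariant_rels:
  assumes A: "group A" shows "coinvariant_rels d A \<lhd> tensor_power d A"
  unfolding coinvariant_rels_def
  by (intro comm_group.subgroup_imp_normal comm_group_tensor_power[OF A]
      group.generate_is_subgroup group_tensor_power[OF A]) (auto intro: coinvariant_gens_carrier[OF A])

lemma coinvariant_rels_image:
  assumes A: "group A" and B: "group B" and f: "f \<in> hom A B"
  shows "tensor_map d B (map f) ` coinvariant_rels d A \<subseteq> coinvariant_rels d B"
  unfolding coinvariant_rels_def
proof (rule hom_image_generate[OF group_tensor_power[OF A] group_tensor_power[OF B]])
  let ?f = "tensor_map d B (map f)"
  show h: "?f \<in> hom (tensor_power d A) (tensor_power d B)"
    by (rule tensor_map_hom[OF A B map_multilinear[OF A B f]])
  interpret h: group_hom "tensor_power d A" "tensor_power d B" ?f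
    using h by (simp add: group_hom_def group_hom_axioms_def group_tensor_power A B)
  show "?f ` {tensor_map d A (permute_list \<sigma>) t \<otimes>\<^bsub>tensor_power d A\<^esub> inv\<^bsub>tensor_power d A\<^esub> t |\<sigma> t.
         \<sigma> permutes {..<d} \<and> t \<in> carrier (tensor_power d A)}
    \<subseteq> generate (tensor_power d B) {tensor_map d B (permute_list \<sigma>) t \<otimes>\<^bsub>tensor_power d B\<^esub> inv\<^bsub>tensor_power d B\<^esub> t |\<sigma> t.
         \<sigma> permutes {..<d} \<and> t \<in> carrier (tensor_power d B)}"
  proof safe
    fix \<sigma> t assume s: "\<sigma> permutes {..<d}" and t: "t \<in> carrier (tensor_power d A)"
    have p: "tensor_map d A (permute_list \<sigma>) t \<in> carrier (tensor_power d A)"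
      by (rule hom_in_carrier[OF tensor_map_hom[OF A A permute_multilinear[OF A s]] t])
    have "?f (tensor_map d A (permute_list \<sigma>) t) = tensor_map d B (\<lambda>xs. map f (permute_list \<sigma> xs)) t"
      by (rule tensor_map_comp[OF A A B permute_multilinear[OF A s] map_multilinear[OF A B f], symmetric])
        (use t in auto)
    also have "\<dots> = tensor_map d B (permute_list \<sigma>) (?f t)"
      by (rule tensor_map_comp[OF A B B map_multilinear[OF A B f] permute_multilinear[OF B s]])
        (use t s in \<open>auto simp: tuples_def permute_list_map\<close>)
    finally have "?f (tensor_map d A (permute_list \<sigma>) t \<otimes>\<^bsub>tensor_power d A\<^esub> inv\<^bsub>tensor_power d A\<^esub> t)
      = tensor_map d B (permute_list \<sigma>) (?f t) \<otimes>\<^bsub>tensor_power d B\<^esub> inv\<^bsub>tensor_power d B\<^esub> ?f t"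
      using t p by simp
    moreover have "?f t \<in> carrier (tensor_power d B)" using t by simp
    ultimately show "?f (tensor_map d A (permute_list \<sigma>) t \<otimes>\<^bsub>tensor_power d A\<^esub> inv\<^bsub>tensor_power d A\<^esub> t) \<in> generate (tensor_power d B) {tensor_map d B (permute_list \<sigma>) t \<otimes>\<^bsub>tensor_power d B\<^esub> inv\<^bsub>tensor_power d B\<^esub> t |\<sigma> t.
         \<sigma> permutes {..<d} \<and> t \<in> carrier (tensor_power d B)}"
      using s by (intro generate.incl) auto
  qed
qed (auto intro: coinvariant_gens_carrier[OF A] coinvariant_gens_carrier[OF B])

lemma is_gr_functor_sym:
  assumes F: "is_gr_functor F"
  shows "is_gr_functor (sym_functor d F)"
proof -
  have G: "group (obj F n)" for n
    using F by (auto simp: is_gr_functor_def comm_group_def)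
  have h: "mor F m n f \<in> hom (obj F m) (obj F n)" if "f \<in> gr_hom m n" for m n f
    using F that by (auto simp: is_gr_functor_def)
  note N = normal_coinvariant_rels[OF G]
  have T: "tensor_map d (obj F n) (map (mor F m n f)) \<in> hom (tensor_power d (obj F m)) (tensor_power d (obj F n))"
    if "f \<in> gr_hom m n" for m n f
    by (rule tensor_map_hom[OF G G map_multilinear[OF G G h[OF that]]])
  have R: "tensor_map d (obj F n) (map (mor F m n f)) ` coinvariant_rels d (obj F m) \<subseteq> coinvariant_rels d (obj F n)"
    if "f \<in> gr_hom m n" for m n f
    by (rule coinvariant_rels_image[OF G G h[OF that]])
  show ?thesis
    unfolding is_gr_functor_def sym_functor_def sym_power_def sym_map_def gr_functor.simps
  proof (intro conjI allI ballI)
    show "comm_group (tensor_power d (obj F n) Mod coinvariant_rels d (obj F n))" for n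
      by (intro comm_group.abelian_FactGroup comm_group_tensor_power G normal_imp_subgroup N)
    show "quot_map (tensor_power d (obj F n)) (coinvariant_rels d (obj F n)) (tensor_map d (obj F n) (map (mor F m n f)))
       \<in> hom (tensor_power d (obj F m) Mod coinvariant_rels d (obj F m)) (tensor_power d (obj F n) Mod coinvariant_rels d (obj F n))"
      if "f \<in> gr_hom m n" for m n f
      by (rule quot_map_hom[OF N N T[OF that] R[OF that]])
    show "quot_map (tensor_power d (obj F n)) (coinvariant_rels d (obj F n)) (tensor_map d (obj F n) (map (mor F n n (gr_id n)))) x = x"
      if "x \<in> carrier (tensor_power d (obj F n) Mod coinvariant_rels d (obj F n))" for n x
    proof (rule quot_map_id[OF N _ that])
      fix t assume "t \<in> carrier (tensor_power d (obj F n))"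
      then show "tensor_map d (obj F n) (map (mor F n n (gr_id n))) t = t"
        unfolding tensor_map_def tensor_power_def
      proof (rule quot_map_id[OF normal_multilinear_rels[OF G], rotated])
        fix c assume "c \<in> carrier (free_Abelian_group (tuples d (obj F n)))"
        then have "Poly_Mapping.keys c \<subseteq> tuples d (obj F n)" by simp
        then show "frag_extend (\<lambda>xs. frag_of (map (mor F n n (gr_id n)) xs)) c = c"
          by (rule frag_map_id) (use F in \<open>auto simp: is_gr_functor_def tuples_def intro!: map_idI\<close>)
      qed
    qed
    show "quot_map (tensor_power d (obj F n)) (coinvariant_rels d (obj F n)) (tensor_map d (obj F n) (map (mor F l n (gr_comp l g f)))) x
       = quot_map (tensor_power d (obj F n)) (coinvariant_rels d (obj F n)) (tensor_map d (obj F n) (map (mor F m n g)))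
          (quot_map (tensor_power d (obj F m)) (coinvariant_rels d (obj F m)) (tensor_map d (obj F m) (map (mor F l m f))) x)"
      if f: "f \<in> gr_hom l m" and g: "g \<in> gr_hom m n"
        and x: "x \<in> carrier (tensor_power d (obj F l) Mod coinvariant_rels d (obj F l))" for l m n f g x
    proof (rule quot_map_comp[OF N N N T[OF f] R[OF f] T[OF g] R[OF g] _ x])
      fix t assume "t \<in> carrier (tensor_power d (obj F l))"
      then show "tensor_map d (obj F n) (map (mor F l n (gr_comp l g f))) t
         = tensor_map d (obj F n) (map (mor F m n g)) (tensor_map d (obj F m) (map (mor F l m f)) t)"
        by (rule tensor_map_comp[OF G G G map_multilinear[OF G G h[OF f]] map_multilinear[OF G G h[OF g]], rotated])
          (use F f g in \<open>auto simp: is_gr_functor_def tuples_def subset_iff\<close>)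
    qed
  qed
qed


section \<open>The resolution is projective and exact\<close>

context comm_group begin

lemma free_lift_eq:
  assumes "f ` S \<subseteq> carrier G" "finite K" "Poly_Mapping.keys c \<subseteq> K" "K \<subseteq> S"
  shows "free_lift G f c = finprod G (\<lambda>a. f a [^] Poly_Mapping.lookup c a) K"
  unfolding free_lift_def
proof (rule finprod_mono_neutral_cong_left)
  show "(\<lambda>a. f a [^] Poly_Mapping.lookup c a) \<in> K \<rightarrow> carrier G"
    using assms by (auto intro!: int_pow_closed)
  show "f i [^] Poly_Mapping.lookup c i = \<one>" if "i \<in> K - Poly_Mapping.keys c" for i
    using that by (auto simp: in_keys_iff)
qed (use assms in auto)

lemma free_lift_hom:
  assumes "f ` S \<subseteq> carrier G"
  shows "free_lift G f \<in> hom (free_Abelian_group S) G"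
proof (rule homI)
  fix c assume "c \<in> carrier (free_Abelian_group S)"
  then show "free_lift G f c \<in> carrier G"
    using assms unfolding free_lift_def by (intro finprod_closed) auto
next
  fix c d assume cd: "c \<in> carrier (free_Abelian_group S)" "d \<in> carrier (free_Abelian_group S)"
  let ?K = "Poly_Mapping.keys c \<union> Poly_Mapping.keys d"
  have K: "finite ?K" "?K \<subseteq> S" "Poly_Mapping.keys (c + d) \<subseteq> ?K" using cd keys_add[of c d] by auto
  have f: "f a \<in> carrier G" if "a \<in> ?K" for a using that K(2) assms by auto
  have "finprod G (\<lambda>a. f a [^] Poly_Mapping.lookup (c + d) a) ?K
    = finprod G (\<lambda>a. f a [^] Poly_Mapping.lookup c a \<otimes> f a [^] Poly_Mapping.lookup d a) ?K"
    by (rule finprod_cong') (auto simp: Poly_Mapping.lookup_add int_pow_mult f)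
  also have "\<dots> = finprod G (\<lambda>a. f a [^] Poly_Mapping.lookup c a) ?K \<otimes> finprod G (\<lambda>a. f a [^] Poly_Mapping.lookup d a) ?K"
    by (rule finprod_multf) (auto simp: f)
  finally show "free_lift G f (c \<otimes>\<^bsub>free_Abelian_group S\<^esub> d) = free_lift G f c \<otimes> free_lift G f d"
    using K by (simp add: free_lift_eq[OF assms, of ?K])
qed

lemma free_lift_of: "f a \<in> carrier G \<Longrightarrow> free_lift G f (frag_of a) = f a"
  by (subst free_lift_eq[of f "{a}" "{a}"]) (auto simp: int_pow_1)

end

lemma hom_free_eqI:
  assumes "group G" "h \<in> hom (free_Abelian_group S) G" "k \<in> hom (free_Abelian_group S) G"
    and "\<And>a. a \<in> S \<Longrightarrow> h (frag_of a) = k (frag_of a)" and c: "Poly_Mapping.keys c \<subseteq> S"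
  shows "h c = k c"
proof -
  interpret h: group_hom "free_Abelian_group S" G h using assms by (simp add: group_hom_def group_hom_axioms_def)
  interpret k: group_hom "free_Abelian_group S" G k using assms by (simp add: group_hom_def group_hom_axioms_def)
  show ?thesis
  proof (rule free_Abelian_group_induct[OF c])
    show "h 0 = k 0" using h.hom_one k.hom_one by simp
    fix x y assume xy: "Poly_Mapping.keys x \<subseteq> S" "Poly_Mapping.keys y \<subseteq> S" "h x = k x" "h y = k y"
    have "x - y = x \<otimes>\<^bsub>free_Abelian_group S\<^esub> inv\<^bsub>free_Abelian_group S\<^esub> y" using xy by simp
    then show "h (x - y) = k (x - y)" using xy
      by (metis carrier_free_Abelian_group_iff h.hom_mult h.hom_inv k.hom_mult k.hom_inv h.G.inv_closed)
  qed (use assms in auto)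
qed

lemma frag_extend_hom:
  assumes "\<And>a. a \<in> S \<Longrightarrow> Poly_Mapping.keys (f a) \<subseteq> T"
  shows "frag_extend f \<in> hom (free_Abelian_group S) (free_Abelian_group T)"
proof (rule homI)
  fix c assume "c \<in> carrier (free_Abelian_group S)"
  then have "Poly_Mapping.keys c \<subseteq> S" by simp
  then show "frag_extend f c \<in> carrier (free_Abelian_group T)"
    using keys_frag_extend[of f c] assms by fastforce
qed (simp add: frag_extend_add)

lemma push_hom:
  assumes "f \<in> gr_hom m n"
  shows "push f \<in> hom (free_Abelian_group (cells B m)) (free_Abelian_group (cells B n))"
  unfolding push_def by (rule frag_extend_hom) (use assms in \<open>auto simp: cells_def\<close>)

lemma push_keys: "f \<in> gr_hom m n \<Longrightarrow> Poly_Mapping.keys c \<subseteq> cells B m \<Longrightarrow> Poly_Mapping.keys (push f c) \<subseteq> cells B n"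
  using hom_in_carrier[OF push_hom, of f m n c B] by simp

lemma push_of [simp]: "push f (frag_of (g, h)) = frag_of (g, gr_comp (rank g) f h)"
  by (simp add: push_def)

lemma push_0 [simp]: "push f 0 = 0"
  by (simp add: push_def)

lemma push_diff: "push f (c - d) = push f c - push f d"
  by (simp add: push_def frag_extend_diff)

lemma push_id: "Poly_Mapping.keys c \<subseteq> cells B n \<Longrightarrow> push (gr_id n) c = c"
  by (rule frag_induction[of c "cells B n"]) (auto simp: push_diff cells_def gr_comp_id_left)

lemma push_comp:
  assumes "Poly_Mapping.keys c \<subseteq> cells B l"
  shows "push (gr_comp l g f) c = push g (push f c)"
  using assms
  by (rule frag_induction) (auto simp: push_diff cells_def gr_comp_assoc)

lemma is_gr_functor_free: "is_gr_functor (free_functor B)"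
  unfolding is_gr_functor_def free_functor_def gr_functor.simps
  by (simp add: abelian_free_Abelian_group push_hom push_id push_comp)

lemma obj_free [simp]: "obj (free_functor B) n = free_Abelian_group (cells B n)"
  and mor_free [simp]: "mor (free_functor B) m n f = push f"
  by (simp_all add: free_functor_def)

lemma obj_resolution [simp]: "obj (resolution F k) n = free_Abelian_group (cells (res_gens F k) n)"
  and mor_resolution [simp]: "mor (resolution F k) m n f = push f"
  by (simp_all add: resolution_def)

lemma gr_functorD:
  assumes "is_gr_functor F"
  shows "comm_group (obj F n)" "group (obj F n)"
    "f \<in> gr_hom m n \<Longrightarrow> mor F m n f \<in> hom (obj F m) (obj F n)"
    "x \<in> carrier (obj F n) \<Longrightarrow> mor F n n (gr_id n) x = x"
    "f \<in> gr_hom l m \<Longrightarrow> g \<in> gr_hom m n \<Longrightarrow> x \<in> carrier (obj F l) \<Longrightarrow>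
       mor F l n (gr_comp l g f) x = mor F m n g (mor F l m f x)"
  using assms by (simp_all add: is_gr_functor_def comm_group_def)

lemma nat_transD:
  assumes "\<eta> \<in> nat_trans F G"
  shows "\<eta> n \<in> hom (obj F n) (obj G n)" "\<eta> n \<in> extensional (carrier (obj F n))"
    "f \<in> gr_hom m n \<Longrightarrow> x \<in> carrier (obj F m) \<Longrightarrow> \<eta> n (mor F m n f x) = mor G m n f (\<eta> m x)"
  using assms by (simp_all add: nat_trans_def)

theorem free_functor_projective:
  fixes A :: "'b gr_functor" and C :: "'c gr_functor"
  assumes A: "is_gr_functor A" and C: "is_gr_functor C"
    and e: "\<epsilon> \<in> nat_trans A C" and surj: "\<And>n. \<epsilon> n ` carrier (obj A n) = carrier (obj C n)"
    and phi: "\<phi> \<in> nat_trans (free_functor B) C"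
  shows "\<exists>\<psi> \<in> nat_trans (free_functor B) A.
           \<forall>n. \<forall>c \<in> carrier (obj (free_functor B) n). \<epsilon> n (\<psi> n c) = \<phi> n c"
proof -
  have phi_hom: "\<phi> n \<in> hom (free_Abelian_group (cells B n)) (obj C n)" for n
    using phi by (simp add: nat_trans_def)
  have e_hom: "\<epsilon> n \<in> hom (obj A n) (obj C n)" for n using e by (simp add: nat_trans_def)
  have gA: "comm_group (obj A n)" and gC: "comm_group (obj C n)" for n
    using A C by (auto simp: is_gr_functor_def)
  have mA: "mor A m n f \<in> hom (obj A m) (obj A n)" if "f \<in> gr_hom m n" for m n f
    using A that by (auto simp: is_gr_functor_def)
  have "\<exists>x \<in> carrier (obj A (rank g)). \<epsilon> (rank g) x = \<phi> (rank g) (frag_of (g, gr_id (rank g)))"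
    if "g \<in> B" for g
  proof -
    have "frag_of (g, gr_id (rank g)) \<in> carrier (free_Abelian_group (cells B (rank g)))"
      using that by (simp add: cells_def)
    then have "\<phi> (rank g) (frag_of (g, gr_id (rank g))) \<in> carrier (obj C (rank g))"
      by (rule hom_in_carrier[OF phi_hom])
    then show ?thesis using surj[of "rank g"] by (metis imageE)
  qed
  then obtain l where l: "\<And>g. g \<in> B \<Longrightarrow> l g \<in> carrier (obj A (rank g))"
     "\<And>g. g \<in> B \<Longrightarrow> \<epsilon> (rank g) (l g) = \<phi> (rank g) (frag_of (g, gr_id (rank g)))" by metis
  define v where "v n = (\<lambda>(g, h). mor A (rank g) n h (l g))" for n
  have v: "v n ` cells B n \<subseteq> carrier (obj A n)" for n
    using l(1) by (auto simp: v_def cells_def intro: hom_in_carrier[OF mA])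
  define \<psi> where "\<psi> n = restrict (free_lift (obj A n) (v n)) (carrier (free_Abelian_group (cells B n)))" for n
  have lift: "free_lift (obj A n) (v n) \<in> hom (free_Abelian_group (cells B n)) (obj A n)" for n
    by (rule comm_group.free_lift_hom[OF gA v])
  have psi_hom: "\<psi> n \<in> hom (free_Abelian_group (cells B n)) (obj A n)" for n
  proof (rule homI)
    fix c d assume cd: "c \<in> carrier (free_Abelian_group (cells B n))" "d \<in> carrier (free_Abelian_group (cells B n))"
    show "\<psi> n c \<in> carrier (obj A n)"
      using hom_in_carrier[OF lift cd(1)] cd by (simp add: \<psi>_def)
    have "c \<otimes>\<^bsub>free_Abelian_group (cells B n)\<^esub> d \<in> carrier (free_Abelian_group (cells B n))"
      using cd by (intro monoid.m_closed group.is_monoid group_free_Abelian_group)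
    then show "\<psi> n (c \<otimes>\<^bsub>free_Abelian_group (cells B n)\<^esub> d) = \<psi> n c \<otimes>\<^bsub>obj A n\<^esub> \<psi> n d"
      using hom_mult[OF lift cd] cd by (simp add: \<psi>_def del: carrier_free_Abelian_group_iff)
  qed
  have psi_of: "\<psi> n (frag_of (g, h)) = mor A (rank g) n h (l g)" if "(g, h) \<in> cells B n" for n g h
  proof -
    have "v n (g, h) \<in> carrier (obj A n)" using v that by blast
    then show ?thesis using comm_group.free_lift_of[OF gA, of "v n"] that by (simp add: \<psi>_def v_def)
  qed
  have "\<psi> \<in> nat_trans (free_functor B) A"
    unfolding nat_trans_def
  proof (intro CollectI conjI allI ballI)
    show "\<psi> n \<in> hom (obj (free_functor B) n) (obj A n) \<inter> extensional (carrier (obj (free_functor B) n))" for n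
      using psi_hom by (simp add: \<psi>_def)
    show "\<psi> n (mor (free_functor B) m n f x) = mor A m n f (\<psi> m x)"
      if f: "f \<in> gr_hom m n" and x: "x \<in> carrier (obj (free_functor B) m)" for m n f x
    proof -
      have k: "Poly_Mapping.keys x \<subseteq> cells B m" using x by simp
      have "(\<lambda>x. \<psi> n (push f x)) x = (\<lambda>x. mor A m n f (\<psi> m x)) x"
      proof (rule hom_free_eqI[OF _ _ _ _ k])
        show "group (obj A n)" using gA comm_group.axioms(2) by blast
        show "(\<lambda>x. \<psi> n (push f x)) \<in> hom (free_Abelian_group (cells B m)) (obj A n)"
          using Group.hom_compose[OF push_hom[OF f] psi_hom] by (simp add: comp_def)
        show "(\<lambda>x. mor A m n f (\<psi> m x)) \<in> hom (free_Abelian_group (cells B m)) (obj A n)"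
          using Group.hom_compose[OF psi_hom mA[OF f]] by (simp add: comp_def)
        fix a assume a: "a \<in> cells B m"
        obtain g h where gh: "a = (g, h)" by force
        have "(g, gr_comp (rank g) f h) \<in> cells B n" using a gh f by (auto simp: cells_def)
        then show "\<psi> n (push f (frag_of a)) = mor A m n f (\<psi> m (frag_of a))"
          using a gh f gr_functorD(5)[OF A _ f l(1)] by (auto simp: psi_of cells_def)
      qed
      then show ?thesis by simp
    qed
  qed
  moreover have "\<epsilon> n (\<psi> n c) = \<phi> n c" if "Poly_Mapping.keys c \<subseteq> cells B n" for n c
  proof -
    have "(\<lambda>x. \<epsilon> n (\<psi> n x)) c = \<phi> n c"
    proof (rule hom_free_eqI[OF _ _ phi_hom _ that])
      show "group (obj C n)" using gC comm_group.axioms(2) by blast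
      show "(\<lambda>x. \<epsilon> n (\<psi> n x)) \<in> hom (free_Abelian_group (cells B n)) (obj C n)"
        using Group.hom_compose[OF psi_hom e_hom] by (simp add: comp_def)
      fix a assume a: "a \<in> cells B n"
      obtain g h where gh: "a = (g, h)" by force
      then have g: "g \<in> B" "h \<in> gr_hom (rank g) n" using a by (auto simp: cells_def)
      have fg: "frag_of (g, gr_id (rank g)) \<in> carrier (obj (free_functor B) (rank g))"
        using g by (simp add: cells_def)
      have "\<epsilon> n (\<psi> n (frag_of a)) = mor C (rank g) n h (\<epsilon> (rank g) (l g))"
        using psi_of[of g h n] a gh nat_transD(3)[OF e g(2) l(1)[OF g(1)]] by simp
      also have "\<dots> = \<phi> n (mor (free_functor B) (rank g) n h (frag_of (g, gr_id (rank g))))"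
        using nat_transD(3)[OF phi g(2) fg] l(2)[OF g(1)] by simp
      also have "\<dots> = \<phi> n (frag_of a)" using g gh by (simp add: gr_comp_id_right)
      finally show "\<epsilon> n (\<psi> n (frag_of a)) = \<phi> n (frag_of a)" .
    qed
    then show ?thesis by simp
  qed
  ultimately show ?thesis by (intro bexI[of _ \<psi>]) auto
qed

declare res_gens.simps [simp del]

lemma lincomb_simps [simp]:
  "lincomb [] = 0" "lincomb ((c, g, h) # L) = frag_cmul c (frag_of (g, h)) + lincomb L"
  by (simp_all add: lincomb_def)

lemma keys_lincomb:
  "\<forall>(c, g, h) \<in> set L. (g, h) \<in> S \<Longrightarrow> Poly_Mapping.keys (lincomb L) \<subseteq> S"
  by (induction L) (auto dest!: subsetD[OF keys_add])

lemma res_gens_SucE: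
  assumes "g \<in> res_gens F (Suc k)"
  obtains n L where "g = Cyc n L" "Poly_Mapping.keys (lincomb L) \<subseteq> cells (res_gens F k) n"
    "if k = 0 then augmentation F n (lincomb L) = \<one>\<^bsub>obj F n\<^esub> else boundary (lincomb L) = 0"
  using assms keys_lincomb unfolding res_gens.simps by blast

lemma cells_SucE:
  assumes "a \<in> cells (res_gens F (Suc k)) n"
  obtains m L h where "a = (Cyc m L, h)" "Cyc m L \<in> res_gens F (Suc k)" "h \<in> gr_hom m n"
    "if k = 0 then augmentation F m (lincomb L) = \<one>\<^bsub>obj F m\<^esub> else boundary (lincomb L) = 0"
proof -
  obtain g h where a: "a = (g, h)" "g \<in> res_gens F (Suc k)" "h \<in> gr_hom (rank g) n"
    using assms by (auto simp: cells_def)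
  show thesis using a(2)
  proof (rule res_gens_SucE)
    fix m L assume "g = Cyc m L"
      "if k = 0 then augmentation F m (lincomb L) = \<one>\<^bsub>obj F m\<^esub> else boundary (lincomb L) = 0"
    then show thesis using a that[of m L h] by simp
  qed
qed

lemma lincomb_append: "lincomb (L @ M) = lincomb L + lincomb M"
  by (simp add: lincomb_def)

lemma lincomb_minus: "lincomb (map (\<lambda>(c, x). (- c, x)) L) = - lincomb L"
  by (induction L) (auto simp flip: minus_frag_cmul)

lemma ex_lincomb:
  assumes "Poly_Mapping.keys x \<subseteq> S"
  shows "\<exists>L. (\<forall>(c, g, h) \<in> set L. (g, h) \<in> S) \<and> lincomb L = x"
  using assms
proof (rule free_Abelian_group_induct)
  show "\<exists>L. (\<forall>(c, g, h) \<in> set L. (g, h) \<in> S) \<and> lincomb L = 0"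
    by (rule exI[of _ "[]"]) simp
  show "\<exists>L. (\<forall>(c, g, h) \<in> set L. (g, h) \<in> S) \<and> lincomb L = frag_of a" if "a \<in> S" for a
    using that by (intro exI[of _ "[(1, a)]"]) (cases a, simp)
  fix x y
  assume "\<exists>L. (\<forall>(c, g, h) \<in> set L. (g, h) \<in> S) \<and> lincomb L = x"
    "\<exists>L. (\<forall>(c, g, h) \<in> set L. (g, h) \<in> S) \<and> lincomb L = y"
  then obtain L M where "\<forall>(c, g, h) \<in> set L. (g, h) \<in> S" "lincomb L = x"
    "\<forall>(c, g, h) \<in> set M. (g, h) \<in> S" "lincomb M = y" by blast
  then show "\<exists>L. (\<forall>(c, g, h) \<in> set L. (g, h) \<in> S) \<and> lincomb L = x - y"
    by (intro exI[of _ "L @ map (\<lambda>(c, x). (- c, x)) M"]) (auto simp: lincomb_append lincomb_minus)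
qed

lemma gen_boundary_keys:
  "g \<in> res_gens F (Suc k) \<Longrightarrow> Poly_Mapping.keys (gen_boundary g) \<subseteq> cells (res_gens F k) (rank g)"
  by (erule res_gens_SucE) simp

lemma boundary_of [simp]: "boundary (frag_of (g, h)) = push h (gen_boundary g)"
  by (simp add: boundary_def)

lemma boundary_0 [simp]: "boundary 0 = 0"
  by (simp add: boundary_def)

lemma boundary_add: "boundary (c + d) = boundary c + boundary d"
  by (simp add: boundary_def frag_extend_add)

lemma boundary_diff: "boundary (c - d) = boundary c - boundary d"
  by (simp add: boundary_def frag_extend_diff)

lemma boundary_hom:
  "boundary \<in> hom (free_Abelian_group (cells (res_gens F (Suc k)) n))
     (free_Abelian_group (cells (res_gens F k) n))"
  unfolding boundary_def
proof (rule frag_extend_hom)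
  fix a assume "a \<in> cells (res_gens F (Suc k)) n"
  then obtain g h where "a = (g, h)" "g \<in> res_gens F (Suc k)" "h \<in> gr_hom (rank g) n"
    by (auto simp: cells_def)
  then show "Poly_Mapping.keys ((\<lambda>(g, h). push h (gen_boundary g)) a) \<subseteq> cells (res_gens F k) n"
    using push_keys[OF _ gen_boundary_keys, of h g n F k] by simp
qed

lemma boundary_keys:
  "Poly_Mapping.keys c \<subseteq> cells (res_gens F (Suc k)) n \<Longrightarrow>
   Poly_Mapping.keys (boundary c) \<subseteq> cells (res_gens F k) n"
  using hom_in_carrier[OF boundary_hom, of c F k n] by simp

lemma boundary_push:
  assumes "f \<in> gr_hom m n" and c: "Poly_Mapping.keys c \<subseteq> cells (res_gens F (Suc k)) m"
  shows "boundary (push f c) = push f (boundary c)"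
  using c
proof (rule frag_induction)
  fix a assume "a \<in> cells (res_gens F (Suc k)) m"
  then obtain g h where a: "a = (g, h)" "g \<in> res_gens F (Suc k)" "h \<in> gr_hom (rank g) m"
    by (auto simp: cells_def)
  show "boundary (push f (frag_of a)) = push f (boundary (frag_of a))"
    using push_comp[OF gen_boundary_keys[OF a(2)], of f h] by (simp add: a(1))
qed (simp_all add: push_diff boundary_diff)

context
  fixes F :: "'a gr_functor" assumes F: "is_gr_functor F"
begin

lemma augmentation_hom:
  "augmentation F n \<in> hom (free_Abelian_group (cells (res_gens F 0) n)) (obj F n)"
  unfolding augmentation_def
  by (intro comm_group.free_lift_hom gr_functorD(1)[OF F])
    (auto simp: cells_def res_gens.simps intro: hom_in_carrier[OF gr_functorD(3)[OF F]])

lemma augmentation_of: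
  assumes "x \<in> carrier (obj F m)" "h \<in> gr_hom m n"
  shows "augmentation F n (frag_of (Elt m x, h)) = mor F m n h x"
proof -
  have "mor F m n h x \<in> carrier (obj F n)"
    by (rule hom_in_carrier[OF gr_functorD(3)[OF F assms(2)] assms(1)])
  then show ?thesis
    unfolding augmentation_def by (subst comm_group.free_lift_of[OF gr_functorD(1)[OF F]]) auto
qed

lemma augmentation_push:
  assumes f: "f \<in> gr_hom m n" and c: "Poly_Mapping.keys c \<subseteq> cells (res_gens F 0) m"
  shows "augmentation F n (push f c) = mor F m n f (augmentation F m c)"
proof -
  have "(\<lambda>c. augmentation F n (push f c)) c = (\<lambda>c. mor F m n f (augmentation F m c)) c"
  proof (rule hom_free_eqI[OF _ _ _ _ c])
    show "group (obj F n)" by (rule gr_functorD(2)[OF F])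
    show "(\<lambda>c. augmentation F n (push f c)) \<in> hom (free_Abelian_group (cells (res_gens F 0) m)) (obj F n)"
      using Group.hom_compose[OF push_hom[OF f] augmentation_hom] by (simp add: comp_def)
    show "(\<lambda>c. mor F m n f (augmentation F m c)) \<in> hom (free_Abelian_group (cells (res_gens F 0) m)) (obj F n)"
      using Group.hom_compose[OF augmentation_hom gr_functorD(3)[OF F f]] by (simp add: comp_def)
    fix a assume "a \<in> cells (res_gens F 0) m"
    then obtain l x h where a: "a = (Elt l x, h)" "x \<in> carrier (obj F l)" "h \<in> gr_hom l m"
      by (auto simp: cells_def res_gens.simps)
    then show "augmentation F n (push f (frag_of a)) = mor F m n f (augmentation F m (frag_of a))"
      using f by (simp add: augmentation_of gr_functorD(5)[OF F])
  qed
  then show ?thesis by simp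
qed

lemma augmentation_surj:
  "augmentation F n ` carrier (obj (resolution F 0) n) = carrier (obj F n)"
proof
  show "augmentation F n ` carrier (obj (resolution F 0) n) \<subseteq> carrier (obj F n)"
    using hom_carrier[OF augmentation_hom] by simp
  show "carrier (obj F n) \<subseteq> augmentation F n ` carrier (obj (resolution F 0) n)"
  proof
    fix x assume x: "x \<in> carrier (obj F n)"
    have "x = augmentation F n (frag_of (Elt n x, gr_id n))"
      using x by (simp add: augmentation_of gr_functorD(4)[OF F])
    then show "x \<in> augmentation F n ` carrier (obj (resolution F 0) n)"
      using x by (intro image_eqI) (auto simp: cells_def res_gens.simps)
  qed
qed

lemma augmentation_boundary:
  assumes c: "Poly_Mapping.keys c \<subseteq> cells (res_gens F 1) n"
  shows "augmentation F n (boundary c) = \<one>\<^bsub>obj F n\<^esub>"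
proof -
  have "(\<lambda>c. augmentation F n (boundary c)) c = (\<lambda>c. \<one>\<^bsub>obj F n\<^esub>) c"
  proof (rule hom_free_eqI[OF _ _ _ _ c])
    interpret group "obj F n" by (rule gr_functorD(2)[OF F])
    show "group (obj F n)" by (rule gr_functorD(2)[OF F])
    show "(\<lambda>c. augmentation F n (boundary c)) \<in> hom (free_Abelian_group (cells (res_gens F 1) n)) (obj F n)"
      using Group.hom_compose[OF boundary_hom[of F 0] augmentation_hom] by (simp add: comp_def)
    show "(\<lambda>c. \<one>\<^bsub>obj F n\<^esub>) \<in> hom (free_Abelian_group (cells (res_gens F 1) n)) (obj F n)"
      by (rule homI) auto
    fix a assume "a \<in> cells (res_gens F 1) n"
    then have "a \<in> cells (res_gens F (Suc 0)) n" by simp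
    then obtain m L h where a: "a = (Cyc m L, h)" "Cyc m L \<in> res_gens F (Suc 0)"
      "augmentation F m (lincomb L) = \<one>\<^bsub>obj F m\<^esub>" "h \<in> gr_hom m n"
      by (rule cells_SucE) simp
    have k: "Poly_Mapping.keys (lincomb L) \<subseteq> cells (res_gens F 0) m"
      using gen_boundary_keys[OF a(2)] by simp
    interpret h: group_hom "obj F m" "obj F n" "mor F m n h"
      using gr_functorD[OF F] a(4) by (simp add: group_hom_def group_hom_axioms_def)
    show "augmentation F n (boundary (frag_of a)) = \<one>\<^bsub>obj F n\<^esub>"
      using a(3) by (simp add: a(1) augmentation_push[OF a(4) k])
  qed
  then show ?thesis by simp
qed

lemma boundary_boundary:
  assumes c: "Poly_Mapping.keys c \<subseteq> cells (res_gens F (Suc (Suc k))) n"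
  shows "boundary (boundary c) = 0"
  using c
proof (rule frag_induction)
  fix a assume "a \<in> cells (res_gens F (Suc (Suc k))) n"
  then obtain m L h where a: "a = (Cyc m L, h)" "Cyc m L \<in> res_gens F (Suc (Suc k))"
    "boundary (lincomb L) = 0" "h \<in> gr_hom m n"
    by (rule cells_SucE) simp
  have "Poly_Mapping.keys (lincomb L) \<subseteq> cells (res_gens F (Suc k)) m"
    using gen_boundary_keys[OF a(2)] by simp
  then show "boundary (boundary (frag_of a)) = 0"
    using a(3) by (simp add: a(1) boundary_push[OF a(4)])
qed (simp_all add: boundary_diff)

lemma cycle_is_boundary:
  assumes c: "Poly_Mapping.keys c \<subseteq> cells (res_gens F k) n"
    and z: "if k = 0 then augmentation F n c = \<one>\<^bsub>obj F n\<^esub> else boundary c = 0"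
  shows "c \<in> boundary ` carrier (obj (resolution F (Suc k)) n)"
proof -
  obtain L where L: "\<forall>(c, g, h) \<in> set L. (g, h) \<in> cells (res_gens F k) n" "lincomb L = c"
    using ex_lincomb[OF c] by blast
  have "Cyc n L \<in> res_gens F (Suc k)" using L z by (simp add: res_gens.simps)
  then have "frag_of (Cyc n L, gr_id n) \<in> carrier (obj (resolution F (Suc k)) n)"
    by (simp add: cells_def)
  moreover have "boundary (frag_of (Cyc n L, gr_id n)) = c"
    using c L by (simp add: push_id)
  ultimately show ?thesis by (metis imageI)
qed

theorem resolution_exact_0:
  "kernel (obj (resolution F 0) n) (obj F n) (augmentation F n)
     = boundary ` carrier (obj (resolution F 1) n)"
proof
  show "kernel (obj (resolution F 0) n) (obj F n) (augmentation F n)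
     \<subseteq> boundary ` carrier (obj (resolution F 1) n)"
  proof
    fix c assume "c \<in> kernel (obj (resolution F 0) n) (obj F n) (augmentation F n)"
    then show "c \<in> boundary ` carrier (obj (resolution F 1) n)"
      using cycle_is_boundary[of c 0 n] by (simp add: kernel_def)
  qed
  show "boundary ` carrier (obj (resolution F 1) n)
     \<subseteq> kernel (obj (resolution F 0) n) (obj F n) (augmentation F n)"
    using augmentation_boundary[of _ n] boundary_keys[of _ F 0 n]
    by (clarsimp simp: kernel_def)
qed

theorem resolution_exact_Suc:
  "kernel (obj (resolution F (Suc k)) n) (obj (resolution F k) n) boundary
     = boundary ` carrier (obj (resolution F (Suc (Suc k))) n)"
proof
  show "kernel (obj (resolution F (Suc k)) n) (obj (resolution F k) n) boundary
     \<subseteq> boundary ` carrier (obj (resolution F (Suc (Suc k))) n)"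
  proof
    fix c assume "c \<in> kernel (obj (resolution F (Suc k)) n) (obj (resolution F k) n) boundary"
    then show "c \<in> boundary ` carrier (obj (resolution F (Suc (Suc k))) n)"
      using cycle_is_boundary[of c "Suc k" n] by (simp add: kernel_def)
  qed
  show "boundary ` carrier (obj (resolution F (Suc (Suc k))) n)
     \<subseteq> kernel (obj (resolution F (Suc k)) n) (obj (resolution F k) n) boundary"
    using boundary_keys[of _ F "Suc k" n] boundary_boundary[of _ k n]
    by (clarsimp simp: kernel_def)
qed

end


section \<open>Ext is an abelian group\<close>

lemma comm_group_Hom_group:
  assumes F: "is_gr_functor F" and G: "is_gr_functor G"
  shows "comm_group (Hom_group F G)"
proof (rule comm_groupI)
  have cG: "comm_group (obj G n)" for n by (rule gr_functorD(1)[OF G])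
  have gG: "group (obj G n)" for n by (rule gr_functorD(2)[OF G])
  have mF: "monoid (obj F n)" for n using gr_functorD(2)[OF F] by (rule group.is_monoid)
  note mG = group.is_monoid[OF gG]
  have cl: "\<eta> n x \<in> carrier (obj G n)" if "\<eta> \<in> nat_trans F G" "x \<in> carrier (obj F n)" for \<eta> n x
    using hom_in_carrier[OF nat_transD(1)[OF that(1)] that(2)] .
  have mF': "mor F m n f x \<in> carrier (obj F n)" if "f \<in> gr_hom m n" "x \<in> carrier (obj F m)" for m n f x
    using hom_in_carrier[OF gr_functorD(3)[OF F that(1)] that(2)] .
  have gh: "group_hom (obj G m) (obj G n) (mor G m n f)" if "f \<in> gr_hom m n" for m n f
    using that by (simp add: group_hom_def group_hom_axioms_def gG gr_functorD(3)[OF G])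
  show "\<eta> \<otimes>\<^bsub>Hom_group F G\<^esub> \<theta> \<in> carrier (Hom_group F G)"
    if "\<eta> \<in> carrier (Hom_group F G)" "\<theta> \<in> carrier (Hom_group F G)" for \<eta> \<theta>
  proof -
    have e: "\<eta> \<in> nat_trans F G" "\<theta> \<in> nat_trans F G" using that by (simp_all add: Hom_group_def)
    have "(\<lambda>n. \<lambda>x \<in> carrier (obj F n). \<eta> n x \<otimes>\<^bsub>obj G n\<^esub> \<theta> n x) \<in> nat_trans F G"
      unfolding nat_trans_def
    proof (intro CollectI conjI allI ballI IntI)
      fix n
      interpret comm_group "obj G n" by (rule cG)
      show "(\<lambda>x \<in> carrier (obj F n). \<eta> n x \<otimes>\<^bsub>obj G n\<^esub> \<theta> n x) \<in> hom (obj F n) (obj G n)"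
        by (rule homI) (simp_all add: cl[OF e(1)] cl[OF e(2)] monoid.m_closed[OF mF]
            hom_mult[OF nat_transD(1)[OF e(1)]] hom_mult[OF nat_transD(1)[OF e(2)]] m_ac)
    next
      fix m n f x assume fx: "f \<in> gr_hom m n" "x \<in> carrier (obj F m)"
      interpret f: group_hom "obj G m" "obj G n" "mor G m n f" by (rule gh[OF fx(1)])
      show "(\<lambda>x \<in> carrier (obj F n). \<eta> n x \<otimes>\<^bsub>obj G n\<^esub> \<theta> n x) (mor F m n f x)
        = mor G m n f ((\<lambda>x \<in> carrier (obj F m). \<eta> m x \<otimes>\<^bsub>obj G m\<^esub> \<theta> m x) x)"
        using fx by (simp add: cl[OF e(1)] cl[OF e(2)] mF' nat_transD(3)[OF e(1)] nat_transD(3)[OF e(2)])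
    qed simp
    then show ?thesis by (simp add: Hom_group_def)
  qed
  show "\<one>\<^bsub>Hom_group F G\<^esub> \<in> carrier (Hom_group F G)"
  proof -
    have "(\<lambda>n. \<lambda>x \<in> carrier (obj F n). \<one>\<^bsub>obj G n\<^esub>) \<in> nat_trans F G"
      unfolding nat_trans_def
    proof (intro CollectI conjI allI ballI IntI)
      show "(\<lambda>x \<in> carrier (obj F n). \<one>\<^bsub>obj G n\<^esub>) \<in> hom (obj F n) (obj G n)" for n
        by (rule homI) (simp_all add: monoid.m_closed[OF mF] monoid.one_closed[OF mG] monoid.l_one[OF mG])
      show "(\<lambda>x \<in> carrier (obj F n). \<one>\<^bsub>obj G n\<^esub>) (mor F m n f x)
        = mor G m n f ((\<lambda>x \<in> carrier (obj F m). \<one>\<^bsub>obj G m\<^esub>) x)"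
        if "f \<in> gr_hom m n" "x \<in> carrier (obj F m)" for m n f x
        using that mF'[OF that] group_hom.hom_one[OF gh[OF that(1)]] by simp
    qed simp
    then show ?thesis by (simp add: Hom_group_def)
  qed
  have ext: "\<eta> = \<theta>" if "\<And>n x. x \<in> carrier (obj F n) \<Longrightarrow> \<eta> n x = \<theta> n x"
    "\<And>n. \<eta> n \<in> extensional (carrier (obj F n))" "\<And>n. \<theta> n \<in> extensional (carrier (obj F n))"
    for \<eta> \<theta> :: "nat \<Rightarrow> 'a \<Rightarrow> 'b"
  proof
    show "\<eta> n = \<theta> n" for n by (rule extensionalityI[OF that(2,3)]) (rule that(1))
  qed
  show "\<eta> \<otimes>\<^bsub>Hom_group F G\<^esub> \<theta> \<otimes>\<^bsub>Hom_group F G\<^esub> \<zeta> = \<eta> \<otimes>\<^bsub>Hom_group F G\<^esub> (\<theta> \<otimes>\<^bsub>Hom_group F G\<^esub> \<zeta>)"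
    if "\<eta> \<in> carrier (Hom_group F G)" "\<theta> \<in> carrier (Hom_group F G)" "\<zeta> \<in> carrier (Hom_group F G)" for \<eta> \<theta> \<zeta>
    by (rule ext) (use that in \<open>simp_all add: Hom_group_def cl monoid.m_assoc[OF mG]\<close>)
  show "\<eta> \<otimes>\<^bsub>Hom_group F G\<^esub> \<theta> = \<theta> \<otimes>\<^bsub>Hom_group F G\<^esub> \<eta>"
    if "\<eta> \<in> carrier (Hom_group F G)" "\<theta> \<in> carrier (Hom_group F G)" for \<eta> \<theta>
    by (rule ext) (use that in \<open>simp_all add: Hom_group_def cl comm_monoid.m_comm[OF comm_group.axioms(1)[OF cG]]\<close>)
  show "\<one>\<^bsub>Hom_group F G\<^esub> \<otimes>\<^bsub>Hom_group F G\<^esub> \<eta> = \<eta>" if "\<eta> \<in> carrier (Hom_group F G)" for \<eta>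
    by (rule ext) (use that in \<open>simp_all add: Hom_group_def cl monoid.l_one[OF mG] nat_transD(2)\<close>)
  show "\<exists>\<theta>\<in>carrier (Hom_group F G). \<theta> \<otimes>\<^bsub>Hom_group F G\<^esub> \<eta> = \<one>\<^bsub>Hom_group F G\<^esub>"
    if "\<eta> \<in> carrier (Hom_group F G)" for \<eta>
  proof (rule bexI[of _ "\<lambda>n. \<lambda>x \<in> carrier (obj F n). inv\<^bsub>obj G n\<^esub> \<eta> n x"])
    have e: "\<eta> \<in> nat_trans F G" using that by (simp add: Hom_group_def)
    show "(\<lambda>n. \<lambda>x \<in> carrier (obj F n). inv\<^bsub>obj G n\<^esub> \<eta> n x) \<otimes>\<^bsub>Hom_group F G\<^esub> \<eta> = \<one>\<^bsub>Hom_group F G\<^esub>"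
      by (rule ext) (use e in \<open>simp_all add: Hom_group_def cl group.l_inv[OF gG]\<close>)
    have "(\<lambda>n. \<lambda>x \<in> carrier (obj F n). inv\<^bsub>obj G n\<^esub> \<eta> n x) \<in> nat_trans F G"
      unfolding nat_trans_def
    proof (intro CollectI conjI allI ballI IntI)
      fix n
      interpret comm_group "obj G n" by (rule cG)
      show "(\<lambda>x \<in> carrier (obj F n). inv\<^bsub>obj G n\<^esub> \<eta> n x) \<in> hom (obj F n) (obj G n)"
        by (rule homI) (simp_all add: cl[OF e] monoid.m_closed[OF mF]
            hom_mult[OF nat_transD(1)[OF e]] inv_mult)
    next
      fix m n f x assume fx: "f \<in> gr_hom m n" "x \<in> carrier (obj F m)"
      interpret f: group_hom "obj G m" "obj G n" "mor G m n f" by (rule gh[OF fx(1)])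
      show "(\<lambda>x \<in> carrier (obj F n). inv\<^bsub>obj G n\<^esub> \<eta> n x) (mor F m n f x)
        = mor G m n f ((\<lambda>x \<in> carrier (obj F m). inv\<^bsub>obj G m\<^esub> \<eta> m x) x)"
        using fx by (simp add: cl[OF e] mF' nat_transD(3)[OF e])
    qed simp
    then show "(\<lambda>n. \<lambda>x \<in> carrier (obj F n). inv\<^bsub>obj G n\<^esub> \<eta> n x) \<in> carrier (Hom_group F G)"
      by (simp add: Hom_group_def)
  qed
qed

lemma coboundary_group_hom:
  fixes F :: "'a gr_functor" and G :: "'b gr_functor"
  assumes F: "is_gr_functor F" and G: "is_gr_functor G"
  shows "group_hom (Hom_group (resolution F k) G) (Hom_group (resolution F (Suc k)) G) (coboundary k F)"
proof -
  have g: "group (Hom_group (resolution F k) G)" for k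
    using comm_group_Hom_group[OF is_gr_functor_free G, of "res_gens F k"]
    by (simp add: resolution_def comm_group_def)
  have "coboundary k F \<in> hom (Hom_group (resolution F k) G) (Hom_group (resolution F (Suc k)) G)"
  proof (rule homI)
    fix \<phi> assume "\<phi> \<in> carrier (Hom_group (resolution F k) G)"
    then have phi: "\<phi> \<in> nat_trans (resolution F k) G" by (simp add: Hom_group_def)
    have "coboundary k F \<phi> \<in> nat_trans (resolution F (Suc k)) G"
      unfolding nat_trans_def
    proof (intro CollectI conjI allI ballI IntI)
      fix n
      show "coboundary k F \<phi> n \<in> hom (obj (resolution F (Suc k)) n) (obj G n)"
      proof (rule homI)
        fix c d assume cd: "c \<in> carrier (obj (resolution F (Suc k)) n)" "d \<in> carrier (obj (resolution F (Suc k)) n)"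
        have b: "boundary c \<in> carrier (obj (resolution F k) n)" "boundary d \<in> carrier (obj (resolution F k) n)"
          using cd boundary_keys[of _ F k n] by auto
        show "coboundary k F \<phi> n c \<in> carrier (obj G n)"
          using hom_in_carrier[OF nat_transD(1)[OF phi] b(1)] cd by (simp add: coboundary_def)
        have "Poly_Mapping.keys (c + d) \<subseteq> cells (res_gens F (Suc k)) n"
          using cd keys_add[of c d] by auto
        then show "coboundary k F \<phi> n (c \<otimes>\<^bsub>obj (resolution F (Suc k)) n\<^esub> d)
            = coboundary k F \<phi> n c \<otimes>\<^bsub>obj G n\<^esub> coboundary k F \<phi> n d"
          using hom_mult[OF nat_transD(1)[OF phi] b] cd by (simp add: coboundary_def boundary_add)
      qed
    next
      fix m n f c assume f: "f \<in> gr_hom m n" and c: "c \<in> carrier (obj (resolution F (Suc k)) m)"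
      have k: "Poly_Mapping.keys c \<subseteq> cells (res_gens F (Suc k)) m" using c by simp
      show "coboundary k F \<phi> n (mor (resolution F (Suc k)) m n f c) = mor G m n f (coboundary k F \<phi> m c)"
        using nat_transD(3)[OF phi f, of "boundary c"] boundary_keys[OF k] push_keys[OF f k] boundary_push[OF f k] k
        by (simp add: coboundary_def)
    qed (simp add: coboundary_def)
    then show "coboundary k F \<phi> \<in> carrier (Hom_group (resolution F (Suc k)) G)" by (simp add: Hom_group_def)
  next
    fix \<phi> \<psi> :: "nat \<Rightarrow> 'a chain \<Rightarrow> 'b"
    show "coboundary k F (\<phi> \<otimes>\<^bsub>Hom_group (resolution F k) G\<^esub> \<psi>)
       = coboundary k F \<phi> \<otimes>\<^bsub>Hom_group (resolution F (Suc k)) G\<^esub> coboundary k F \<psi>"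
      using boundary_keys[of _ F k] by (auto simp: Hom_group_def coboundary_def fun_eq_iff)
  qed
  then show ?thesis using g by (simp add: group_hom_def group_hom_axioms_def)
qed

lemma cocycles_eq_kernel:
  assumes F: "is_gr_functor F" and G: "is_gr_functor G"
  shows "cocycles k F G = kernel (Hom_group (resolution F k) G) (Hom_group (resolution F (Suc k)) G) (coboundary k F)"
  unfolding cocycles_def kernel_def by (auto simp: Hom_group_def coboundary_def fun_eq_iff)

lemma coboundaries_Suc_eq_image:
  "coboundaries (Suc k) F G = coboundary k F ` carrier (Hom_group (resolution F k) G)"
  by (simp add: Hom_group_def)

theorem comm_group_Ext:
  assumes F: "is_gr_functor F" and G: "is_gr_functor G"
  shows "comm_group (Ext k F G)"
proof -
  interpret D: group_hom "Hom_group (resolution F i) G" "Hom_group (resolution F (Suc i)) G" "coboundary i F" for i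
    by (rule coboundary_group_hom[OF F G])
  have H: "comm_group (Hom_group (resolution F k) G)"
    by (rule comm_group_Hom_group[OF _ G]) (simp add: resolution_def is_gr_functor_free)
  have z: "subgroup (cocycles k F G) (Hom_group (resolution F k) G)"
    unfolding cocycles_eq_kernel[OF F G] by (rule D.subgroup_kernel)
  have b: "subgroup (coboundaries k F G) (Hom_group (resolution F k) G)"
  proof (cases k)
    case 0 then show ?thesis using group.triv_subgroup[OF D.G.group_axioms] by simp
  next
    case (Suc j)
    then show ?thesis using D.img_is_subgroup[of j] by (simp add: coboundaries_Suc_eq_image del: coboundaries.simps)
  qed
  have "coboundaries k F G \<subseteq> cocycles k F G"
  proof (cases k)
    case 0 then show ?thesis using subgroup.one_closed[OF z] by simp
  next
    case (Suc j)
    have "coboundary k F (coboundary j F \<phi>) = \<one>\<^bsub>Hom_group (resolution F (Suc k)) G\<^esub>"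
      if "\<phi> \<in> carrier (Hom_group (resolution F j) G)" for \<phi>
    proof -
      have phi: "\<phi> \<in> nat_trans (resolution F j) G" using that by (simp add: Hom_group_def)
      have "\<phi> n 0 = \<one>\<^bsub>obj G n\<^esub>" for n
        using hom_one[OF nat_transD(1)[OF phi] _ gr_functorD(2)[OF G], of n] by simp
      then show ?thesis
        using Suc boundary_keys[of _ F "Suc j"] boundary_boundary[OF F, of _ j]
        by (auto simp: Hom_group_def coboundary_def fun_eq_iff)
    qed
    then show ?thesis
      using Suc D.hom_closed[of _ j] unfolding cocycles_eq_kernel[OF F G]
      by (auto simp: coboundaries_Suc_eq_image kernel_def simp del: coboundaries.simps)
  qed
  then have s: "subgroup (coboundaries k F G) ((Hom_group (resolution F k) G)\<lparr>carrier := cocycles k F G\<rparr>)"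
    by (rule D.G.subgroup_incl[OF b z])
  have c: "comm_group ((Hom_group (resolution F k) G)\<lparr>carrier := cocycles k F G\<rparr>)"
    by (rule group.group_comm_groupI[OF subgroup.subgroup_is_group[OF z D.G.group_axioms]])
      (use subgroup.subset[OF z] comm_monoid.m_comm[OF comm_group.axioms(1)[OF H]] in auto)
  show ?thesis
    unfolding Ext_def using comm_group.abelian_FactGroup[OF c s] by simp
qed

end

theory Submission
  imports Defs "HOL-Computational_Algebra.Polynomial"
begin

text \<open>For a group \<open>G\<close> the chains \<open>\<int>[G\<^sup>k]\<close>, \<open>k \<ge> 1\<close>, with the differential of the bar complex with trivial
  coefficients compute the homology of \<open>G\<close> in positive degrees. A free group has
  \<open>H\<^sub>1(G) = G/[G,G]\<close> and no homology above degree one, and \<open>G\<^sup>k\<close> is the set of homomorphisms from the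
  free group of rank \<open>k\<close> to \<open>G\<close>. So on \<open>gr\<close> the bar complex, shifted by one, is a resolution of
  \<open>\<aa>\<close> by the representable functors \<open>\<int>[gr(k + 1, -)]\<close>, and by Yoneda \<open>Ext\<^sup>k(\<aa>, T)\<close> is the cohomology
  at \<open>T(k + 1)\<close> of the complex \<open>T(1) \<rightarrow> T(2) \<rightarrow> T(3) \<rightarrow> \<dots>\<close>. Exactness of the bar complex comes from an
  explicit contraction built from Fox derivatives (\<open>bar_contract\<close>, \<open>bar_exact\<close>) and, at the end, from the
  relation \<open>[g] + [h] \<sim> [gh]\<close> (\<open>bar_exact_low\<close>).

  The groups \<open>Ext\<close> are defined by a much larger resolution, which has a generator for every cycle. It
  contains the bar resolution as a subcomplex: the generators \<open>bar_gen k\<close> are chosen one after the other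
  among its generators. Exactness of the subcomplex makes it a natural deformation retract, and
  \<open>Ext_iso\<close> follows.

  For \<open>T = S\<^sup>d \<circ> \<aa>\<close> the group \<open>T(n)\<close> is the group of integral forms of degree \<open>d\<close> in \<open>n\<close> variables, which
  are treated as functions of integer vectors (\<open>form_of_forms\<close>, \<open>forms_form_of\<close>, \<open>form_of_inject\<close>). A
  homomorphism of free groups acts by a linear substitution, and the differential becomes
  \<open>f(x\<^sub>1, x\<^sub>2, \<dots>) - f(x\<^sub>0 + x\<^sub>1, x\<^sub>2, \<dots>) + \<dots>\<close> (\<open>form_of_differential\<close>), the cobar differential of the
  additive group. Cochains may be normalised (\<open>normalise\<close>): only forms in which every monomial involves
  every variable matter. Let \<open>P\<close> be the product of all variables. In \<open>n\<close> variables the normalised forms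
  are \<open>P q\<close> with \<open>q\<close> of degree \<open>d - n\<close>, so the last groups of the complex are spanned by \<open>P\<close> for \<open>n = d\<close>, by
  \<open>P x\<^sub>i\<close> for \<open>n = d - 1\<close> and by \<open>P x\<^sub>i x\<^sub>j\<close> for \<open>n = d - 2\<close>. Up to sign the differential is
  \<open>P x\<^sub>i \<mapsto> 2 P\<close>, \<open>P x\<^sub>i\<^sup>2 \<mapsto> 3 P (x\<^sub>i + x\<^sub>i\<^sub>+\<^sub>1)\<close> and \<open>P x\<^sub>i x\<^sub>j \<mapsto> 2 P (x\<^sub>j\<^sub>+\<^sub>1 \<plusminus> x\<^sub>i)\<close> for \<open>i < j\<close>.

  The first formula gives \<open>\<int>/2\<close> for \<open>n = d\<close>. For \<open>n = d - 1\<close> the cocycles are spanned by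
  \<open>b\<^sub>i = P (x\<^sub>i + x\<^sub>i\<^sub>+\<^sub>1)\<close>, the second formula kills \<open>3 b\<^sub>i\<close>, and the third with \<open>j = i + 1\<close> kills
  \<open>2 (b\<^sub>i\<^sub>+\<^sub>1 - b\<^sub>i)\<close>, so all \<open>b\<^sub>i\<close> agree in the quotient, which has at most three elements. As soon as there are
  four variables, that is for \<open>d \<ge> 5\<close>, the third formula with \<open>i = 0\<close>, \<open>j = 2\<close> kills
  \<open>2 (b\<^sub>0 - b\<^sub>1 + b\<^sub>2)\<close>, hence \<open>2 b\<^sub>0\<close>, and nothing is left; for \<open>d = 3, 4\<close> no further relation exists, and for
  \<open>d = 2\<close> there is no \<open>b\<^sub>i\<close>. The sum of the coefficients of a normalised form, modulo two or three,
  detects the classes (\<open>codimension_0\<close>, \<open>codimension_1\<close>).\<close>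

section \<open>Chains and maps on quotients\<close>

abbreviation supp :: "('a \<Rightarrow>\<^sub>0 int) \<Rightarrow> 'a set" where
  "supp \<equiv> Poly_Mapping.keys"

text \<open>The map induced on a quotient is evaluated at a chosen representative of the coset, so that no
  codomain has to be mentioned; \<open>quot_lift_coset\<close> shows that the choice does not matter when the
  normal subgroup is mapped to the unit.\<close>

definition quot_lift :: "('a \<Rightarrow> 'b) \<Rightarrow> 'a set \<Rightarrow> 'b" where
  "quot_lift h C = h (SOME x. x \<in> C)"

lemma quot_lift_coset:
  assumes N: "N \<lhd> G" and H: "group H" and h: "h \<in> hom G H" and k: "\<And>x. x \<in> N \<Longrightarrow> h x = \<one>\<^bsub>H\<^esub>"
    and x: "x \<in> carrier G"
  shows "quot_lift h (N #>\<^bsub>G\<^esub> x) = h x"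
proof -
  interpret N: normal N G by fact
  interpret h: group_hom G H h by (simp add: group_hom_def group_hom_axioms_def H h N.is_group)
  have "x \<in> N #>\<^bsub>G\<^esub> x" using x by (rule N.rcos_self) (rule N.subgroup_axioms)
  then have "(SOME y. y \<in> N #>\<^bsub>G\<^esub> x) \<in> N #>\<^bsub>G\<^esub> x" by (rule someI)
  then obtain m where "m \<in> N" "(SOME y. y \<in> N #>\<^bsub>G\<^esub> x) = m \<otimes>\<^bsub>G\<^esub> x" by (auto simp: r_coset_def)
  then show ?thesis using x k N.subset by (auto simp: quot_lift_def)
qed

lemma quot_lift_hom:
  assumes N: "N \<lhd> G" and H: "group H" and h: "h \<in> hom G H" and k: "\<And>x. x \<in> N \<Longrightarrow> h x = \<one>\<^bsub>H\<^esub>"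
  shows "quot_lift h \<in> hom (G Mod N) H"
proof -
  interpret N: normal N G by fact
  interpret h: group_hom G H h by (simp add: group_hom_def group_hom_axioms_def H h N.is_group)
  show ?thesis
    by (rule homI) (auto simp: carrier_FactGroup quot_lift_coset[OF assms] N.rcos_sum)
qed

section \<open>The bar complex\<close>

definition bar_prefix :: "'a \<Rightarrow> ('a list \<Rightarrow>\<^sub>0 int) \<Rightarrow> 'a list \<Rightarrow>\<^sub>0 int" where
  "bar_prefix g = frag_extend (\<lambda>l. frag_of (g # l))"

text \<open>The alternating sum of all faces of \<open>g # hs\<close> except the one that drops \<open>g\<close>. Splitting the faces in
  this way makes the recursion run along the list, and \<open>\<partial>\<^sup>2 = 0\<close> becomes the statement that \<open>bar_act\<close> is
  an action of the monoid on bar chains (\<open>bar_act_act\<close>).\<close>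

fun bar_act :: "('a, 'm) monoid_scheme \<Rightarrow> 'a \<Rightarrow> 'a list \<Rightarrow> 'a list \<Rightarrow>\<^sub>0 int" where
  "bar_act G g [] = frag_of []"
| "bar_act G g (h # hs) = frag_of ((g \<otimes>\<^bsub>G\<^esub> h) # hs) - bar_prefix g (bar_act G h hs)"

fun bar_face_sum :: "('a, 'm) monoid_scheme \<Rightarrow> 'a list \<Rightarrow> 'a list \<Rightarrow>\<^sub>0 int" where
  "bar_face_sum G [] = 0"
| "bar_face_sum G (g # gs) = frag_of gs - bar_act G g gs"

definition bar_boundary :: "('a, 'm) monoid_scheme \<Rightarrow> ('a list \<Rightarrow>\<^sub>0 int) \<Rightarrow> 'a list \<Rightarrow>\<^sub>0 int" where
  "bar_boundary G = frag_extend (bar_face_sum G)"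

lemma bar_prefix_of [simp]: "bar_prefix g (frag_of l) = frag_of (g # l)"
  by (simp add: bar_prefix_def)

lemma bar_prefix_0 [simp]: "bar_prefix g 0 = 0"
  by (simp add: bar_prefix_def)

lemma bar_prefix_diff: "bar_prefix g (c - d) = bar_prefix g c - bar_prefix g d"
  by (simp add: bar_prefix_def frag_extend_diff)

lemma bar_boundary_of [simp]: "bar_boundary G (frag_of gs) = bar_face_sum G gs"
  by (simp add: bar_boundary_def)

lemma bar_boundary_diff: "bar_boundary G (c - d) = bar_boundary G c - bar_boundary G d"
  by (simp add: bar_boundary_def frag_extend_diff)

lemma bar_boundary_add: "bar_boundary G (c + d) = bar_boundary G c + bar_boundary G d"
  by (simp add: bar_boundary_def frag_extend_add)

lemma bar_boundary_0 [simp]: "bar_boundary G 0 = 0"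
  by (simp add: bar_boundary_def)

lemma tuples_Cons [simp]: "g # gs \<in> tuples (Suc k) G \<longleftrightarrow> g \<in> carrier G \<and> gs \<in> tuples k G"
  by (auto simp: tuples_def)

lemma tuples_0 [simp]: "gs \<in> tuples 0 G \<longleftrightarrow> gs = []"
  by (auto simp: tuples_def)

lemma tuples_SucE:
  assumes "l \<in> tuples (Suc k) G"
  obtains g gs where "l = g # gs" "g \<in> carrier G" "gs \<in> tuples k G"
  using assms by (cases l) (auto simp: tuples_def)

lemma keys_bar_prefix:
  "g \<in> carrier G \<Longrightarrow> supp c \<subseteq> tuples k G \<Longrightarrow> supp (bar_prefix g c) \<subseteq> tuples (Suc k) G"
  using keys_frag_extend[of "\<lambda>l. frag_of (g # l)" c] by (fastforce simp: bar_prefix_def)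

lemma keys_frag_diff: "supp c \<subseteq> S \<Longrightarrow> supp d \<subseteq> S \<Longrightarrow> supp (c - d) \<subseteq> S"
  for c d :: "'a \<Rightarrow>\<^sub>0 int"
  using keys_diff[of c d] by auto

lemma keys_frag_add: "supp c \<subseteq> S \<Longrightarrow> supp d \<subseteq> S \<Longrightarrow> supp (c + d) \<subseteq> S"
  for c d :: "'a \<Rightarrow>\<^sub>0 int"
  using keys_add[of c d] by auto

context
  fixes G :: "'a monoid" assumes G: "monoid G"
begin

interpretation monoid G by (rule G)

lemma keys_bar_act:
  "g \<in> carrier G \<Longrightarrow> hs \<in> tuples k G \<Longrightarrow> supp (bar_act G g hs) \<subseteq> tuples k G"
proof (induction hs arbitrary: g k)
  case (Cons h hs)
  then obtain j where "k = Suc j" by (cases k) (auto simp: tuples_def)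
  with Cons show ?case
    unfolding bar_act.simps \<open>k = Suc j\<close> by (intro keys_frag_diff keys_bar_prefix) auto
qed auto

lemma keys_bar_face_sum:
  "gs \<in> tuples (Suc k) G \<Longrightarrow> supp (bar_face_sum G gs) \<subseteq> tuples k G"
  by (erule tuples_SucE, hypsubst, unfold bar_face_sum.simps, intro keys_frag_diff keys_bar_act) auto

lemma keys_bar_boundary:
  "supp c \<subseteq> tuples (Suc k) G \<Longrightarrow> supp (bar_boundary G c) \<subseteq> tuples k G"
  using hom_in_carrier[OF frag_extend_hom[of "tuples (Suc k) G" "bar_face_sum G" "tuples k G"], of c]
    keys_bar_face_sum by (simp add: bar_boundary_def)

lemma bar_act_prefix:
  "frag_extend (bar_act G g) (bar_prefix h c)
     = bar_prefix (g \<otimes>\<^bsub>G\<^esub> h) c - bar_prefix g (frag_extend (bar_act G h) c)"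
  by (rule frag_induction[of c UNIV]) (auto simp: frag_extend_diff bar_prefix_diff bar_prefix_def)

text \<open>Both sides expand to three kinds of terms by \<open>bar_act_prefix\<close>; they agree by associativity and by
  the same law for the shorter list.\<close>

lemma bar_act_act:
  "g \<in> carrier G \<Longrightarrow> h \<in> carrier G \<Longrightarrow> x \<in> tuples k G \<Longrightarrow>
   frag_extend (bar_act G g) (bar_act G h x) = bar_act G (g \<otimes>\<^bsub>G\<^esub> h) x"
proof (induction x arbitrary: g h k)
  case (Cons a r)
  obtain j where j: "k = Suc j" using Cons.prems by (cases k) (auto simp: tuples_def)
  have IH: "frag_extend (bar_act G h) (bar_act G a r) = bar_act G (h \<otimes>\<^bsub>G\<^esub> a) r"
    using Cons j by auto
  show ?case
    using Cons.prems j by (simp add: frag_extend_diff bar_act_prefix IH m_assoc)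
qed auto

lemma bar_boundary_prefix:
  "bar_boundary G (bar_prefix g c) = c - frag_extend (bar_act G g) c"
  by (rule frag_induction[of c UNIV])
    (auto simp: frag_extend_diff bar_prefix_diff bar_boundary_diff)

lemma bar_boundary_act:
  assumes "g \<in> carrier G" "hs \<in> tuples k G"
  shows "bar_boundary G (bar_act G g hs) = bar_face_sum G hs"
proof (cases hs)
  case Nil
  then show ?thesis by simp
next
  case (Cons h r)
  then obtain j where "k = Suc j" using assms by (cases k) (auto simp: tuples_def)
  then have "frag_extend (bar_act G g) (bar_act G h r) = bar_act G (g \<otimes>\<^bsub>G\<^esub> h) r"
    using assms Cons by (intro bar_act_act[of _ _ _ j]) auto
  then show ?thesis by (simp add: Cons bar_boundary_diff bar_boundary_prefix)
qed

text \<open>With \<open>\<partial>[g|hs] = [hs] - g\<cdot>[hs]\<close>, where the dot is the action, this says that acting by \<open>g\<close> does not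
  change the boundary, and that follows from the action law (\<open>bar_boundary_act\<close>).\<close>

lemma bar_boundary_boundary:
  assumes "supp c \<subseteq> tuples k G"
  shows "bar_boundary G (bar_boundary G c) = 0"
  using assms
proof (rule frag_induction)
  fix gs assume gs: "gs \<in> tuples k G"
  show "bar_boundary G (bar_boundary G (frag_of gs)) = 0"
  proof (cases k)
    case (Suc j)
    then show ?thesis using gs by (auto elim!: tuples_SucE simp: bar_boundary_diff bar_boundary_act)
  qed (use gs in auto)
qed (simp_all add: bar_boundary_diff)

end

lemma bar_prefix_map:
  "frag_extend (\<lambda>l. frag_of (map h l)) (bar_prefix g c)
     = bar_prefix (h g) (frag_extend (\<lambda>l. frag_of (map h l)) c)"
  by (rule frag_induction[of c UNIV]) (auto simp: frag_extend_diff bar_prefix_diff)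

lemma bar_act_map:
  assumes "h \<in> hom G H" "g \<in> carrier G" "set gs \<subseteq> carrier G"
  shows "frag_extend (\<lambda>l. frag_of (map h l)) (bar_act G g gs) = bar_act H (h g) (map h gs)"
  using assms(2,3)
  by (induction gs arbitrary: g) (auto simp: frag_extend_diff bar_prefix_map hom_mult[OF assms(1)])

lemma bar_face_sum_map:
  assumes "h \<in> hom G H" "set gs \<subseteq> carrier G"
  shows "frag_extend (\<lambda>l. frag_of (map h l)) (bar_face_sum G gs) = bar_face_sum H (map h gs)"
  using assms by (cases gs) (auto simp: frag_extend_diff bar_act_map)

section \<open>Acyclicity of the bar complex of a free group\<close>

text \<open>Fox's derivation in its right handed form: for a word \<open>w = p x s\<close> with \<open>x\<close> a generator there is a term
  for the suffix \<open>s\<close>, and the term of an inverse letter is minus the one of the suffix \<open>x\<^sup>-\<^sup>1 s\<close>, which is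
  the suffix that starts at this letter. The argument \<open>e\<close> says into which chain such a term is
  translated. The derivation rule is \<open>fox_product\<close>, the fundamental formula of Fox calculus is
  \<open>fox_telescope\<close>.\<close>

fun fox :: "(nat \<Rightarrow> word \<Rightarrow> 'c \<Rightarrow>\<^sub>0 int) \<Rightarrow> word \<Rightarrow> 'c \<Rightarrow>\<^sub>0 int" where
  "fox e [] = 0"
| "fox e (x # s) = (if snd x then e (fst x) s else - e (fst x) (x # s)) + fox e s"

lemma fox_add: "fox (\<lambda>i s. e i s + f i s) w = fox e w + fox f w"
  by (induction w) auto

lemma fox_0 [simp]: "fox (\<lambda>i s. 0) w = 0"
  by (induction w) auto

lemma fox_diff: "fox (\<lambda>i s. e i s - f i s) w = fox e w - fox f w"
  by (induction w) auto

lemma frag_extend_fox: "frag_extend L (fox e w) = fox (\<lambda>i s. frag_extend L (e i s)) w"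
  by (induction w) (auto simp: frag_extend_add frag_extend_minus)

text \<open>When the first letter cancels, its term is opposite to the term of the letter that it cancels.\<close>

lemma fox_cons_reduce:
  "fox e (cons_reduce x y) =
     (if snd x then e (fst x) y else - e (fst x) (cons_reduce x y)) + fox e y"
  by (cases y) (auto simp: inv_letter_def)

lemma fox_product:
  "fox e (foldr cons_reduce u w) = fox (\<lambda>i s. e i (foldr cons_reduce s w)) u + fox e w"
  by (induction u) (auto simp: fox_cons_reduce)

lemma fox_telescope:
  "reduced w \<Longrightarrow> fox (\<lambda>i s. F s - F (cons_reduce (i, True) s)) w = F [] - F w"
proof (induction w)
  case (Cons x w)
  have w: "reduced w" "cons_reduce x w = x # w"
    using Cons.prems by (cases w; simp add: reduced_Cons)+
  obtain i b where x: "x = (i, b)" by (cases x)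
  show ?case
  proof (cases b)
    case True
    show ?thesis using Cons.IH[OF w(1)] w(2) by (simp add: x True)
  next
    case False
    have "cons_reduce (i, True) (x # w) = w" by (simp add: inv_letter_def x False)
    then show ?thesis using Cons.IH[OF w(1)] by (simp add: x False)
  qed
qed simp

lemma keys_fox:
  assumes "set w \<subseteq> S" "reduced w"
    "\<And>i s. i \<in> fst ` S \<Longrightarrow> reduced s \<Longrightarrow> set s \<subseteq> S \<Longrightarrow> supp (e i s) \<subseteq> T"
  shows "supp (fox e w) \<subseteq> T"
  using assms(1,2)
proof (induction w)
  case (Cons x w)
  have "reduced w" using Cons.prems by (simp add: reduced_Cons)
  then have "supp (if snd x then e (fst x) w else - e (fst x) (x # w)) \<subseteq> T"
    using Cons.prems assms(3)[of "fst x" w] assms(3)[of "fst x" "x # w"] by auto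
  then show ?case unfolding fox.simps by (rule keys_frag_add) (use Cons \<open>reduced w\<close> in auto)
qed simp

text \<open>With \<open>H[g|r] = \<Sum> [x|s|r]\<close> over the Fox terms of \<open>g\<close>, the operator \<open>\<partial>H + H\<partial>\<close> sends \<open>[g|r]\<close> to
  \<open>[1|r] - [g|r]\<close> when \<open>r\<close> is nonempty. The summand \<open>[1|1|r]\<close> removes the degenerate term \<open>[1|r]\<close>.\<close>

fun bar_contract :: "word list \<Rightarrow> word list \<Rightarrow>\<^sub>0 int" where
  "bar_contract [] = 0"
| "bar_contract (g # r) = frag_of ([] # [] # r) - fox (\<lambda>i s. frag_of ([(i, True)] # s # r)) g"

lemma free_group_simps:
  "u \<otimes>\<^bsub>free_group n\<^esub> v = foldr cons_reduce u v" "\<one>\<^bsub>free_group n\<^esub> = []"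
  "w \<in> carrier (free_group n) \<longleftrightarrow> reduced w \<and> fst ` set w \<subseteq> {..<n}"
  by (simp_all add: free_group_def)

lemma diff_diff_swap: "(p - q) - (r - s) = (p - r) - (q - s)" for p q r s :: "'a::ab_group_add"
  by (simp add: algebra_simps)

lemma bar_contract_prefix:
  "frag_extend bar_contract (bar_prefix g c)
     = bar_prefix [] (bar_prefix [] c) - fox (\<lambda>i s. bar_prefix [(i, True)] (bar_prefix s c)) g"
proof (rule frag_induction[of c UNIV])
  fix a b
  assume *: "frag_extend bar_contract (bar_prefix g a)
      = bar_prefix [] (bar_prefix [] a) - fox (\<lambda>i s. bar_prefix [(i, True)] (bar_prefix s a)) g"
    "frag_extend bar_contract (bar_prefix g b)
      = bar_prefix [] (bar_prefix [] b) - fox (\<lambda>i s. bar_prefix [(i, True)] (bar_prefix s b)) g"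
  have D: "fox (\<lambda>i s. bar_prefix [(i, True)] (bar_prefix s (a - b))) g
    = fox (\<lambda>i s. bar_prefix [(i, True)] (bar_prefix s a)) g - fox (\<lambda>i s. bar_prefix [(i, True)] (bar_prefix s b)) g"
    unfolding bar_prefix_diff by (rule fox_diff)
  show "frag_extend bar_contract (bar_prefix g (a - b))
      = bar_prefix [] (bar_prefix [] (a - b)) - fox (\<lambda>i s. bar_prefix [(i, True)] (bar_prefix s (a - b))) g"
    unfolding D unfolding bar_prefix_diff frag_extend_diff * by (rule diff_diff_swap)
next
  show "frag_extend bar_contract (bar_prefix g (frag_of x))
      = bar_prefix [] (bar_prefix [] (frag_of x)) - fox (\<lambda>i s. bar_prefix [(i, True)] (bar_prefix s (frag_of x))) g" for x
    unfolding bar_prefix_of frag_extend_of bar_contract.simps ..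
next
  show "frag_extend bar_contract (bar_prefix g 0)
      = bar_prefix [] (bar_prefix [] 0) - fox (\<lambda>i s. bar_prefix [(i, True)] (bar_prefix s 0)) g"
    unfolding bar_prefix_0 fox_0 frag_extend_0 by (rule diff_zero[symmetric])
qed (rule subset_UNIV)

lemma bar_contract_arith:
  "A - (A - (A - B)) - (A - W + (U - Y)) + (C - H - (C - (U + H) - (B - Y))) = W"
  for A :: "'a::ab_group_add"
  by (simp add: algebra_simps)

text \<open>In the boundary of \<open>[x|s|h|r]\<close> the first two faces telescope over the Fox terms of \<open>g\<close>; the third is
  cancelled because \<open>fox\<close> is a derivation, \<open>D(gh) = D(g)h + D(h)\<close>; the remaining faces do not touch \<open>x\<close> and
  \<open>s\<close> and cancel against the contraction of the corresponding faces of \<open>[g|h|r]\<close>. A second entry \<open>h\<close> is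
  needed: in degree one the contraction stops at the generators, which survive in homology.\<close>

lemma bar_contract:
  fixes n :: nat
  defines "G \<equiv> free_group n"
  assumes gs: "gs \<in> tuples (Suc (Suc k)) G"
  shows "bar_boundary G (bar_contract gs) + frag_extend bar_contract (bar_face_sum G gs) = frag_of gs"
proof -
  interpret group G unfolding G_def by (rule group_free_group)
  obtain g h r where gs: "gs = g # h # r" "g \<in> carrier G" "h \<in> carrier G" "r \<in> tuples k G"
    using assms by (auto elim!: tuples_SucE)
  have red: "reduced g" "reduced h" using gs by (simp_all add: G_def free_group_simps)
  have m: "foldr cons_reduce u v = u \<otimes>\<^bsub>G\<^esub> v" for u v by (simp add: G_def free_group_simps)
  have m1: "cons_reduce x v = [x] \<otimes>\<^bsub>G\<^esub> v" for x v by (simp add: G_def free_group_simps)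
  have nil: "[] \<otimes>\<^bsub>G\<^esub> v = v" for v by (simp add: G_def free_group_simps)
  let ?A = "bar_act G h r"
  have "bar_boundary G (fox (\<lambda>i s. frag_of ([(i, True)] # s # h # r)) g)
     = fox (\<lambda>i s. (frag_of (s # h # r) - frag_of (cons_reduce (i, True) s # h # r))
         + (frag_of ([(i, True)] # (s \<otimes>\<^bsub>G\<^esub> h) # r) - bar_prefix [(i, True)] (bar_prefix s ?A))) g"
    unfolding bar_boundary_def frag_extend_fox by (simp add: bar_prefix_diff m1 algebra_simps)
  also have "\<dots> = (frag_of ([] # h # r) - frag_of (g # h # r))
      + (fox (\<lambda>i s. frag_of ([(i, True)] # (s \<otimes>\<^bsub>G\<^esub> h) # r)) g - fox (\<lambda>i s. bar_prefix [(i, True)] (bar_prefix s ?A)) g)"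
    using fox_telescope[OF red(1), of "\<lambda>s. frag_of (s # h # r)"]
    by (subst fox_add, subst (2) fox_diff) simp
  finally have 1: "bar_boundary G (fox (\<lambda>i s. frag_of ([(i, True)] # s # h # r)) g) = \<dots>" .
  have 2: "fox (\<lambda>i s. frag_of ([(i, True)] # s # r)) (g \<otimes>\<^bsub>G\<^esub> h)
     = fox (\<lambda>i s. frag_of ([(i, True)] # (s \<otimes>\<^bsub>G\<^esub> h) # r)) g + fox (\<lambda>i s. frag_of ([(i, True)] # s # r)) h"
    using fox_product[of "\<lambda>i s. frag_of ([(i, True)] # s # r)" g h] by (simp only: m)
  show ?thesis
    unfolding gs(1) bar_contract.simps bar_face_sum.simps bar_act.simps bar_boundary_diff 1
      frag_extend_diff bar_contract_prefix bar_boundary_of nil bar_prefix_diff bar_prefix_of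
      frag_extend_of 2
    by (rule bar_contract_arith)
qed

lemma keys_bar_contract:
  assumes "gs \<in> tuples (Suc k) (free_group n)"
  shows "supp (bar_contract gs) \<subseteq> tuples (Suc (Suc k)) (free_group n)"
proof -
  obtain g r where gs: "gs = g # r" "g \<in> carrier (free_group n)" "r \<in> tuples k (free_group n)"
    using assms by (auto elim!: tuples_SucE)
  have "supp (fox (\<lambda>i s. frag_of ([(i, True)] # s # r)) g) \<subseteq> tuples (Suc (Suc k)) (free_group n)"
    by (rule keys_fox[of _ "{x. fst x < n}"]) (use gs in \<open>auto simp: free_group_simps reduced_Cons\<close>)
  then show ?thesis unfolding gs(1) bar_contract.simps
    by (intro keys_frag_diff) (use gs in \<open>auto simp: free_group_simps\<close>)
qed

theorem bar_exact:
  assumes c: "supp c \<subseteq> tuples (Suc (Suc k)) (free_group n)"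
    and z: "bar_boundary (free_group n) c = 0"
  shows "\<exists>e. supp e \<subseteq> tuples (Suc (Suc (Suc k))) (free_group n) \<and> bar_boundary (free_group n) e = c"
proof (intro exI conjI)
  let ?G = "free_group n"
  show "supp (frag_extend bar_contract c) \<subseteq> tuples (Suc (Suc (Suc k))) ?G"
    using hom_in_carrier[OF frag_extend_hom[of "tuples (Suc (Suc k)) ?G" bar_contract], of _ c]
      keys_bar_contract c by simp
  have "bar_boundary ?G (frag_extend bar_contract c) + frag_extend bar_contract (bar_boundary ?G c) = c"
    using c
  proof (rule frag_induction)
    fix x y
    assume "bar_boundary ?G (frag_extend bar_contract x) + frag_extend bar_contract (bar_boundary ?G x) = x"
      "bar_boundary ?G (frag_extend bar_contract y) + frag_extend bar_contract (bar_boundary ?G y) = y"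
    then show "bar_boundary ?G (frag_extend bar_contract (x - y))
        + frag_extend bar_contract (bar_boundary ?G (x - y)) = x - y"
      unfolding frag_extend_diff bar_boundary_diff add_diff_add[symmetric] by (rule arg_cong2)
  qed (simp_all add: bar_contract)
  then show "bar_boundary ?G (frag_extend bar_contract c) = c" using z by simp
qed

section \<open>Natural maps between free functors\<close>

text \<open>The natural map between free functors that sends the generator \<open>g\<close> to \<open>\<tau> g\<close>; \<open>boundary\<close> is the case
  \<open>\<tau> = gen_boundary\<close>.\<close>

definition gen_extend :: "('a gen \<Rightarrow> 'a chain) \<Rightarrow> 'a chain \<Rightarrow> 'a chain" where
  "gen_extend \<tau> = frag_extend (\<lambda>(g, h). push h (\<tau> g))"

lemma gen_extend_of [simp]: "gen_extend \<tau> (frag_of (g, h)) = push h (\<tau> g)"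
  by (simp add: gen_extend_def)

lemma gen_extend_0 [simp]: "gen_extend \<tau> 0 = 0"
  by (simp add: gen_extend_def)

lemma gen_extend_add: "gen_extend \<tau> (c + d) = gen_extend \<tau> c + gen_extend \<tau> d"
  by (simp add: gen_extend_def frag_extend_add)

lemma gen_extend_diff: "gen_extend \<tau> (c - d) = gen_extend \<tau> c - gen_extend \<tau> d"
  by (simp add: gen_extend_def frag_extend_diff)

lemma gen_extend_keys:
  assumes "\<And>g. g \<in> B \<Longrightarrow> supp (\<tau> g) \<subseteq> cells C (rank g)"
    and "supp c \<subseteq> cells B n"
  shows "supp (gen_extend \<tau> c) \<subseteq> cells C n"
proof -
  have "gen_extend \<tau> \<in> hom (free_Abelian_group (cells B n)) (free_Abelian_group (cells C n))"
    unfolding gen_extend_def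
    by (rule frag_extend_hom) (auto simp: cells_def dest!: push_keys[OF _ assms(1)])
  from hom_in_carrier[OF this, of c] assms(2) show ?thesis by simp
qed

lemma gen_extend_push:
  assumes "\<And>g. g \<in> B \<Longrightarrow> supp (\<tau> g) \<subseteq> cells C (rank g)"
    and c: "supp c \<subseteq> cells B m" and f: "f \<in> gr_hom m n"
  shows "gen_extend \<tau> (push f c) = push f (gen_extend \<tau> c)"
  using c
proof (rule frag_induction)
  fix a assume "a \<in> cells B m"
  then obtain g h where a: "a = (g, h)" "g \<in> B" "h \<in> gr_hom (rank g) m" by (auto simp: cells_def)
  show "gen_extend \<tau> (push f (frag_of a)) = push f (gen_extend \<tau> (frag_of a))"
    using push_comp[OF assms(1)[OF a(2)], of f h] by (simp add: a(1))
qed (simp_all add: push_diff gen_extend_diff)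

lemma gen_extend_cong_0:
  assumes "supp c \<subseteq> cells B n" "\<And>g. g \<in> B \<Longrightarrow> \<tau> g = 0"
  shows "gen_extend \<tau> c = 0"
  unfolding gen_extend_def using assms by (intro frag_extend_eq_0) (auto simp: cells_def)

definition unit_cell :: "'a gen \<Rightarrow> 'a chain" where
  "unit_cell g = frag_of (g, gr_id (rank g))"

lemma unit_cell_keys: "g \<in> B \<Longrightarrow> supp (unit_cell g) \<subseteq> cells B (rank g)"
  by (simp add: unit_cell_def cells_def)

lemma push_unit_cell: "h \<in> gr_hom (rank g) n \<Longrightarrow> push h (unit_cell g) = frag_of (g, h)"
  by (simp add: unit_cell_def gr_comp_id_right)

lemma boundary_unit_cell:
  "g \<in> res_gens F (Suc k) \<Longrightarrow> boundary (unit_cell g) = gen_boundary g"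
  using gen_boundary_keys[of g F k] by (simp add: unit_cell_def push_id)

section \<open>Natural transformations out of a free functor\<close>

text \<open>The value at a chain of the transformation that sends its generator to \<open>x\<close>. It is used for chains on
  cells of a single generator, since \<open>x\<close> is the same for all of them.\<close>

definition gen_value_at :: "'b gr_functor \<Rightarrow> 'b \<Rightarrow> nat \<Rightarrow> 'a chain \<Rightarrow> 'b" where
  "gen_value_at G x n = free_lift (obj G n) (\<lambda>(g, h). mor G (rank g) n h x)"

text \<open>The existence half of Yoneda's lemma for a sum of representable functors; the uniqueness half is
  \<open>nat_trans_cell\<close>.\<close>

lemma yoneda_exists:
  assumes G: "is_gr_functor G" and l: "\<And>g. g \<in> B \<Longrightarrow> l g \<in> carrier (obj G (rank g))"
  shows "\<exists>\<psi> \<in> nat_trans (free_functor B) G. \<forall>g \<in> B. \<psi> (rank g) (unit_cell g) = l g"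
proof -
  note gG = gr_functorD(1)[OF G] and mG = gr_functorD(3)[OF G]
  define v where "v n = (\<lambda>(g, h). mor G (rank g) n h (l g))" for n
  have v: "v n ` cells B n \<subseteq> carrier (obj G n)" for n
    using l by (auto simp: v_def cells_def intro: hom_in_carrier[OF mG])
  note lift = comm_group.free_lift_hom[OF gG v]
  have lift_of: "free_lift (obj G n) (v n) (frag_of (g, h)) = mor G (rank g) n h (l g)"
    if "(g, h) \<in> cells B n" for n g h
    using comm_group.free_lift_of[OF gG, of "v n" "(g, h)" n] v[of n] that by (auto simp: v_def)
  define \<psi> where "\<psi> n = restrict (free_lift (obj G n) (v n)) (carrier (free_Abelian_group (cells B n)))" for n
  have "\<psi> \<in> nat_trans (free_functor B) G"
    unfolding nat_trans_def
  proof (intro CollectI conjI allI ballI IntI)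
    fix n
    show "\<psi> n \<in> hom (obj (free_functor B) n) (obj G n)"
    proof (rule homI)
      fix c d assume cd: "c \<in> carrier (obj (free_functor B) n)" "d \<in> carrier (obj (free_functor B) n)"
      show "\<psi> n c \<in> carrier (obj G n)"
        using hom_in_carrier[OF lift, of c] cd by (simp add: \<psi>_def)
      have "c \<otimes>\<^bsub>free_Abelian_group (cells B n)\<^esub> d \<in> carrier (free_Abelian_group (cells B n))"
        using cd by (intro monoid.m_closed group.is_monoid) auto
      then show "\<psi> n (c \<otimes>\<^bsub>obj (free_functor B) n\<^esub> d) = \<psi> n c \<otimes>\<^bsub>obj G n\<^esub> \<psi> n d"
        using hom_mult[OF lift, of c n d] cd by (simp add: \<psi>_def del: carrier_free_Abelian_group_iff)
    qed
    show "\<psi> n \<in> extensional (carrier (obj (free_functor B) n))" by (simp add: \<psi>_def)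
  next
    fix m n f c assume f: "f \<in> gr_hom m n" and c: "c \<in> carrier (obj (free_functor B) m)"
    then have k: "supp c \<subseteq> cells B m" by simp
    have "(\<lambda>c. free_lift (obj G n) (v n) (push f c)) c = (\<lambda>c. mor G m n f (free_lift (obj G m) (v m) c)) c"
    proof (rule hom_free_eqI[OF gr_functorD(2)[OF G] _ _ _ k])
      show "(\<lambda>c. free_lift (obj G n) (v n) (push f c)) \<in> hom (free_Abelian_group (cells B m)) (obj G n)"
        using Group.hom_compose[OF push_hom[OF f] lift] by (simp add: comp_def)
      show "(\<lambda>c. mor G m n f (free_lift (obj G m) (v m) c)) \<in> hom (free_Abelian_group (cells B m)) (obj G n)"
        using Group.hom_compose[OF lift mG[OF f]] by (simp add: comp_def)
      fix a assume "a \<in> cells B m"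
      then obtain g h where a: "a = (g, h)" "g \<in> B" "h \<in> gr_hom (rank g) m" by (auto simp: cells_def)
      then have "(g, gr_comp (rank g) f h) \<in> cells B n" "(g, h) \<in> cells B m" using f by (auto simp: cells_def)
      then show "free_lift (obj G n) (v n) (push f (frag_of a)) = mor G m n f (free_lift (obj G m) (v m) (frag_of a))"
        by (simp add: a(1) lift_of gr_functorD(5)[OF G a(3) f l[OF a(2)]])
    qed
    then show "\<psi> n (mor (free_functor B) m n f c) = mor G m n f (\<psi> m c)"
      using k push_keys[OF f k] by (simp add: \<psi>_def)
  qed
  moreover have "\<psi> (rank g) (unit_cell g) = l g" if "g \<in> B" for g
    using that unit_cell_keys[OF that] lift_of[of g "gr_id (rank g)" "rank g"] gr_functorD(4)[OF G l[OF that]]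
    by (simp add: \<psi>_def unit_cell_def cells_def)
  ultimately show ?thesis by blast
qed

lemma nat_trans_cell:
  assumes "\<phi> \<in> nat_trans (free_functor B) G" "g \<in> B" "h \<in> gr_hom (rank g) n"
  shows "\<phi> n (frag_of (g, h)) = mor G (rank g) n h (\<phi> (rank g) (unit_cell g))"
  using nat_transD(3)[OF assms(1,3), of "unit_cell g"] unit_cell_keys[OF assms(2)] assms(3)
  by (simp add: push_unit_cell)

lemma hom_free_subset:
  assumes "h \<in> hom (free_Abelian_group T) H" "S \<subseteq> T"
  shows "h \<in> hom (free_Abelian_group S) H"
  using assms by (auto simp: hom_def Pi_iff)

lemma hom_free_diff:
  assumes "group H" "h \<in> hom (free_Abelian_group S) H" "supp x \<subseteq> S" "supp y \<subseteq> S"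
  shows "h (x - y) = h x \<otimes>\<^bsub>H\<^esub> inv\<^bsub>H\<^esub> h y"
proof -
  interpret h: group_hom "free_Abelian_group S" H h
    using assms by (simp add: group_hom_def group_hom_axioms_def)
  show ?thesis using h.hom_mult[of x "- y"] h.hom_inv[of y] assms(3,4) by simp
qed

lemma nat_trans_gen_value_at:
  assumes G: "is_gr_functor G" and p: "\<phi> \<in> nat_trans (free_functor B) G"
    and g: "g \<in> B" and c: "supp c \<subseteq> cells {g} n"
  shows "\<phi> n c = gen_value_at G (\<phi> (rank g) (unit_cell g)) n c"
proof (rule hom_free_eqI[OF gr_functorD(2)[OF G] _ _ _ c])
  let ?x = "\<phi> (rank g) (unit_cell g)"
  have x: "?x \<in> carrier (obj G (rank g))"
    using hom_in_carrier[OF nat_transD(1)[OF p]] unit_cell_keys[OF g] by simp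
  have sub: "cells {g} n \<subseteq> cells B n" using g by (auto simp: cells_def)
  show "\<phi> n \<in> hom (free_Abelian_group (cells {g} n)) (obj G n)"
    using nat_transD(1)[OF p, of n] by (intro hom_free_subset[OF _ sub]) simp
  have v: "(\<lambda>(g, h). mor G (rank g) n h ?x) ` cells {g} n \<subseteq> carrier (obj G n)"
    using x by (auto simp: cells_def intro: hom_in_carrier[OF gr_functorD(3)[OF G]])
  show "gen_value_at G ?x n \<in> hom (free_Abelian_group (cells {g} n)) (obj G n)"
    unfolding gen_value_at_def by (rule comm_group.free_lift_hom[OF gr_functorD(1)[OF G] v])
  fix a assume a: "a \<in> cells {g} n"
  then obtain h where h: "a = (g, h)" "h \<in> gr_hom (rank g) n" by (auto simp: cells_def)
  show "\<phi> n (frag_of a) = gen_value_at G ?x n (frag_of a)"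
    unfolding gen_value_at_def
    by (subst comm_group.free_lift_of[OF gr_functorD(1)[OF G]])
      (use v a h nat_trans_cell[OF p g h(2)] in auto)
qed

lemma nat_trans_precomp:
  assumes p: "\<phi> \<in> nat_trans (free_functor B) G"
    and add: "\<And>c d. \<theta> (c + d) = \<theta> c + \<theta> d"
    and keys: "\<And>n c. supp c \<subseteq> cells C n \<Longrightarrow> supp (\<theta> c) \<subseteq> cells B n"
    and push: "\<And>m n f c. f \<in> gr_hom m n \<Longrightarrow> supp c \<subseteq> cells C m \<Longrightarrow> \<theta> (push f c) = push f (\<theta> c)"
  shows "(\<lambda>n. \<lambda>c \<in> carrier (obj (free_functor C) n). \<phi> n (\<theta> c)) \<in> nat_trans (free_functor C) G"
  unfolding nat_trans_def
proof (intro CollectI conjI allI ballI IntI)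
  fix n
  show "(\<lambda>c \<in> carrier (obj (free_functor C) n). \<phi> n (\<theta> c)) \<in> hom (obj (free_functor C) n) (obj G n)"
  proof (rule homI)
    fix c d assume cd: "c \<in> carrier (obj (free_functor C) n)" "d \<in> carrier (obj (free_functor C) n)"
    show "(\<lambda>c \<in> carrier (obj (free_functor C) n). \<phi> n (\<theta> c)) c \<in> carrier (obj G n)"
      using cd keys[of c n] hom_in_carrier[OF nat_transD(1)[OF p]] by simp
    have "supp (c + d) \<subseteq> cells C n" using cd keys_add[of c d] by auto
    then show "(\<lambda>c \<in> carrier (obj (free_functor C) n). \<phi> n (\<theta> c)) (c \<otimes>\<^bsub>obj (free_functor C) n\<^esub> d)
      = (\<lambda>c \<in> carrier (obj (free_functor C) n). \<phi> n (\<theta> c)) c \<otimes>\<^bsub>obj G n\<^esub> (\<lambda>c \<in> carrier (obj (free_functor C) n). \<phi> n (\<theta> c)) d"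
      using cd keys[of _ n] hom_mult[OF nat_transD(1)[OF p], of "\<theta> c" n "\<theta> d"] by (simp add: add)
  qed
next
  fix m n f c assume f: "f \<in> gr_hom m n" and c: "c \<in> carrier (obj (free_functor C) m)"
  then show "(\<lambda>c \<in> carrier (obj (free_functor C) n). \<phi> n (\<theta> c)) (mor (free_functor C) m n f c)
     = mor G m n f ((\<lambda>c \<in> carrier (obj (free_functor C) m). \<phi> m (\<theta> c)) c)"
    using push_keys[OF f, of c C] push[OF f, of c] keys[of c m] nat_transD(3)[OF p f, of "\<theta> c"] by simp
qed simp

section \<open>Ext from one generator in each degree\<close>

text \<open>A choice of one generator \<open>b k\<close> of the standard resolution in each degree such that the cells of the
  \<open>b k\<close> form a subcomplex which is itself a resolution.\<close>

locale one_generator_resolution =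
  fixes F :: "'a gr_functor" and b :: "nat \<Rightarrow> 'a gen"
  assumes F: "is_gr_functor F"
    and b_res: "\<And>k. b k \<in> res_gens F k"
    and b_boundary: "\<And>k. supp (gen_boundary (b (Suc k))) \<subseteq> cells {b k} (rank (b (Suc k)))"
    and b_surj: "\<And>n x. x \<in> carrier (obj F n) \<Longrightarrow>
      \<exists>p. supp p \<subseteq> cells {b 0} n \<and> augmentation F n p = x"
    and b_exact: "\<And>k n p. supp p \<subseteq> cells {b k} n \<Longrightarrow>
      if k = 0 then augmentation F n p = \<one>\<^bsub>obj F n\<^esub> else boundary p = 0 \<Longrightarrow>
      \<exists>q. supp q \<subseteq> cells {b (Suc k)} n \<and> boundary q = p"
begin

lemma cells_b: "cells {b k} n \<subseteq> cells (res_gens F k) n"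
  using b_res by (auto simp: cells_def)

text \<open>A contraction of the standard resolution onto the subcomplex is built degree by degree. The
  condition on \<open>c\<close> is what the next step needs: cycles in degree \<open>k\<close> are moved into the subcomplex by a
  boundary. In degree \<open>0\<close> every chain counts as a cycle.\<close>

definition contracts :: "nat \<Rightarrow> ('a gen \<Rightarrow> 'a chain) \<Rightarrow> bool" where
  "contracts k \<sigma> \<longleftrightarrow>
     (\<forall>g \<in> res_gens F k. supp (\<sigma> g) \<subseteq> cells (res_gens F (Suc k)) (rank g)) \<and>
     \<sigma> (b k) = 0 \<and>
     (\<forall>n c. supp c \<subseteq> cells (res_gens F k) n \<longrightarrow> k = 0 \<or> boundary c = 0 \<longrightarrow>
        supp (c - boundary (gen_extend \<sigma> c)) \<subseteq> cells {b k} n)"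

definition contracts_step :: "nat \<Rightarrow> ('a gen \<Rightarrow> 'a chain) \<Rightarrow> ('a gen \<Rightarrow> 'a chain) \<Rightarrow> bool" where
  "contracts_step k \<sigma> \<sigma>' \<longleftrightarrow>
     (\<forall>n c. supp c \<subseteq> cells (res_gens F (Suc k)) n \<longrightarrow>
        supp (c - gen_extend \<sigma> (boundary c) - boundary (gen_extend \<sigma>' c)) \<subseteq> cells {b (Suc k)} n)"

text \<open>Everything in sight is natural, so a chain can be pushed into the subcomplex as soon as the
  generators can.\<close>

lemma deform_generators:
  assumes gens: "\<And>g. g \<in> res_gens F k \<Longrightarrow>
      \<exists>s. supp s \<subseteq> cells (res_gens F (Suc k)) (rank g) \<and> (g = b k \<longrightarrow> s = 0) \<and>
          supp (\<eta> (unit_cell g) - boundary s) \<subseteq> cells {b k} (rank g)"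
    and diff: "\<And>c d. \<eta> (c - d) = \<eta> c - \<eta> d"
    and push: "\<And>m n f c. f \<in> gr_hom m n \<Longrightarrow> supp c \<subseteq> cells (res_gens F k) m \<Longrightarrow> \<eta> (push f c) = push f (\<eta> c)"
  shows "\<exists>\<sigma>. (\<forall>g \<in> res_gens F k. supp (\<sigma> g) \<subseteq> cells (res_gens F (Suc k)) (rank g)) \<and>
     \<sigma> (b k) = 0 \<and>
     (\<forall>n c. supp c \<subseteq> cells (res_gens F k) n \<longrightarrow>
        supp (\<eta> c - boundary (gen_extend \<sigma> c)) \<subseteq> cells {b k} n)"
proof -
  obtain \<sigma> where s: "\<And>g. g \<in> res_gens F k \<Longrightarrow> supp (\<sigma> g) \<subseteq> cells (res_gens F (Suc k)) (rank g)"
    "\<And>g. g \<in> res_gens F k \<Longrightarrow> g = b k \<Longrightarrow> \<sigma> g = 0"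
    "\<And>g. g \<in> res_gens F k \<Longrightarrow> supp (\<eta> (unit_cell g) - boundary (\<sigma> g)) \<subseteq> cells {b k} (rank g)"
    using gens by metis
  have "supp (\<eta> c - boundary (gen_extend \<sigma> c)) \<subseteq> cells {b k} n"
    if c: "supp c \<subseteq> cells (res_gens F k) n" for n c
    using c
  proof (rule frag_induction)
    show "supp (\<eta> 0 - boundary (gen_extend \<sigma> 0)) \<subseteq> cells {b k} n"
      using diff[of 0 0] by simp
    fix a assume "a \<in> cells (res_gens F k) n"
    then obtain g h where a: "a = (g, h)" "g \<in> res_gens F k" "h \<in> gr_hom (rank g) n" by (auto simp: cells_def)
    have "\<eta> (frag_of a) - boundary (gen_extend \<sigma> (frag_of a)) = push h (\<eta> (unit_cell g) - boundary (\<sigma> g))"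
      using push[OF a(3) unit_cell_keys[OF a(2)]] boundary_push[OF a(3) s(1)[OF a(2)]]
      by (simp add: a(1) push_unit_cell[OF a(3)] push_diff)
    then show "supp (\<eta> (frag_of a) - boundary (gen_extend \<sigma> (frag_of a))) \<subseteq> cells {b k} n"
      using push_keys[OF a(3) s(3)[OF a(2)]] by simp
  next
    fix x y
    assume xy: "supp (\<eta> x - boundary (gen_extend \<sigma> x)) \<subseteq> cells {b k} n"
      "supp (\<eta> y - boundary (gen_extend \<sigma> y)) \<subseteq> cells {b k} n"
    have "\<eta> (x - y) - boundary (gen_extend \<sigma> (x - y))
       = (\<eta> x - boundary (gen_extend \<sigma> x)) - (\<eta> y - boundary (gen_extend \<sigma> y))"
      by (simp add: diff gen_extend_diff boundary_diff)
    then show "supp (\<eta> (x - y) - boundary (gen_extend \<sigma> (x - y))) \<subseteq> cells {b k} n"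
      using keys_frag_diff[OF xy] by simp
  qed
  then show ?thesis using s(1) s(2)[OF b_res refl] by (intro exI[of _ \<sigma>] conjI ballI allI impI)
qed

lemma contracts_0: "\<exists>\<sigma>. contracts 0 \<sigma>"
proof -
  have "\<exists>\<sigma>. (\<forall>g \<in> res_gens F 0. supp (\<sigma> g) \<subseteq> cells (res_gens F (Suc 0)) (rank g)) \<and>
     \<sigma> (b 0) = 0 \<and>
     (\<forall>n c. supp c \<subseteq> cells (res_gens F 0) n \<longrightarrow>
        supp (c - boundary (gen_extend \<sigma> c)) \<subseteq> cells {b 0} n)"
  proof (rule deform_generators[of 0 "\<lambda>c. c"])
    fix g assume g: "g \<in> res_gens F 0"
    let ?n = "rank g"
    interpret A: group_hom "free_Abelian_group (cells (res_gens F 0) ?n)" "obj F ?n" "augmentation F ?n"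
      using augmentation_hom[OF F] gr_functorD(2)[OF F] by (simp add: group_hom_def group_hom_axioms_def)
    have u: "supp (unit_cell g) \<subseteq> cells (res_gens F 0) ?n" by (rule unit_cell_keys[OF g])
    have "augmentation F ?n (unit_cell g) \<in> carrier (obj F ?n)" using A.hom_closed[of "unit_cell g"] u by simp
    then obtain p where p: "supp p \<subseteq> cells {b 0} ?n" "augmentation F ?n p = augmentation F ?n (unit_cell g)"
      using b_surj by blast
    have p': "supp p \<subseteq> cells (res_gens F 0) ?n" using p(1) cells_b by blast
    have "augmentation F ?n (unit_cell g - p) = \<one>\<^bsub>obj F ?n\<^esub>"
      using hom_free_diff[OF gr_functorD(2)[OF F] augmentation_hom[OF F] u p'] p(2) A.hom_closed[of "unit_cell g"] u by simp
    then have "unit_cell g - p \<in> boundary ` carrier (obj (resolution F (Suc 0)) ?n)"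
      using cycle_is_boundary[OF F keys_frag_diff[OF u p']] by simp
    then obtain s where s: "supp s \<subseteq> cells (res_gens F (Suc 0)) ?n" "boundary s = unit_cell g - p" by auto
    show "\<exists>s. supp s \<subseteq> cells (res_gens F (Suc 0)) ?n \<and> (g = b 0 \<longrightarrow> s = 0) \<and>
          supp (unit_cell g - boundary s) \<subseteq> cells {b 0} ?n"
    proof (cases "g = b 0")
      case True then show ?thesis by (intro exI[of _ 0]) (simp add: unit_cell_keys)
    next
      case False then show ?thesis using s p(1) by (intro exI[of _ s]) simp
    qed
  qed simp_all
  then obtain \<sigma> where "contracts 0 \<sigma>" unfolding contracts_def by (elim exE conjE) simp
  then show ?thesis by (rule exI[of _ \<sigma>])
qed

lemma contracts_Suc:
  assumes s: "contracts k \<sigma>"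
  shows "\<exists>\<sigma>'. contracts (Suc k) \<sigma>' \<and> contracts_step k \<sigma> \<sigma>'"
proof -
  have sk: "supp (\<sigma> g) \<subseteq> cells (res_gens F (Suc k)) (rank g)" if "g \<in> res_gens F k" for g
    using s that by (auto simp: contracts_def)
  have sb: "\<sigma> (b k) = 0" using s by (simp add: contracts_def)
  have "\<exists>\<sigma>'. (\<forall>g \<in> res_gens F (Suc k). supp (\<sigma>' g) \<subseteq> cells (res_gens F (Suc (Suc k))) (rank g)) \<and>
     \<sigma>' (b (Suc k)) = 0 \<and>
     (\<forall>n c. supp c \<subseteq> cells (res_gens F (Suc k)) n \<longrightarrow>
        supp ((c - gen_extend \<sigma> (boundary c)) - boundary (gen_extend \<sigma>' c)) \<subseteq> cells {b (Suc k)} n)"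
  proof (rule deform_generators[of "Suc k" "\<lambda>c. c - gen_extend \<sigma> (boundary c)"])
    show "f \<in> gr_hom m n \<Longrightarrow> supp c \<subseteq> cells (res_gens F (Suc k)) m \<Longrightarrow>
      push f c - gen_extend \<sigma> (boundary (push f c)) = push f (c - gen_extend \<sigma> (boundary c))" for m n f c
      by (simp add: push_diff boundary_push[of f m n _ F k] gen_extend_push[OF sk boundary_keys])
    fix g assume g: "g \<in> res_gens F (Suc k)"
    let ?n = "rank g" and ?c = "gen_boundary g"
    have c: "supp ?c \<subseteq> cells (res_gens F k) ?n" by (rule gen_boundary_keys[OF g])
    have u: "supp (unit_cell g) \<subseteq> cells (res_gens F (Suc k)) ?n" by (rule unit_cell_keys[OF g])
    have bu: "boundary (unit_cell g) = ?c" by (rule boundary_unit_cell[OF g])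
    \<comment> \<open>The contraction in degree k moves the boundary of y into the subcomplex. By exactness there it is
      the boundary of some p in the subcomplex, and y - p is a cycle, hence a boundary.\<close>
    define y where "y = unit_cell g - gen_extend \<sigma> ?c"
    have y: "supp y \<subseteq> cells (res_gens F (Suc k)) ?n"
      unfolding y_def by (intro keys_frag_diff u gen_extend_keys[OF sk c])
    have "k = 0 \<or> boundary ?c = 0"
    proof (cases k)
      case (Suc j)
      then show ?thesis using boundary_boundary[OF F, of "unit_cell g" j ?n] u bu by simp
    qed simp
    then have byP: "supp (boundary y) \<subseteq> cells {b k} ?n"
      using s[unfolded contracts_def, THEN conjunct2, THEN conjunct2, rule_format, OF c]
      by (simp only: y_def boundary_diff bu)
    have "if k = 0 then augmentation F ?n (boundary y) = \<one>\<^bsub>obj F ?n\<^esub> else boundary (boundary y) = 0"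
    proof (cases k)
      case 0 then show ?thesis using augmentation_boundary[OF F, of y ?n] y by simp
    next
      case (Suc j) then show ?thesis using boundary_boundary[OF F, of y j ?n] y by simp
    qed
    then obtain p where p: "supp p \<subseteq> cells {b (Suc k)} ?n" "boundary p = boundary y"
      using b_exact[OF byP] by blast
    have p': "supp p \<subseteq> cells (res_gens F (Suc k)) ?n" using p(1) cells_b by blast
    have "y - p \<in> boundary ` carrier (obj (resolution F (Suc (Suc k))) ?n)"
      using cycle_is_boundary[OF F keys_frag_diff[OF y p']] p(2) by (simp add: boundary_diff)
    then obtain t where t: "supp t \<subseteq> cells (res_gens F (Suc (Suc k))) ?n" "boundary t = y - p" by auto
    show "\<exists>s. supp s \<subseteq> cells (res_gens F (Suc (Suc k))) ?n \<and> (g = b (Suc k) \<longrightarrow> s = 0) \<and>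
          supp (unit_cell g - gen_extend \<sigma> (boundary (unit_cell g)) - boundary s) \<subseteq> cells {b (Suc k)} ?n"
    proof (cases "g = b (Suc k)")
      case True
      then have "gen_extend \<sigma> ?c = 0"
        using b_boundary[of k] sb by (intro gen_extend_cong_0[of _ "{b k}" ?n]) auto
      then have "gen_extend \<sigma> (boundary (unit_cell g)) = 0" using bu by simp
      then show ?thesis using True unit_cell_keys[of g "{b (Suc k)}"] by (intro exI[of _ 0]) auto
    next
      case False then show ?thesis using t p(1) by (intro exI[of _ t]) (simp add: bu flip: y_def)
    qed
  qed (simp add: boundary_diff gen_extend_diff)
  then obtain \<sigma>' where s': "\<forall>g \<in> res_gens F (Suc k). supp (\<sigma>' g) \<subseteq> cells (res_gens F (Suc (Suc k))) (rank g)"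
     "\<sigma>' (b (Suc k)) = 0" "contracts_step k \<sigma> \<sigma>'"
    unfolding contracts_step_def by (elim exE conjE)
  have "supp (c - boundary (gen_extend \<sigma>' c)) \<subseteq> cells {b (Suc k)} n"
    if "supp c \<subseteq> cells (res_gens F (Suc k)) n" "boundary c = 0" for c n
    using s'(3)[unfolded contracts_step_def, rule_format, OF that(1)] that(2) by simp
  then have "contracts (Suc k) \<sigma>'" using s'(1,2) unfolding contracts_def by simp
  with s'(3) show ?thesis by (intro exI[of _ \<sigma>'] conjI)
qed

definition contraction :: "nat \<Rightarrow> 'a gen \<Rightarrow> 'a chain" where
  "contraction = (SOME \<sigma>. \<forall>k. contracts k (\<sigma> k) \<and> contracts_step k (\<sigma> k) (\<sigma> (Suc k)))"

lemma contraction: "contracts k (contraction k)" "contracts_step k (contraction k) (contraction (Suc k))"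
proof -
  have "\<exists>\<sigma>. \<forall>k. contracts k (\<sigma> k) \<and> contracts_step k (\<sigma> k) (\<sigma> (Suc k))"
    by (rule dependent_nat_choice) (simp_all add: contracts_0 contracts_Suc)
  from someI_ex[OF this] show "contracts k (contraction k)" "contracts_step k (contraction k) (contraction (Suc k))"
    by (simp_all add: contraction_def)
qed

text \<open>The chain map homotopic to the identity by way of the contraction.\<close>

definition retraction :: "nat \<Rightarrow> 'a chain \<Rightarrow> 'a chain" where
  "retraction k c = c - (if k = 0 then 0 else gen_extend (contraction (k - 1)) (boundary c))
     - boundary (gen_extend (contraction k) c)"

lemma contraction_keys:
  "supp c \<subseteq> cells (res_gens F k) n \<Longrightarrow>
   supp (gen_extend (contraction k) c) \<subseteq> cells (res_gens F (Suc k)) n"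
  using contraction(1)[of k] by (intro gen_extend_keys) (auto simp: contracts_def)

lemma contraction_push:
  "f \<in> gr_hom m n \<Longrightarrow> supp c \<subseteq> cells (res_gens F k) m \<Longrightarrow>
   gen_extend (contraction k) (push f c) = push f (gen_extend (contraction k) c)"
  using contraction(1)[of k] by (intro gen_extend_push[of "res_gens F k" _ "res_gens F (Suc k)"]) (auto simp: contracts_def)

lemma retraction_b:
  assumes "supp c \<subseteq> cells (res_gens F k) n"
  shows "supp (retraction k c) \<subseteq> cells {b k} n"
proof (cases k)
  case 0 then show ?thesis using assms contraction(1)[of 0] by (auto simp: contracts_def retraction_def)
next
  case (Suc j) then show ?thesis using assms contraction(2)[of j] by (auto simp: contracts_step_def retraction_def)
qed

lemma retraction_keys:
  "supp c \<subseteq> cells (res_gens F k) n \<Longrightarrow> supp (retraction k c) \<subseteq> cells (res_gens F k) n"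
  using retraction_b cells_b by blast

lemma retraction_push:
  assumes "f \<in> gr_hom m n" and c: "supp c \<subseteq> cells (res_gens F k) m"
  shows "retraction k (push f c) = push f (retraction k c)"
proof -
  have 1: "boundary (gen_extend (contraction k) (push f c)) = push f (boundary (gen_extend (contraction k) c))"
    by (simp add: contraction_push[OF assms] boundary_push[OF assms(1) contraction_keys[OF c]])
  show ?thesis
  proof (cases k)
    case 0 with 1 show ?thesis by (simp add: retraction_def push_diff)
  next
    case (Suc j)
    have c': "supp c \<subseteq> cells (res_gens F (Suc j)) m" using c Suc by simp
    with 1 show ?thesis
      by (simp add: retraction_def push_diff Suc boundary_push[OF assms(1) c'] contraction_push[OF assms(1) boundary_keys[OF c']])
  qed
qed

lemma retraction_add: "retraction k (c + d) = retraction k c + retraction k d"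
  by (simp add: retraction_def gen_extend_add boundary_add)

lemma retraction_unit_cell: "retraction k (unit_cell (b k)) = unit_cell (b k)"
proof -
  have s: "contraction k (b k) = 0" for k using contraction(1)[of k] by (simp add: contracts_def)
  show ?thesis
  proof (cases k)
    case 0 then show ?thesis using s[of 0] by (simp add: retraction_def unit_cell_def)
  next
    case (Suc j)
    have "gen_extend (contraction j) (boundary (unit_cell (b (Suc j)))) = 0"
      using gen_extend_cong_0[OF b_boundary[of j], of "contraction j"] s[of j] boundary_unit_cell[OF b_res[of "Suc j"]] by simp
    then show ?thesis using s[of "Suc j"] Suc by (simp add: retraction_def) (simp add: unit_cell_def)
  qed
qed

text \<open>Both sides are \<open>\<partial>c - \<partial>\<sigma>\<partial>c\<close>.\<close>

lemma retraction_boundary: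
  assumes c: "supp c \<subseteq> cells (res_gens F (Suc k)) n"
  shows "retraction k (boundary c) = boundary (retraction (Suc k) c)"
proof -
  have "(if k = 0 then 0 else gen_extend (contraction (k - 1)) (boundary (boundary c))) = 0"
    using boundary_boundary[OF F, of c "k - 1" n] c by simp
  moreover have "boundary (boundary (gen_extend (contraction (Suc k)) c)) = 0"
    by (rule boundary_boundary[OF F contraction_keys[OF c]])
  ultimately show ?thesis by (simp add: retraction_def boundary_diff)
qed

context
  fixes G :: "'b gr_functor" assumes G: "is_gr_functor G"
begin

abbreviation at_gen :: "nat \<Rightarrow> (nat \<Rightarrow> 'a chain \<Rightarrow> 'b) \<Rightarrow> 'b" where
  "at_gen k \<phi> \<equiv> \<phi> (rank (b k)) (unit_cell (b k))"

text \<open>The differential of the complex \<open>G(rank (b 0)) \<rightarrow> G(rank (b 1)) \<rightarrow> \<dots>\<close> into which Yoneda's lemma turns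
  the transformations from the subcomplex to \<open>G\<close>.\<close>

definition gen_differential :: "nat \<Rightarrow> 'b \<Rightarrow> 'b" where
  "gen_differential k x = gen_value_at G x (rank (b (Suc k))) (gen_boundary (b (Suc k)))"

definition gen_cocycles :: "nat \<Rightarrow> 'b set" where
  "gen_cocycles k = {x \<in> carrier (obj G (rank (b k))). gen_differential k x = \<one>\<^bsub>obj G (rank (b (Suc k)))\<^esub>}"

definition gen_coboundaries :: "nat \<Rightarrow> 'b set" where
  "gen_coboundaries k = (if k = 0 then {\<one>\<^bsub>obj G (rank (b 0))\<^esub>}
     else gen_differential (k - 1) ` carrier (obj G (rank (b (k - 1)))))"

lemma value_closed: "\<phi> \<in> nat_trans (resolution F k) G \<Longrightarrow> at_gen k \<phi> \<in> carrier (obj G (rank (b k)))"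
  using hom_in_carrier[OF nat_transD(1)] unit_cell_keys[OF b_res[of k]] by fastforce

lemma differential_value:
  assumes p: "\<phi> \<in> nat_trans (resolution F k) G"
  shows "\<phi> (rank (b (Suc k))) (gen_boundary (b (Suc k))) = gen_differential k (at_gen k \<phi>)"
  unfolding gen_differential_def
  by (rule nat_trans_gen_value_at[OF G p[unfolded resolution_def] b_res b_boundary])

lemma agree_on_b:
  assumes "\<phi> \<in> nat_trans (resolution F k) G" "\<psi> \<in> nat_trans (resolution F k) G"
    "at_gen k \<phi> = at_gen k \<psi>"
    "supp c \<subseteq> cells {b k} n"
  shows "\<phi> n c = \<psi> n c"
  using nat_trans_gen_value_at[OF G assms(1)[unfolded resolution_def] b_res assms(4)]
    nat_trans_gen_value_at[OF G assms(2)[unfolded resolution_def] b_res assms(4)] assms(3) by simp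

lemma nat_trans_one: "\<phi> \<in> nat_trans (resolution F k) G \<Longrightarrow> \<phi> n 0 = \<one>\<^bsub>obj G n\<^esub>"
  using hom_one[OF nat_transD(1) _ gr_functorD(2)[OF G], of \<phi> "resolution F k" n] by simp

lemma group_Hom_resolution: "group (Hom_group (resolution F k) G)"
  using comm_group_Hom_group[OF is_gr_functor_free G, of "res_gens F k"]
  by (simp add: comm_group_def resolution_def)

lemma one_nat_trans: "\<one>\<^bsub>Hom_group (resolution F k) G\<^esub> \<in> nat_trans (resolution F k) G"
  using monoid.one_closed[OF group.is_monoid[OF group_Hom_resolution[of k]]] by (simp add: Hom_group_def)

lemma coboundary_nat_trans:
  "\<phi> \<in> nat_trans (resolution F k) G \<Longrightarrow> coboundary k F \<phi> \<in> nat_trans (resolution F (Suc k)) G"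
  using group_hom.hom_closed[OF coboundary_group_hom[OF F G, of k], of \<phi>] by (simp add: Hom_group_def)

lemma coboundary_value:
  assumes p: "\<phi> \<in> nat_trans (resolution F k) G"
  shows "at_gen (Suc k) (coboundary k F \<phi>)
     = gen_differential k (at_gen k \<phi>)"
  using differential_value[OF p] unit_cell_keys[OF b_res[of "Suc k"]] boundary_unit_cell[OF b_res[of "Suc k"]]
  by (simp add: coboundary_def)

lemma exists_with_value:
  assumes x: "x \<in> carrier (obj G (rank (b k)))"
  shows "\<exists>\<psi> \<in> nat_trans (resolution F k) G. at_gen k \<psi> = x"
proof -
  define l where "l g = (if g = b k then x else \<one>\<^bsub>obj G (rank g)\<^esub>)" for g
  have "\<exists>\<psi> \<in> nat_trans (free_functor (res_gens F k)) G. \<forall>g \<in> res_gens F k. \<psi> (rank g) (unit_cell g) = l g"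
    by (rule yoneda_exists[OF G]) (use x gr_functorD(2)[OF G] in \<open>auto simp: l_def group.is_monoid\<close>)
  then obtain \<psi> where "\<psi> \<in> nat_trans (resolution F k) G" "at_gen k \<psi> = l (b k)"
    using b_res[of k] unfolding resolution_def by blast
  then show ?thesis by (auto simp: l_def)
qed

lemma cocycle_value:
  assumes "\<phi> \<in> cocycles k F G"
  shows "at_gen k \<phi> \<in> gen_cocycles k"
proof -
  have p: "\<phi> \<in> nat_trans (resolution F k) G" using assms by (simp add: cocycles_def)
  have "\<phi> (rank (b (Suc k))) (boundary (unit_cell (b (Suc k)))) = \<one>\<^bsub>obj G (rank (b (Suc k)))\<^esub>"
    using assms unit_cell_keys[OF b_res[of "Suc k"]] by (simp add: cocycles_def)
  then show ?thesis
    using differential_value[OF p] value_closed[OF p] by (simp add: gen_cocycles_def boundary_unit_cell[OF b_res])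
qed

lemma coboundaries_value:
  assumes "\<phi> \<in> coboundaries k F G"
  shows "at_gen k \<phi> \<in> gen_coboundaries k"
proof (cases k)
  case 0
  then show ?thesis using assms unit_cell_keys[OF b_res[of 0]] by (simp add: Hom_group_def gen_coboundaries_def)
next
  case (Suc j)
  then obtain \<psi> where "\<psi> \<in> nat_trans (resolution F j) G" "\<phi> = coboundary j F \<psi>" using assms by auto
  then show ?thesis using Suc coboundary_value value_closed by (auto simp: gen_coboundaries_def)
qed

text \<open>Extend \<open>x\<close> in any way to a transformation on the whole resolution and compose with the retraction:
  the result depends only on the subcomplex, where \<open>x\<close> is a cocycle.\<close>

lemma cocycle_exists:
  assumes x: "x \<in> gen_cocycles k"
  shows "\<exists>\<phi> \<in> cocycles k F G. at_gen k \<phi> = x"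
proof -
  obtain \<psi> where psi: "\<psi> \<in> nat_trans (resolution F k) G" "at_gen k \<psi> = x"
    using exists_with_value[of x k] x by (auto simp: gen_cocycles_def)
  define \<phi> where "\<phi> = (\<lambda>n. \<lambda>c \<in> carrier (obj (resolution F k) n). \<psi> n (retraction k c))"
  have phi: "\<phi> \<in> nat_trans (resolution F k) G"
    unfolding \<phi>_def resolution_def
    by (rule nat_trans_precomp[OF psi(1)[unfolded resolution_def]])
      (simp_all add: retraction_add retraction_keys retraction_push)
  have one: "(\<lambda>n. \<lambda>c \<in> carrier (obj (resolution F (Suc k)) n). \<one>\<^bsub>obj G n\<^esub>) \<in> nat_trans (resolution F (Suc k)) G"
    using one_nat_trans[of "Suc k"] by (simp add: Hom_group_def)
  have "\<psi> n (boundary p) = \<one>\<^bsub>obj G n\<^esub>" if p: "supp p \<subseteq> cells {b (Suc k)} n" for n p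
  proof -
    have "coboundary k F \<psi> n p = (\<lambda>n. \<lambda>c \<in> carrier (obj (resolution F (Suc k)) n). \<one>\<^bsub>obj G n\<^esub>) n p"
      by (rule agree_on_b[OF coboundary_nat_trans[OF psi(1)] one _ p])
        (use coboundary_value[OF psi(1)] psi(2) x unit_cell_keys[OF b_res[of "Suc k"]] in \<open>simp add: gen_cocycles_def\<close>)
    then show ?thesis using order_trans[OF p cells_b] by (simp add: coboundary_def)
  qed
  then have "\<phi> n (boundary c) = \<one>\<^bsub>obj G n\<^esub>" if "supp c \<subseteq> cells (res_gens F (Suc k)) n" for n c
    using that retraction_boundary[OF that] boundary_keys[OF that] retraction_b[OF that] by (simp add: \<phi>_def)
  then have "\<phi> \<in> cocycles k F G" using phi by (simp add: cocycles_def)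
  moreover have "at_gen k \<phi> = x"
    using psi(2) unit_cell_keys[OF b_res[of k]] by (simp add: \<phi>_def retraction_unit_cell)
  ultimately show ?thesis by blast
qed

lemma cocycle_retraction:
  assumes p: "\<phi> \<in> cocycles k F G" and c: "supp c \<subseteq> cells (res_gens F k) n"
  shows "\<phi> n c = \<phi> n (retraction k c) \<otimes>\<^bsub>obj G n\<^esub>
     \<phi> n (if k = 0 then 0 else gen_extend (contraction (k - 1)) (boundary c))"
proof -
  let ?s = "if k = 0 then 0 else gen_extend (contraction (k - 1)) (boundary c)"
  have phi: "\<phi> \<in> nat_trans (resolution F k) G" using p by (simp add: cocycles_def)
  interpret G: comm_group "obj G n" by (rule gr_functorD(1)[OF G])
  have s: "supp ?s \<subseteq> cells (res_gens F k) n"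
  proof (cases k)
    case (Suc j)
    then show ?thesis using contraction_keys[OF boundary_keys[of c F j n]] c by simp
  qed simp
  let ?t = "boundary (gen_extend (contraction k) c)"
  have t: "supp ?t \<subseteq> cells (res_gens F k) n" "\<phi> n ?t = \<one>\<^bsub>obj G n\<^esub>"
    using boundary_keys[OF contraction_keys[OF c]] contraction_keys[OF c] p by (auto simp: cocycles_def)
  note r = retraction_keys[OF c]
  note m = hom_mult[OF nat_transD(1)[OF phi], of _ n]
  note cl = hom_in_carrier[OF nat_transD(1)[OF phi], of _ n]
  have rs: "supp (retraction k c + ?s) \<subseteq> cells (res_gens F k) n"
    using keys_add[of "retraction k c" ?s] r s by blast
  have "c = (retraction k c + ?s) + ?t" by (simp add: retraction_def)
  then have "\<phi> n c = \<phi> n ((retraction k c + ?s) + ?t)" by (rule arg_cong)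
  also have "\<dots> = \<phi> n (retraction k c + ?s) \<otimes>\<^bsub>obj G n\<^esub> \<phi> n ?t" using m[of "retraction k c + ?s" ?t] rs t by (simp del: if_split)
  also have "\<phi> n (retraction k c + ?s) = \<phi> n (retraction k c) \<otimes>\<^bsub>obj G n\<^esub> \<phi> n ?s"
    using m[of "retraction k c" ?s] r s by (simp del: if_split)
  finally show ?thesis using t(2) cl[of "retraction k c"] cl[of ?s] r s by (simp del: if_split)
qed

text \<open>By \<open>cocycle_retraction\<close> a cocycle is the sum of its composites with the retraction and with
  \<open>\<sigma> \<circ> \<partial>\<close>. The second is a coboundary, and the first is the coboundary of \<open>\<psi>\<close> composed with the retraction
  when the cocycle agrees with the coboundary of \<open>\<psi>\<close> on the subcomplex.\<close>

lemma coboundariesI: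
  assumes p: "\<phi> \<in> cocycles k F G" and v: "at_gen k \<phi> \<in> gen_coboundaries k"
  shows "\<phi> \<in> coboundaries k F G"
proof (cases k)
  case 0
  have phi: "\<phi> \<in> nat_trans (resolution F 0) G" using p 0 by (simp add: cocycles_def)
  note one = one_nat_trans[of 0]
  have r1: "\<phi> n q = \<one>\<^bsub>obj G n\<^esub>" if "supp q \<subseteq> cells {b 0} n" for n q
  proof -
    have "\<phi> n q = \<one>\<^bsub>Hom_group (resolution F 0) G\<^esub> n q"
      by (rule agree_on_b[OF phi one _ that])
        (use v 0 unit_cell_keys[OF b_res[of 0]] in \<open>simp add: Hom_group_def gen_coboundaries_def\<close>)
    then show ?thesis using order_trans[OF that cells_b] by (simp add: Hom_group_def)
  qed
  have "\<phi> = \<one>\<^bsub>Hom_group (resolution F 0) G\<^esub>"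
  proof
    fix n
    show "\<phi> n = \<one>\<^bsub>Hom_group (resolution F 0) G\<^esub> n"
    proof (rule extensionalityI[OF nat_transD(2)[OF phi] nat_transD(2)[OF one]])
      fix c assume "c \<in> carrier (obj (resolution F 0) n)"
      then have c: "supp c \<subseteq> cells (res_gens F 0) n" by simp
      interpret G: comm_group "obj G n" by (rule gr_functorD(1)[OF G])
      have "\<phi> n c = \<one>\<^bsub>obj G n\<^esub> \<otimes>\<^bsub>obj G n\<^esub> \<one>\<^bsub>obj G n\<^esub>"
        using cocycle_retraction[OF p, of c n] c 0 r1[OF retraction_b[OF c]] nat_trans_one[OF phi] by simp
      then show "\<phi> n c = \<one>\<^bsub>Hom_group (resolution F 0) G\<^esub> n c" using c by (simp add: Hom_group_def)
    qed
  qed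
  then show ?thesis using 0 by simp
next
  case (Suc j)
  have phi: "\<phi> \<in> nat_trans (resolution F (Suc j)) G" using p Suc by (simp add: cocycles_def)
  obtain y where y: "y \<in> carrier (obj G (rank (b j)))" "at_gen (Suc j) \<phi> = gen_differential j y"
    using v Suc by (auto simp: gen_coboundaries_def)
  obtain \<psi> where psi: "\<psi> \<in> nat_trans (resolution F j) G" "at_gen j \<psi> = y"
    using exists_with_value[OF y(1)] by blast
  define \<chi>1 where "\<chi>1 = (\<lambda>n. \<lambda>c \<in> carrier (obj (resolution F j) n). \<psi> n (retraction j c))"
  define \<chi>2 where "\<chi>2 = (\<lambda>n. \<lambda>c \<in> carrier (obj (resolution F j) n). \<phi> n (gen_extend (contraction j) c))"
  have x1: "\<chi>1 \<in> nat_trans (resolution F j) G"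
    unfolding \<chi>1_def resolution_def
    by (rule nat_trans_precomp[OF psi(1)[unfolded resolution_def]])
      (simp_all add: retraction_add retraction_keys retraction_push)
  have x2: "\<chi>2 \<in> nat_trans (resolution F j) G"
    unfolding \<chi>2_def resolution_def
    by (rule nat_trans_precomp[OF phi[unfolded resolution_def]])
      (simp_all add: gen_extend_add contraction_keys contraction_push)
  define \<chi> where "\<chi> = \<chi>1 \<otimes>\<^bsub>Hom_group (resolution F j) G\<^esub> \<chi>2"
  have chi: "\<chi> \<in> nat_trans (resolution F j) G"
    using monoid.m_closed[OF group.is_monoid[OF group_Hom_resolution[of j]], of \<chi>1 \<chi>2] x1 x2 by (simp add: Hom_group_def \<chi>_def)
  have "\<phi> = coboundary j F \<chi>"
  proof
    fix n
    show "\<phi> n = coboundary j F \<chi> n"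
    proof (rule extensionalityI[OF nat_transD(2)[OF phi] nat_transD(2)[OF coboundary_nat_trans[OF chi]]])
      fix c assume c0: "c \<in> carrier (obj (resolution F (Suc j)) n)"
      then have c: "supp c \<subseteq> cells (res_gens F (Suc j)) n" by simp
      have "\<phi> n (retraction (Suc j) c) = coboundary j F \<psi> n (retraction (Suc j) c)"
        by (rule agree_on_b[OF phi coboundary_nat_trans[OF psi(1)] _ retraction_b[OF c]])
          (use coboundary_value[OF psi(1)] psi(2) y(2) in simp)
      also have "\<dots> = \<psi> n (retraction j (boundary c))"
        using retraction_keys[OF c] by (simp add: coboundary_def retraction_boundary[OF c])
      finally have "\<phi> n c = \<psi> n (retraction j (boundary c)) \<otimes>\<^bsub>obj G n\<^esub> \<phi> n (gen_extend (contraction j) (boundary c))"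
        using cocycle_retraction[OF p, of c n] c Suc by simp
      then show "\<phi> n c = coboundary j F \<chi> n c"
        using c boundary_keys[OF c] by (simp add: coboundary_def \<chi>_def \<chi>1_def \<chi>2_def Hom_group_def)
    qed
  qed
  then show ?thesis using chi Suc by simp
qed

text \<open>Evaluation at the generator \<open>b k\<close> maps cocycles onto \<open>gen_cocycles k\<close> and reflects coboundaries, so a
  surjection from \<open>gen_cocycles k\<close> whose kernel is \<open>gen_coboundaries k\<close> computes \<open>Ext\<close>.\<close>

theorem Ext_iso:
  fixes H :: "'c monoid"
  assumes H: "group H"
    and mult: "\<And>x y. x \<in> carrier (obj G (rank (b k))) \<Longrightarrow> y \<in> carrier (obj G (rank (b k))) \<Longrightarrow>
        \<theta> (x \<otimes>\<^bsub>obj G (rank (b k))\<^esub> y) = \<theta> x \<otimes>\<^bsub>H\<^esub> \<theta> y"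
    and image: "\<theta> ` gen_cocycles k = carrier H"
    and ker: "\<And>x. x \<in> gen_cocycles k \<Longrightarrow> \<theta> x = \<one>\<^bsub>H\<^esub> \<longleftrightarrow> x \<in> gen_coboundaries k"
  shows "Ext k F G \<cong> H"
proof -
  let ?K = "Hom_group (resolution F k) G"
  let ?Z = "?K\<lparr>carrier := cocycles k F G\<rparr>"
  let ?h = "\<lambda>\<phi>. \<theta> (at_gen k \<phi>)"
  have K: "comm_group ?K"
    by (rule comm_group_Hom_group[OF _ G]) (simp add: resolution_def is_gr_functor_free)
  interpret D: group_hom ?K "Hom_group (resolution F (Suc k)) G" "coboundary k F"
    by (rule coboundary_group_hom[OF F G])
  have Z: "group ?Z"
    using subgroup.subgroup_is_group[OF D.subgroup_kernel D.G.group_axioms] by (simp add: cocycles_eq_kernel[OF F G])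
  have nt: "\<phi> \<in> nat_trans (resolution F k) G" if "\<phi> \<in> cocycles k F G" for \<phi> using that by (simp add: cocycles_def)
  have u: "unit_cell (b k) \<in> carrier (obj (resolution F k) (rank (b k)))" using unit_cell_keys[OF b_res[of k]] by simp
  have h: "?h \<in> hom ?Z H"
  proof (rule homI)
    show "?h \<phi> \<in> carrier H" if "\<phi> \<in> carrier ?Z" for \<phi>
      using that cocycle_value image by auto
  qed (use u in \<open>simp_all add: value_closed nt Hom_group_def mult\<close>)
  interpret h: group_hom ?Z H ?h using Z H h by (simp add: group_hom_def group_hom_axioms_def)
  have val: "(\<lambda>\<phi>. at_gen k \<phi>) ` cocycles k F G = gen_cocycles k"
  proof (intro equalityI subsetI)
    fix x assume "x \<in> gen_cocycles k"
    then obtain \<phi> where "\<phi> \<in> cocycles k F G" "at_gen k \<phi> = x" using cocycle_exists by blast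
    then show "x \<in> (\<lambda>\<phi>. at_gen k \<phi>) ` cocycles k F G" by (intro rev_image_eqI[of \<phi>]) simp_all
  qed (use cocycle_value in auto)
  have "?h ` carrier ?Z = \<theta> ` ((\<lambda>\<phi>. at_gen k \<phi>) ` cocycles k F G)" by (simp add: image_image)
  then have "?h ` carrier ?Z = carrier H" by (simp only: val image)
  then have "?Z Mod kernel ?Z H ?h \<cong> H" by (rule h.FactGroup_iso)
  moreover have "kernel ?Z H ?h = coboundaries k F G"
  proof -
    have sub: "coboundaries k F G \<subseteq> cocycles k F G"
    proof (cases k)
      case 0
      then show ?thesis using group.is_monoid[OF Z] monoid.one_closed by fastforce
    next
      case (Suc j)
      show ?thesis
      proof
        fix \<phi> assume "\<phi> \<in> coboundaries k F G"
        then obtain \<psi> where psi: "\<psi> \<in> nat_trans (resolution F j) G" "\<phi> = coboundary j F \<psi>" using Suc by auto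
        then show "\<phi> \<in> cocycles k F G"
          using coboundary_nat_trans[OF psi(1)] Suc boundary_keys[of _ F "Suc j"] boundary_boundary[OF F, of _ j] nat_trans_one[OF psi(1)]
          by (auto simp: cocycles_def coboundary_def)
      qed
    qed
    have iff: "?h \<phi> = \<one>\<^bsub>H\<^esub> \<longleftrightarrow> \<phi> \<in> coboundaries k F G" if "\<phi> \<in> cocycles k F G" for \<phi>
      using ker[OF cocycle_value[OF that]] coboundariesI[OF that] coboundaries_value by blast
    show ?thesis unfolding kernel_def using iff sub by auto
  qed
  ultimately show ?thesis by (simp add: Ext_def)
qed

end

end

section \<open>Integral forms\<close>

definition monomial :: "nat multiset \<Rightarrow> (nat \<Rightarrow> int) \<Rightarrow> int" where
  "monomial M v = (\<Prod>i\<in>#M. v i)"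

text \<open>Forms of degree \<open>d\<close> in the variables \<open>v 0, \<dots>, v (n - 1)\<close>, as functions on integer vectors. The vectors
  have infinitely many entries, which makes substitutions total; only the first \<open>n\<close> matter
  (\<open>forms_cong\<close>).\<close>

inductive_set forms :: "nat \<Rightarrow> nat \<Rightarrow> ((nat \<Rightarrow> int) \<Rightarrow> int) set" for n d where
  zero: "(\<lambda>v. 0) \<in> forms n d"
| step: "f \<in> forms n d \<Longrightarrow> set_mset M \<subseteq> {..<n} \<Longrightarrow> size M = d \<Longrightarrow>
    (\<lambda>v. f v + c * monomial M v) \<in> forms n d"

lemma monomial_simps [simp]:
  "monomial {#} v = 1" "monomial (add_mset i M) v = v i * monomial M v"
  "monomial (M + N) v = monomial M v * monomial N v"
  by (simp_all add: monomial_def)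

lemma forms_monomial: "set_mset M \<subseteq> {..<n} \<Longrightarrow> size M = d \<Longrightarrow> (\<lambda>v. c * monomial M v) \<in> forms n d"
  using forms.step[OF forms.zero, of M n d c] by simp

lemma forms_add:
  assumes "f \<in> forms n d" "g \<in> forms n d"
  shows "(\<lambda>v. f v + g v) \<in> forms n d"
  using assms(2)
proof (induction g rule: forms.induct)
  case (step g M c)
  then show ?case using forms.step[of "\<lambda>v. f v + g v" n d M c] by (simp add: add.assoc)
qed (simp add: assms(1))

lemma forms_scale: "f \<in> forms n d \<Longrightarrow> (\<lambda>v. k * f v) \<in> forms n d"
proof (induction f rule: forms.induct)
  case (step f M c)
  then show ?case using forms.step[of "\<lambda>v. k * f v" n d M "k * c"] by (simp add: algebra_simps)
qed (simp add: forms.zero)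

lemma forms_diff: "f \<in> forms n d \<Longrightarrow> g \<in> forms n d \<Longrightarrow> (\<lambda>v. f v - g v) \<in> forms n d"
  using forms_add[of f n d "\<lambda>v. -1 * g v"] forms_scale[of g n d "-1"] by simp

lemma forms_sum: "(\<And>a. a \<in> A \<Longrightarrow> f a \<in> forms n d) \<Longrightarrow> (\<lambda>v. \<Sum>a\<in>A. f a v) \<in> forms n d"
  by (induction A rule: infinite_finite_induct) (auto simp: forms.zero intro: forms_add)

lemma forms_var: "i < n \<Longrightarrow> (\<lambda>v. v i) \<in> forms n 1"
  using forms_monomial[of "{#i#}" n 1 1] by simp

lemma forms_var_times: "f \<in> forms n d \<Longrightarrow> i < n \<Longrightarrow> (\<lambda>v. v i * f v) \<in> forms n (Suc d)"
proof (induction f rule: forms.induct)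
  case (step f M c)
  then show ?case
    using forms.step[of "\<lambda>v. v i * f v" n "Suc d" "add_mset i M" c] by (simp add: algebra_simps)
qed (simp add: forms.zero)

lemma forms_linear_times:
  assumes "l \<in> forms n 1" "f \<in> forms n d"
  shows "(\<lambda>v. l v * f v) \<in> forms n (Suc d)"
  using assms(1)
proof (induction l rule: forms.induct)
  case (step l M c)
  obtain i where M: "M = {#i#}" using step.hyps(3) by (metis One_nat_def size_1_singleton_mset)
  then have "(\<lambda>v. c * (v i * f v)) \<in> forms n (Suc d)"
    using forms_scale[OF forms_var_times[OF assms(2)]] step.hyps(2) by simp
  from forms_add[OF step.IH this] show ?case by (simp add: M algebra_simps)
qed (simp add: forms.zero)

text \<open>The form of a linear substitution is seen by multiplying out one variable at a time.\<close>

lemma forms_subst: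
  assumes "f \<in> forms n d" "\<And>i. i < n \<Longrightarrow> (\<lambda>v. L v i) \<in> forms m 1"
  shows "(\<lambda>v. f (L v)) \<in> forms m d"
  using assms(1)
proof (induction f rule: forms.induct)
  case (step f M c)
  have "(\<lambda>v. monomial M (L v)) \<in> forms m (size M)"
    using step.hyps(2)
  proof (induction M)
    case empty
    then show ?case using forms_monomial[of "{#}" m 0 1] by simp
  next
    case (add i M)
    then show ?case using forms_linear_times[OF assms(2)] by simp
  qed
  with forms_add[OF step.IH forms_scale[of _ m d c]] step.hyps(3) show ?case by simp
qed (simp add: forms.zero)

lemma forms_cong: "f \<in> forms n d \<Longrightarrow> (\<And>i. i < n \<Longrightarrow> v i = w i) \<Longrightarrow> f v = f w"
proof (induction f rule: forms.induct)
  case (step f M c)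
  have "monomial M v = monomial M w"
    unfolding monomial_def using step.hyps(2) step.prems by (intro arg_cong[of _ _ prod_mset] image_mset_cong) auto
  then show ?case using step by simp
qed simp

lemma forms_0: "f \<in> forms 0 (Suc d) \<Longrightarrow> f = (\<lambda>v. 0)"
  by (induction f rule: forms.induct) auto

section \<open>The cobar differential\<close>

text \<open>The vector \<open>(v\<^sub>0, \<dots>, v\<^sub>a\<^sub>-\<^sub>1 + v\<^sub>a, \<dots>)\<close>. For \<open>a = 0\<close> no entry satisfies the middle condition and the formula
  drops \<open>v 0\<close>; for \<open>a = n + 1\<close> the first \<open>n\<close> entries are unchanged. So one formula covers all faces of a
  form in \<open>n\<close> variables.\<close>

definition coface :: "nat \<Rightarrow> (nat \<Rightarrow> int) \<Rightarrow> nat \<Rightarrow> int" where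
  "coface a v l = (if l + 1 < a then v l else if l + 1 = a then v l + v (l + 1) else v (l + 1))"

definition cobar :: "nat \<Rightarrow> ((nat \<Rightarrow> int) \<Rightarrow> int) \<Rightarrow> (nat \<Rightarrow> int) \<Rightarrow> int" where
  "cobar n f v = (\<Sum>a\<le>Suc n. (- 1) ^ a * f (coface a v))"

lemma cobar_add: "cobar n (\<lambda>v. f v + g v) v = cobar n f v + cobar n g v"
  by (simp add: cobar_def algebra_simps sum.distrib)

lemma cobar_scale: "cobar n (\<lambda>v. k * f v) v = k * cobar n f v"
  by (simp add: cobar_def sum_distrib_left algebra_simps)

lemma cobar_diff: "cobar n (\<lambda>v. f v - g v) v = cobar n f v - cobar n g v"
  by (simp add: cobar_def algebra_simps sum_subtractf)

lemma forms_cobar: assumes "f \<in> forms n d" shows "cobar n f \<in> forms (Suc n) d"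
proof -
  have "(\<lambda>v. f (coface a v)) \<in> forms (Suc n) d" for a
  proof (rule forms_subst[OF assms])
    fix i assume "i < n"
    then show "(\<lambda>v. coface a v i) \<in> forms (Suc n) 1"
      using forms_add[OF forms_var[of i "Suc n"] forms_var[of "Suc i" "Suc n"]]
        forms_var[of i "Suc n"] forms_var[of "Suc i" "Suc n"]
      by (cases "i + 1 < a"; cases "i + 1 = a") (simp_all add: coface_def)
  qed
  then have "(\<lambda>v. \<Sum>a\<le>Suc n. (- 1) ^ a * f (coface a v)) \<in> forms (Suc n) d"
    by (intro forms_sum forms_scale)
  then show ?thesis by (simp add: cobar_def[abs_def])
qed

section \<open>Normalised cochains\<close>

definition insert_zero :: "nat \<Rightarrow> (nat \<Rightarrow> int) \<Rightarrow> nat \<Rightarrow> int" where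
  "insert_zero j v i = (if i < j then v i else if i = j then 0 else v (i - 1))"

text \<open>The cosimplicial identities between cofaces and the codegeneracies \<open>insert_zero j\<close>.\<close>

lemma coface_insert_zero:
  "a < j \<Longrightarrow> coface a (insert_zero j v) = insert_zero (j - 1) (coface a v)"
  "coface j (insert_zero j v) = v"
  "coface (Suc j) (insert_zero j v) = v"
  "Suc j < a \<Longrightarrow> coface a (insert_zero j v) = insert_zero j (coface (a - 1) v)"
  by (rule ext; auto simp: coface_def insert_zero_def)+

lemma insert_zero_insert_zero:
  "i < j \<Longrightarrow> insert_zero j (insert_zero i v) = insert_zero i (insert_zero (j - 1) v)"
  by (rule ext) (auto simp: insert_zero_def)

definition vanishes :: "nat \<Rightarrow> ((nat \<Rightarrow> int) \<Rightarrow> int) \<Rightarrow> bool" where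
  "vanishes n f \<longleftrightarrow> (\<forall>j<n. \<forall>v. f (insert_zero j v) = 0)"

lemma cobar_split:
  assumes "j \<le> n"
  shows "cobar n f v = (\<Sum>a<j. (- 1) ^ a * f (coface a v))
    + ((- 1) ^ j * f (coface j v) + (- 1) ^ Suc j * f (coface (Suc j) v))
    + (\<Sum>a\<in>{Suc (Suc j)..Suc n}. (- 1) ^ a * f (coface a v))"
proof -
  have "{..Suc n} = {..<j} \<union> ({j, Suc j} \<union> {Suc (Suc j)..Suc n})" using assms by auto
  then show ?thesis unfolding cobar_def by (subst \<open>{..Suc n} = _\<close>) (subst sum.union_disjoint; force)+
qed

text \<open>Subtracting \<open>\<plusminus>\<delta>h\<close> with \<open>h = g \<circ> insert_zero j\<close> makes \<open>g\<close> vanish on one more hyperplane. When the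
  differential of \<open>g\<close> is evaluated on \<open>v\<^sub>j = 0\<close>, the two cofaces that merge \<open>v\<^sub>j\<close> with a neighbour cancel and
  the lower ones vanish, so the higher half of \<open>\<delta>h\<close> is zero; what is left of \<open>\<delta>h\<close> restricts to \<open>\<plusminus>h\<close>
  on \<open>v\<^sub>j = 0\<close> and to zero on the earlier hyperplanes.\<close>

lemma normalise_step:
  assumes g: "vanishes j g" and dg: "\<And>v. cobar (Suc n) g (insert_zero j v) = 0" and j: "j \<le> n"
  shows "vanishes (Suc j) (\<lambda>v. g v - (- 1) ^ j * cobar n (\<lambda>v. g (insert_zero j v)) v)"
proof -
  let ?h = "\<lambda>v. g (insert_zero j v)"
  have g0: "g (insert_zero i v) = 0" if "i < j" for i v using g that by (simp add: vanishes_def)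
  have h0: "?h (insert_zero i v) = 0" if "i < j" for i v
    using that by (simp add: insert_zero_insert_zero g0)
  have low: "cobar n ?h v = (\<Sum>b<Suc j. (- 1) ^ b * ?h (coface b v))" for v
  proof -
    have "0 = (\<Sum>a<j. (- 1) ^ a * g (coface a (insert_zero j v)))
      + (\<Sum>a\<in>{Suc (Suc j)..Suc (Suc n)}. (- 1) ^ a * g (coface a (insert_zero j v)))"
      using dg[of v] j by (simp add: cobar_split[of j "Suc n"] coface_insert_zero)
    also have "(\<Sum>a<j. (- 1) ^ a * g (coface a (insert_zero j v))) = 0"
      by (intro sum.neutral ballI) (auto simp: coface_insert_zero g0)
    also have "(\<Sum>a\<in>{Suc (Suc j)..Suc (Suc n)}. (- 1) ^ a * g (coface a (insert_zero j v)))
       = (\<Sum>b\<in>{Suc j..Suc n}. (- 1) ^ Suc b * ?h (coface b v))"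
      by (subst sum.shift_bounds_cl_Suc_ivl) (intro sum.cong, auto simp: coface_insert_zero)
    finally have "(\<Sum>b\<in>{Suc j..Suc n}. (- 1) ^ b * ?h (coface b v)) = 0"
      by (simp add: sum_negf)
    moreover have "{..Suc n} = {..<Suc j} \<union> {Suc j..Suc n}" using j by auto
    ultimately show ?thesis unfolding cobar_def by (subst \<open>{..Suc n} = _\<close>, subst sum.union_disjoint) auto
  qed
  show ?thesis unfolding vanishes_def
  proof (intro allI impI)
    fix i v assume "i < Suc j"
    then consider "i = j" | "i < j" by linarith
    then show "g (insert_zero i v) - (- 1) ^ j * cobar n ?h (insert_zero i v) = 0"
    proof cases
      case 1
      have "(\<Sum>b<j. (- 1) ^ b * ?h (coface b (insert_zero j v))) = 0"
        by (intro sum.neutral ballI) (auto simp: coface_insert_zero h0)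
      then have "cobar n ?h (insert_zero j v) = (- 1) ^ j * ?h v"
        unfolding low by (simp add: coface_insert_zero)
      then show ?thesis using 1 by (simp flip: mult.assoc power_mult_distrib)
    next
      case 2
      have s: "{..<Suc j} = {..<i} \<union> ({i, Suc i} \<union> {Suc (Suc i)..<Suc j})" using 2 by auto
      have "cobar n ?h (insert_zero i v) = (\<Sum>b<i. (- 1) ^ b * ?h (coface b (insert_zero i v)))
        + ((- 1) ^ i * ?h v + (- 1) ^ Suc i * ?h v)
        + (\<Sum>b\<in>{Suc (Suc i)..<Suc j}. (- 1) ^ b * ?h (coface b (insert_zero i v)))"
        unfolding low s by (subst sum.union_disjoint; force simp: coface_insert_zero)+
      moreover have "(\<Sum>b<i. (- 1) ^ b * ?h (coface b (insert_zero i v))) = 0"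
        using 2 by (intro sum.neutral ballI) (auto simp: coface_insert_zero h0)
      moreover have "(\<Sum>b\<in>{Suc (Suc i)..<Suc j}. (- 1) ^ b * ?h (coface b (insert_zero i v))) = 0"
        using 2 by (intro sum.neutral ballI) (auto simp: coface_insert_zero(4) h0)
      ultimately have "cobar n ?h (insert_zero i v) = 0" by simp
      then show ?thesis using g0[OF 2] by simp
    qed
  qed
qed

lemma forms_insert_zero:
  assumes "f \<in> forms (Suc n) d" "j \<le> n"
  shows "(\<lambda>v. f (insert_zero j v)) \<in> forms n d"
proof (rule forms_subst[OF assms(1)])
  fix i assume "i < Suc n"
  then show "(\<lambda>v. insert_zero j v i) \<in> forms n 1"
    using assms(2) forms_var[of i n] forms_var[of "i - 1" n] forms.zero[of n 1]
    by (cases "i < j"; cases "i = j") (simp_all add: insert_zero_def)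
qed

lemma coface_coface:
  "a < b \<Longrightarrow> f \<in> forms n d \<Longrightarrow> f (coface a (coface b v)) = f (coface (b - 1) (coface a v))"
  by (rule forms_cong) (auto simp: coface_def)

text \<open>The terms with \<open>a < b\<close> are matched with those with \<open>b \<le> a\<close> by the cosimplicial identity
  \<open>coface_coface\<close>, with opposite signs.\<close>

lemma cobar_cobar:
  assumes "f \<in> forms n d"
  shows "cobar (Suc n) (cobar n f) v = 0"
proof -
  let ?F = "\<lambda>b a. (- 1) ^ (a + b) * f (coface a (coface b v))"
  let ?U = "SIGMA b:{..Suc (Suc n)}. {..<b}" and ?L = "SIGMA b:{..Suc n}. {b..Suc n}"
  have "cobar (Suc n) (cobar n f) v = (\<Sum>b\<le>Suc (Suc n). \<Sum>a\<le>Suc n. ?F b a)"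
    unfolding cobar_def sum_distrib_left by (intro sum.cong refl) (simp add: power_add)
  also have "\<dots> = (\<Sum>(b, a)\<in>{..Suc (Suc n)} \<times> {..Suc n}. ?F b a)" by (rule sum.cartesian_product)
  also have "\<dots> = (\<Sum>(b, a)\<in>?U. ?F b a) + (\<Sum>(b, a)\<in>?L. ?F b a)"
  proof -
    have "{..Suc (Suc n)} \<times> {..Suc n} = ?U \<union> ?L" by auto
    moreover have "finite ?U" "finite ?L" "?U \<inter> ?L = {}" by auto
    ultimately show ?thesis by (simp only: sum.union_disjoint)
  qed
  also have "(\<Sum>(b, a)\<in>?U. ?F b a) = (\<Sum>(b, a)\<in>?L. - ?F b a)"
  proof (rule sum.reindex_bij_witness[of _ "\<lambda>(b, a). (Suc a, b)" "\<lambda>(b, a). (a, b - 1)"])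
    fix x assume "x \<in> ?U"
    then obtain b a where x: "x = (b, a)" "a < b" by auto
    then have "(- 1 :: int) ^ (a + b) = - ((- 1) ^ (b - 1 + a))" by (cases b) (auto simp: add.commute)
    then show "(case case x of (b, a) \<Rightarrow> (a, b - 1) of (b, a) \<Rightarrow> - ?F b a) = (case x of (b, a) \<Rightarrow> ?F b a)"
      using coface_coface[OF x(2) assms, of v] by (simp add: x(1))
  qed auto
  finally show ?thesis by (simp add: sum_negf case_prod_unfold)
qed

text \<open>The hypothesis on the differential holds for a cocycle, so every class has a normalised
  representative.\<close>

theorem normalise:
  assumes g: "g \<in> forms (Suc n) d" and dg: "vanishes (Suc (Suc n)) (cobar (Suc n) g)"
  shows "\<exists>h \<in> forms n d. vanishes (Suc n) (\<lambda>v. g v + cobar n h v)"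
proof -
  have "\<exists>h \<in> forms n d. vanishes j (\<lambda>v. g v + cobar n h v)" if "j \<le> Suc n" for j
    using that
  proof (induction j)
    case 0
    show ?case using forms.zero by (auto simp: vanishes_def)
  next
    case (Suc j)
    then obtain h where h: "h \<in> forms n d" "vanishes j (\<lambda>v. g v + cobar n h v)" by auto
    let ?g = "\<lambda>v. g v + cobar n h v"
    let ?k = "\<lambda>v. ?g (insert_zero j v)"
    have gf: "?g \<in> forms (Suc n) d" by (intro forms_add g forms_cobar h)
    have k: "?k \<in> forms n d" using Suc.prems by (intro forms_insert_zero[OF gf]) simp
    have "cobar (Suc n) ?g v = cobar (Suc n) g v" for v
      using cobar_add[of "Suc n" g "cobar n h" v] cobar_cobar[OF h(1)] by simp
    then have "cobar (Suc n) ?g (insert_zero j v) = 0" for v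
      using dg Suc.prems by (simp add: vanishes_def)
    from normalise_step[OF h(2) this] Suc.prems
    have "vanishes (Suc j) (\<lambda>v. ?g v - (- 1) ^ j * cobar n ?k v)" by simp
    moreover have "?g v - (- 1) ^ j * cobar n ?k v = g v + cobar n (\<lambda>v. h v - (- 1) ^ j * ?k v) v" for v
      by (simp add: cobar_diff cobar_scale)
    ultimately have "vanishes (Suc j) (\<lambda>v. g v + cobar n (\<lambda>v. h v - (- 1) ^ j * ?k v) v)" by simp
    then show ?case using forms_diff[OF h(1) forms_scale[OF k]] by blast
  qed
  then show ?thesis by blast
qed

section \<open>Forms divisible by every variable\<close>

definition full :: "nat \<Rightarrow> (nat \<Rightarrow> int) \<Rightarrow> int" where
  "full n v = (\<Prod>i<n. v i)"

text \<open>The product of all variables \<open>v 0, \<dots>, v n\<close> except \<open>v a\<close>.\<close>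

definition full_omit :: "nat \<Rightarrow> nat \<Rightarrow> (nat \<Rightarrow> int) \<Rightarrow> int" where
  "full_omit n a v = (\<Prod>i<n. v (if i < a then i else Suc i))"

lemma full_Suc: "full (Suc n) v = full n v * v n"
  by (simp add: full_def)

lemma full_omit: "a \<le> n \<Longrightarrow> full_omit n a v * v a = full (Suc n) v"
proof (induction n)
  case (Suc n)
  show ?case
  proof (cases "a = Suc n")
    case True
    have "full_omit (Suc n) (Suc n) v = full (Suc n) v" by (simp add: full_omit_def full_def)
    then show ?thesis using True by (simp add: full_Suc)
  next
    case False
    then have "a \<le> n" using Suc.prems by simp
    moreover from this have "full_omit (Suc n) a v = full_omit n a v * v (Suc n)" by (simp add: full_omit_def)
    ultimately show ?thesis using Suc.IH by (simp add: full_Suc algebra_simps)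
  qed
qed (simp add: full_omit_def full_def)

text \<open>The factor \<open>v\<^sub>a\<^sub>-\<^sub>1 + v\<^sub>a\<close> distributes into the two products that omit one of its summands.\<close>

lemma full_coface:
  assumes "a \<le> Suc n"
  shows "full n (coface a v) = (if a \<le> n then full_omit n a v else 0) + (if a = 0 then 0 else full_omit n (a - 1) v)"
proof (cases a)
  case 0
  then show ?thesis by (simp add: full_def full_omit_def coface_def)
next
  case (Suc b)
  show ?thesis
  proof (cases "b = n")
    case True
    then show ?thesis using Suc by (simp add: full_def full_omit_def coface_def)
  next
    case False
    then have b: "b < n" using assms Suc by simp
    let ?R = "\<Prod>i\<in>{..<n} - {b}. v (if i < b then i else Suc i)"
    have "full n (coface a v) = (v b + v (Suc b)) * ?R"
      unfolding full_def using b Suc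
      by (subst prod.remove[of _ b]) (auto simp: coface_def intro!: prod.cong)
    moreover have "full_omit n a v = v b * ?R"
      unfolding full_omit_def using b Suc
      by (subst prod.remove[of _ b]) (auto intro!: prod.cong)
    moreover have "full_omit n b v = v (Suc b) * ?R"
      unfolding full_omit_def using b by (subst prod.remove[of _ b]) auto
    ultimately show ?thesis using Suc b by (simp add: algebra_simps)
  qed
qed

text \<open>By \<open>full_coface\<close> every product \<open>full_omit n a\<close> occurs in the cofaces \<open>a\<close> and \<open>a + 1\<close>, with opposite signs.
  For a variable \<open>q = v\<^sub>j\<close> only \<open>a = j\<close> and \<open>a = j + 1\<close> contribute, which gives the formulas
  below.\<close>

lemma cobar_full:
  "cobar n (\<lambda>v. full n v * q v) v
     = (\<Sum>a\<le>n. (- 1) ^ a * full_omit n a v * (q (coface a v) - q (coface (Suc a) v)))"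
proof -
  let ?s = "\<lambda>a. (- 1) ^ a * q (coface a v)"
  have "cobar n (\<lambda>v. full n v * q v) v
     = (\<Sum>a\<le>Suc n. ?s a * (if a \<le> n then full_omit n a v else 0))
     + (\<Sum>a\<le>Suc n. ?s a * (if a = 0 then 0 else full_omit n (a - 1) v))"
    unfolding cobar_def sum.distrib[symmetric]
    by (intro sum.cong refl) (simp add: full_coface algebra_simps)
  also have "(\<Sum>a\<le>Suc n. ?s a * (if a \<le> n then full_omit n a v else 0)) = (\<Sum>a\<le>n. ?s a * full_omit n a v)"
    by simp
  also have "(\<Sum>a\<le>Suc n. ?s a * (if a = 0 then 0 else full_omit n (a - 1) v)) = (\<Sum>a\<le>n. ?s (Suc a) * full_omit n a v)"
    by (subst sum.atMost_Suc_shift) simp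
  also have "(\<Sum>a\<le>n. ?s a * full_omit n a v) + \<dots>
    = (\<Sum>a\<le>n. (- 1) ^ a * full_omit n a v * (q (coface a v) - q (coface (Suc a) v)))"
    unfolding sum.distrib[symmetric] by (intro sum.cong refl) (simp add: algebra_simps)
  finally show ?thesis .
qed

lemma coface_var_diff:
  "coface a v j - coface (Suc a) v j = (if a = j then - v j else if a = Suc j then v (Suc j) else 0)"
  by (auto simp: coface_def)

lemma cobar_full_aux:
  assumes "j < n"
  shows "(\<Sum>a\<le>n. (- 1) ^ a * full_omit n a v * ((coface a v j - coface (Suc a) v j) * w a))
     = (- 1) ^ Suc j * full (Suc n) v * (w j + w (Suc j))"
proof -
  have "(\<Sum>a\<le>n. (- 1) ^ a * full_omit n a v * ((coface a v j - coface (Suc a) v j) * w a))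
    = (\<Sum>a\<in>{j, Suc j}. (- 1) ^ a * full_omit n a v * ((coface a v j - coface (Suc a) v j) * w a))"
    using assms by (intro sum.mono_neutral_right) (auto simp: coface_var_diff)
  also have "\<dots> = (- 1) ^ Suc j * (full_omit n j v * v j) * w j + (- 1) ^ Suc j * (full_omit n (Suc j) v * v (Suc j)) * w (Suc j)"
    by (simp add: coface_var_diff)
  also have "\<dots> = (- 1) ^ Suc j * full (Suc n) v * (w j + w (Suc j))"
    using assms full_omit[of j n v] full_omit[of "Suc j" n v] by (simp add: algebra_simps)
  finally show ?thesis .
qed

lemma cobar_full_1: "cobar n (full n) v = 0"
  using cobar_full[of n "\<lambda>v. 1" v] by simp

lemma cobar_full_var:
  "j < n \<Longrightarrow> cobar n (\<lambda>v. full n v * v j) v = (- 1) ^ Suc j * 2 * full (Suc n) v"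
  unfolding cobar_full using cobar_full_aux[of j n v "\<lambda>_. 1"] by simp

lemma cobar_full_var_var:
  assumes "i < n" "j < n"
  shows "cobar n (\<lambda>v. full n v * (v i * v j)) v = full (Suc n) v *
    ((- 1) ^ Suc i * (coface i v j + coface (Suc i) v j) + (- 1) ^ Suc j * (coface (Suc j) v i + coface (Suc (Suc j)) v i))"
proof -
  have "cobar n (\<lambda>v. full n v * (v i * v j)) v
    = (\<Sum>a\<le>n. (- 1) ^ a * full_omit n a v * ((coface a v i - coface (Suc a) v i) * coface a v j))
    + (\<Sum>a\<le>n. (- 1) ^ a * full_omit n a v * ((coface a v j - coface (Suc a) v j) * coface (Suc a) v i))"
    unfolding cobar_full sum.distrib[symmetric] by (intro sum.cong refl) (simp add: algebra_simps)
  then show ?thesis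
    unfolding cobar_full_aux[OF assms(1)] cobar_full_aux[OF assms(2), of v "\<lambda>a. coface (Suc a) v i"]
    by (simp add: algebra_simps)
qed

lemma cobar_full_square:
  "j < n \<Longrightarrow> cobar n (\<lambda>v. full n v * (v j * v j)) v = (- 1) ^ Suc j * 3 * (full (Suc n) v * (v j + v (Suc j)))"
  by (simp add: cobar_full_var_var) (simp add: coface_def algebra_simps)

lemma cobar_full_mixed:
  "i < j \<Longrightarrow> j < n \<Longrightarrow> cobar n (\<lambda>v. full n v * (v i * v j)) v
     = 2 * full (Suc n) v * ((- 1) ^ Suc i * v (Suc j) + (- 1) ^ Suc j * v i)"
  by (simp add: cobar_full_var_var) (simp add: coface_def algebra_simps)

section \<open>The terms that involve every variable\<close>

text \<open>Inclusion and exclusion over the coordinate hyperplanes: the monomials that involve all of the first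
  \<open>n\<close> variables are kept and all others are removed.\<close>

definition normal_part :: "nat \<Rightarrow> ((nat \<Rightarrow> int) \<Rightarrow> int) \<Rightarrow> (nat \<Rightarrow> int) \<Rightarrow> int" where
  "normal_part n f v = (\<Sum>S\<in>Pow {..<n}. (- 1) ^ card S * f (\<lambda>i. if i \<in> S then 0 else v i))"

lemma normal_part_add: "normal_part n (\<lambda>v. f v + g v) v = normal_part n f v + normal_part n g v"
  by (simp add: normal_part_def algebra_simps sum.distrib)

lemma normal_part_scale: "normal_part n (\<lambda>v. k * f v) v = k * normal_part n f v"
  by (simp add: normal_part_def sum_distrib_left algebra_simps)

lemma normal_part_sum: "normal_part n (\<lambda>v. \<Sum>a\<in>A. f a v) v = (\<Sum>a\<in>A. normal_part n (f a) v)"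
  unfolding normal_part_def by (subst sum.swap) (simp add: sum_distrib_left)

lemma vanishesD: "vanishes n f \<Longrightarrow> j < n \<Longrightarrow> v j = 0 \<Longrightarrow> f v = 0"
proof -
  assume "vanishes n f" "j < n" "v j = 0"
  moreover from \<open>v j = 0\<close> have "insert_zero j (\<lambda>i. v (if i < j then i else Suc i)) = v"
    by (auto simp: insert_zero_def fun_eq_iff)
  ultimately show "f v = 0" unfolding vanishes_def by metis
qed

lemma vanishesI: "(\<And>j v. j < n \<Longrightarrow> v j = 0 \<Longrightarrow> f v = 0) \<Longrightarrow> vanishes n f"
  unfolding vanishes_def by (auto simp: insert_zero_def)

lemma vanishes_full: "vanishes n (\<lambda>v. full n v * q v)"
  by (rule vanishesI) (auto simp: full_def)

lemma normal_part_vanishes: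
  assumes "vanishes n f"
  shows "normal_part n f v = f v"
proof -
  have "normal_part n f v = (\<Sum>S\<in>{{}}. (- 1) ^ card S * f (\<lambda>i. if i \<in> S then 0 else v i))"
    unfolding normal_part_def
  proof (rule sum.mono_neutral_right)
    show "\<forall>S\<in>Pow {..<n} - {{}}. (- 1) ^ card S * f (\<lambda>i. if i \<in> S then 0 else v i) = 0"
    proof
      fix S assume "S \<in> Pow {..<n} - {{}}"
      then obtain j where "j \<in> S" "j < n" by auto
      then have "f (\<lambda>i. if i \<in> S then 0 else v i) = 0" by (intro vanishesD[OF assms, of j]) auto
      then show "(- 1) ^ card S * f (\<lambda>i. if i \<in> S then 0 else v i) = 0" by simp
    qed
  qed auto
  then show ?thesis by simp
qed

lemma normal_part_independent:
  assumes i: "i < n" and ind: "\<And>v w. (\<And>l. l \<noteq> i \<Longrightarrow> v l = w l) \<Longrightarrow> f v = f w"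
  shows "normal_part n f v = 0"
proof -
  let ?t = "\<lambda>S. (- 1) ^ card S * f (\<lambda>i. if i \<in> S then 0 else v i)"
  have "insert i ({..<n} - {i}) = {..<n}" using i by auto
  then have P: "Pow {..<n} = Pow ({..<n} - {i}) \<union> insert i ` Pow ({..<n} - {i})"
    by (metis Pow_insert)
  have inj: "inj_on (insert i) (Pow ({..<n} - {i}))"
    by (auto simp: inj_on_def)
  have "normal_part n f v = (\<Sum>S\<in>Pow ({..<n} - {i}). ?t S) + (\<Sum>S\<in>Pow ({..<n} - {i}). ?t (insert i S))"
    unfolding normal_part_def P by (subst sum.union_disjoint) (auto simp: sum.reindex[OF inj])
  also have "\<dots> = (\<Sum>S\<in>Pow ({..<n} - {i}). ?t S + ?t (insert i S))" by (rule sum.distrib[symmetric])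
  also have "\<dots> = 0"
  proof (intro sum.neutral ballI)
    fix S assume S: "S \<in> Pow ({..<n} - {i})"
    then have "finite S" "i \<notin> S" by (auto intro: finite_subset)
    moreover have "f (\<lambda>l. if l \<in> insert i S then 0 else v l) = f (\<lambda>l. if l \<in> S then 0 else v l)"
      by (rule ind) auto
    ultimately show "?t S + ?t (insert i S) = 0" by simp
  qed
  finally show ?thesis .
qed

lemma monomial_full:
  assumes "{..<n} \<subseteq> set_mset M"
  obtains M' where "set_mset M' \<subseteq> set_mset M" "size M = n + size M'" "monomial M = (\<lambda>v. full n v * monomial M' v)"
proof -
  have "mset_set {..<n} \<subseteq># M"
    using assms by (auto simp: subseteq_mset_def count_mset_set' Suc_le_eq)
  then have M: "M = mset_set {..<n} + (M - mset_set {..<n})" by simp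
  have "size M = n + size (M - mset_set {..<n})" by (subst M, subst size_union) simp
  moreover have "monomial M = (\<lambda>v. full n v * monomial (M - mset_set {..<n}) v)"
  proof
    show "monomial M v = full n v * monomial (M - mset_set {..<n}) v" for v
      by (subst M, subst monomial_simps) (simp add: monomial_def full_def prod_unfold_prod_mset)
  qed
  ultimately show ?thesis by (intro that[of "M - mset_set {..<n}"]) (auto dest: in_diffD)
qed

lemma monomial_cong: "(\<And>i. i \<in># M \<Longrightarrow> v i = w i) \<Longrightarrow> monomial M v = monomial M w"
  unfolding monomial_def by (intro arg_cong[of _ _ prod_mset] image_mset_cong)

lemma normal_part_monomial:
  assumes "\<not> {..<n} \<subseteq> set_mset M"
  shows "normal_part n (monomial M) v = 0"
proof -
  obtain i where "i < n" "i \<notin># M" using assms by auto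
  then show ?thesis by (intro normal_part_independent[of i] monomial_cong) metis+
qed

lemma normal_part_cobar_monomial:
  assumes "\<not> {..<n} \<subseteq> set_mset M"
  shows "normal_part (Suc n) (cobar n (monomial M)) v = 0"
proof -
  obtain i where i: "i < n" "i \<notin># M" using assms by auto
  \<comment> \<open>M omits the variable i, so its composite with the coface a omits one of the variables
    i and i + 1: merged entries other than the i-th do not contain it.\<close>
  have "normal_part (Suc n) (\<lambda>v. monomial M (coface a v)) v = 0" for a
  proof (rule normal_part_independent[of "if a \<le> i then Suc i else i"])
    fix v w :: "nat \<Rightarrow> int" assume vw: "\<And>l. l \<noteq> (if a \<le> i then Suc i else i) \<Longrightarrow> v l = w l"
    show "monomial M (coface a v) = monomial M (coface a w)"
    proof (rule monomial_cong)
      fix l assume "l \<in># M"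
      then have "l \<noteq> i" using i by auto
      then show "coface a v l = coface a w l"
        using vw[of l] vw[of "Suc l"] by (cases "a \<le> i") (auto simp: coface_def)
    qed
  qed (use i in auto)
  moreover have "cobar n (monomial M) = (\<lambda>v. \<Sum>a\<le>Suc n. (- 1) ^ a * monomial M (coface a v))"
    by (rule ext) (rule cobar_def)
  ultimately show ?thesis by (simp only: normal_part_sum normal_part_scale) simp
qed

section \<open>Cohomology in codimension zero and one\<close>

text \<open>The sum of the coefficients of the monomials that involve every variable.\<close>

definition coefficient_sum :: "nat \<Rightarrow> ((nat \<Rightarrow> int) \<Rightarrow> int) \<Rightarrow> int" where
  "coefficient_sum n f = normal_part n f (\<lambda>_. 1)"

lemma coefficient_sum_add: "coefficient_sum n (\<lambda>v. f v + g v) = coefficient_sum n f + coefficient_sum n g"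
  by (simp add: coefficient_sum_def normal_part_add)

lemma coefficient_sum_scale: "coefficient_sum n (\<lambda>v. k * f v) = k * coefficient_sum n f"
  by (simp add: coefficient_sum_def normal_part_scale)

lemma coefficient_sum_full: "coefficient_sum n (\<lambda>v. full n v * q v) = q (\<lambda>_. 1)"
  by (simp add: coefficient_sum_def normal_part_vanishes[OF vanishes_full]) (simp add: full_def)

lemma cobar_add_fun: "cobar n (\<lambda>v. f v + g v) = (\<lambda>v. cobar n f v + cobar n g v)"
  by (rule ext) (rule cobar_add)

lemma cobar_scale_fun: "cobar n (\<lambda>v. k * f v) = (\<lambda>v. k * cobar n f v)"
  by (rule ext) (rule cobar_scale)

text \<open>A monomial that omits a variable contributes nothing, so the divisibility need only be checked on
  multiples of \<open>full n\<close>.\<close>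

lemma coefficient_sum_cobar_dvd:
  fixes p :: int
  assumes g: "g \<in> forms n (n + e)"
    and full: "\<And>M. set_mset M \<subseteq> {..<n} \<Longrightarrow> size M = e \<Longrightarrow>
      p dvd coefficient_sum (Suc n) (cobar n (\<lambda>v. full n v * monomial M v))"
  shows "p dvd coefficient_sum (Suc n) (cobar n g)"
  using g
proof (induction g rule: forms.induct)
  case zero
  show ?case by (simp add: cobar_def[abs_def] coefficient_sum_def normal_part_def)
next
  case (step f M c)
  have "p dvd coefficient_sum (Suc n) (cobar n (monomial M))"
  proof (cases "{..<n} \<subseteq> set_mset M")
    case True
    then obtain M' where "set_mset M' \<subseteq> set_mset M" "size M = n + size M'" "monomial M = (\<lambda>v. full n v * monomial M' v)"
      by (rule monomial_full)
    then show ?thesis using full[of M'] step.hyps by auto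
  next
    case False
    then show ?thesis by (simp add: coefficient_sum_def normal_part_cobar_monomial)
  qed
  then show ?case
    using step.IH by (simp add: cobar_add_fun cobar_scale_fun coefficient_sum_add coefficient_sum_scale)
qed

lemma normal_part_form:
  assumes "f \<in> forms n (n + e)"
  shows "\<exists>q \<in> forms n e. \<forall>v. normal_part n f v = full n v * q v"
  using assms
proof (induction f rule: forms.induct)
  case zero
  show ?case by (rule bexI[OF _ forms.zero]) (simp add: normal_part_def)
next
  case (step f M k)
  then obtain q where q: "q \<in> forms n e" "\<And>v. normal_part n f v = full n v * q v" by blast
  have "\<exists>r \<in> forms n e. \<forall>v. normal_part n (monomial M) v = full n v * r v"
  proof (cases "{..<n} \<subseteq> set_mset M")
    case True
    then obtain M' where M': "set_mset M' \<subseteq> set_mset M" "size M = n + size M'" "monomial M = (\<lambda>v. full n v * monomial M' v)"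
      by (rule monomial_full)
    then have "(\<lambda>v. 1 * monomial M' v) \<in> forms n e" using step.hyps by (intro forms_monomial) auto
    then show ?thesis by (rule rev_bexI) (simp add: M'(3) normal_part_vanishes[OF vanishes_full])
  next
    case False
    then show ?thesis by (intro bexI[OF _ forms.zero]) (simp add: normal_part_monomial)
  qed
  then obtain r where r: "r \<in> forms n e" "\<And>v. normal_part n (monomial M) v = full n v * r v" by blast
  have "(\<lambda>v. q v + k * r v) \<in> forms n e" by (intro forms_add forms_scale q r)
  then show ?case
    by (rule rev_bexI) (simp add: normal_part_add normal_part_scale q r algebra_simps)
qed

lemma forms_constant: "q \<in> forms n 0 \<Longrightarrow> \<exists>c. \<forall>v. q v = c"
  by (induction q rule: forms.induct) auto

lemma forms_linear:
  assumes "q \<in> forms n 1"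
  shows "\<exists>c. \<forall>v. q v = (\<Sum>i<n. c i * v i)"
  using assms
proof (induction q rule: forms.induct)
  case zero
  show ?case by (rule exI[of _ "\<lambda>_. 0"]) simp
next
  case (step q M k)
  then obtain c where c: "\<And>v. q v = (\<Sum>i<n. c i * v i)" by blast
  obtain j where j: "M = {#j#}" using step.hyps(3) by (metis One_nat_def size_1_singleton_mset)
  then have "j < n" using step.hyps(2) by simp
  have "q v + k * monomial M v = (\<Sum>i<n. (c i + (if i = j then k else 0)) * v i)" for v
  proof -
    have "(\<Sum>i<n. (if i = j then k else 0) * v i) = k * v j"
      using \<open>j < n\<close> by (simp add: if_distrib[of "\<lambda>x. x * _"] cong: if_cong)
    then show ?thesis by (simp add: c j distrib_right sum.distrib)
  qed
  then show ?case by (intro exI[of _ "\<lambda>i. c i + (if i = j then k else 0)"]) simp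
qed

definition cobars :: "nat \<Rightarrow> nat \<Rightarrow> ((nat \<Rightarrow> int) \<Rightarrow> int) set" where
  "cobars n d = cobar n ` forms n d"

lemma cobarsI: "h \<in> forms n d \<Longrightarrow> (\<And>v. f v = cobar n h v) \<Longrightarrow> f \<in> cobars n d"
  unfolding cobars_def by (auto intro!: image_eqI[of _ _ h])

lemma cobars_add: "f \<in> cobars n d \<Longrightarrow> g \<in> cobars n d \<Longrightarrow> (\<lambda>v. f v + g v) \<in> cobars n d"
  unfolding cobars_def by (auto intro!: image_eqI[OF _ forms_add] simp: cobar_add_fun)

lemma cobars_scale: "f \<in> cobars n d \<Longrightarrow> (\<lambda>v. k * f v) \<in> cobars n d"
  unfolding cobars_def by (auto intro!: image_eqI[OF _ forms_scale] simp: cobar_scale_fun)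

lemma cobars_diff: "f \<in> cobars n d \<Longrightarrow> g \<in> cobars n d \<Longrightarrow> (\<lambda>v. f v - g v) \<in> cobars n d"
  using cobars_add[of f n d "\<lambda>v. -1 * g v"] cobars_scale[of g n d "-1"] by simp

lemma cobars_sum: "(\<And>a. a \<in> A \<Longrightarrow> f a \<in> cobars n d) \<Longrightarrow> (\<lambda>v. \<Sum>a\<in>A. f a v) \<in> cobars n d"
proof (induction A rule: infinite_finite_induct)
  case (insert a A)
  then show ?case using cobars_add[of "f a"] by simp
qed (auto intro!: cobarsI[OF forms.zero] simp: cobar_def)

lemma cobars_0: "cobars 0 (Suc d) = {\<lambda>v. 0}"
proof -
  have "forms 0 (Suc d) = {\<lambda>v. 0}"
    using forms_0 forms.zero by (intro equalityI subsetI) simp_all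
  moreover have "cobar 0 (\<lambda>v. 0) = (\<lambda>v. 0)" by (rule ext) (simp add: cobar_def)
  ultimately show ?thesis by (simp add: cobars_def)
qed

lemma forms_full: "set_mset M \<subseteq> {..<n} \<Longrightarrow> (\<lambda>v. full n v * monomial M v) \<in> forms n (n + size M)"
proof -
  assume M: "set_mset M \<subseteq> {..<n}"
  have "(\<lambda>v. full n v * monomial M v) = (\<lambda>v. 1 * monomial (mset_set {..<n} + M) v)"
    by (rule ext) (simp add: monomial_def full_def prod_unfold_prod_mset)
  moreover have "(\<lambda>v. 1 * monomial (mset_set {..<n} + M) v) \<in> forms n (n + size M)"
    using M by (intro forms_monomial) auto
  ultimately show ?thesis by simp
qed

text \<open>Stated with \<open>normal_part\<close> because the representative is then known explicitly by
  \<open>normal_part_form\<close>.\<close>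

lemma normal_representative:
  assumes f: "f \<in> forms (Suc n) d" and z: "\<And>v. cobar (Suc n) f v = 0"
  obtains f' where "f' \<in> forms (Suc n) d" "\<And>v. normal_part (Suc n) f' v = f' v" "(\<lambda>v. f v - f' v) \<in> cobars n d"
    "\<And>v. cobar (Suc n) f' v = 0"
proof -
  have "vanishes (Suc (Suc n)) (cobar (Suc n) f)" by (simp add: vanishes_def z)
  then obtain h where h: "h \<in> forms n d" "vanishes (Suc n) (\<lambda>v. f v + cobar n h v)"
    using normalise[OF f] by blast
  show thesis
  proof (rule that[of "\<lambda>v. f v + cobar n h v"])
    show "(\<lambda>v. f v + cobar n h v) \<in> forms (Suc n) d" by (intro forms_add f forms_cobar h)
    show "normal_part (Suc n) (\<lambda>v. f v + cobar n h v) v = f v + cobar n h v" for v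
      by (rule normal_part_vanishes[OF h(2)])
    show "(\<lambda>v. f v - (f v + cobar n h v)) \<in> cobars n d"
      using forms_scale[OF h(1), of "-1"] cobar_scale[of n "-1" h] by (intro cobarsI[of "\<lambda>v. -1 * h v"]) simp_all
    show "cobar (Suc n) (\<lambda>v. f v + cobar n h v) v = 0" for v
      unfolding cobar_add cobar_cobar[OF h(1)] z by simp
  qed
qed

lemma coefficient_sum_cobar_even:
  assumes "g \<in> forms n (Suc n)"
  shows "even (coefficient_sum (Suc n) (cobar n g))"
proof (rule coefficient_sum_cobar_dvd[of g n 1])
  fix M :: "nat multiset" assume M: "set_mset M \<subseteq> {..<n}" "size M = 1"
  then obtain j where j: "M = {#j#}" by (metis size_1_singleton_mset)
  have "cobar n (\<lambda>v. full n v * monomial M v) = (\<lambda>v. full (Suc n) v * ((- 1) ^ Suc j * 2))"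
    using M j by (intro ext) (simp add: cobar_full_var)
  then show "even (coefficient_sum (Suc n) (cobar n (\<lambda>v. full n v * monomial M v)))"
    by (simp only: coefficient_sum_full) simp
qed (use assms in simp)

text \<open>A normalised form is a multiple of the product of all variables, and twice this product is a
  coboundary.\<close>

theorem codimension_0:
  assumes f: "f \<in> forms (Suc n) (Suc n)" and z: "\<And>v. cobar (Suc n) f v = 0" and n: "0 < n"
  shows "even (coefficient_sum (Suc n) f) \<longleftrightarrow> f \<in> cobars n (Suc n)"
proof
  assume "f \<in> cobars n (Suc n)"
  then show "even (coefficient_sum (Suc n) f)" by (auto simp: cobars_def coefficient_sum_cobar_even)
next
  assume even: "even (coefficient_sum (Suc n) f)"
  obtain f' where f': "f' \<in> forms (Suc n) (Suc n)" "\<And>v. normal_part (Suc n) f' v = f' v"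
      "(\<lambda>v. f v - f' v) \<in> cobars n (Suc n)"
    by (rule normal_representative[OF f z]) auto
  obtain q where q: "q \<in> forms (Suc n) 0" "\<And>v. f' v = full (Suc n) v * q v"
    using normal_part_form[of f' "Suc n" 0] f'(1,2) by auto
  then obtain c where c: "\<And>v. f' v = full (Suc n) v * c" using forms_constant[OF q(1)] by auto
  then have "f' = (\<lambda>v. full (Suc n) v * c)" by (rule ext)
  then have "coefficient_sum (Suc n) f' = c" using coefficient_sum_full[of "Suc n" "\<lambda>v. c"] by simp
  moreover have "even (coefficient_sum (Suc n) (\<lambda>v. f v - f' v))" using f'(3) by (auto simp: cobars_def coefficient_sum_cobar_even)
  moreover have "coefficient_sum (Suc n) f = coefficient_sum (Suc n) (\<lambda>v. f v - f' v) + coefficient_sum (Suc n) f'"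
    using coefficient_sum_add[of "Suc n" "\<lambda>v. f v - f' v" f'] by simp
  ultimately obtain k where k: "c = 2 * k" using even by auto
  have "(\<lambda>v. full n v * v 0) \<in> forms n (Suc n)" using forms_full[of "{#0#}" n] n by simp
  then have "(\<lambda>v. - k * (full n v * v 0)) \<in> forms n (Suc n)" by (rule forms_scale)
  then have "f' \<in> cobars n (Suc n)"
    by (rule cobarsI) (simp only: cobar_scale cobar_full_var[OF n] c k, simp)
  from cobars_add[OF f'(3) this] show "f \<in> cobars n (Suc n)" by simp
qed

lemma size_2_mset:
  assumes "size M = 2"
  shows "\<exists>i j. M = {#i, j#}"
proof -
  obtain i N where M: "M = add_mset i N" using assms by (cases M) auto
  then have "size N = 1" using assms by simp
  then obtain j where "N = {#j#}" by (metis size_1_singleton_mset)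
  then show ?thesis using M by blast
qed

text \<open>Squares give multiples of three. The only mixed product for \<open>n \<le> 2\<close> is \<open>v\<^sub>0 v\<^sub>1\<close>, whose two terms
  have opposite signs; for larger \<open>n\<close> the statement fails because of \<open>v\<^sub>0 v\<^sub>2\<close>.\<close>

lemma coefficient_sum_cobar_dvd_3:
  assumes g: "g \<in> forms n (n + 2)" and n: "n \<le> 2"
  shows "3 dvd coefficient_sum (Suc n) (cobar n g)"
proof (rule coefficient_sum_cobar_dvd[OF g])
  fix M :: "nat multiset" assume M: "set_mset M \<subseteq> {..<n}" "size M = 2"
  then obtain i j where ij: "i \<le> j" "M = {#i, j#}"
    using size_2_mset[of M] by (metis add_mset_commute linorder_le_cases)
  then have lt: "i < n" "j < n" using M(1) by auto
  have m: "monomial M v = v i * v j" for v by (simp add: ij)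
  show "3 dvd coefficient_sum (Suc n) (cobar n (\<lambda>v. full n v * monomial M v))"
  proof (cases "i = j")
    case True
    have "cobar n (\<lambda>v. full n v * monomial M v) = (\<lambda>v. full (Suc n) v * ((- 1) ^ Suc j * 3 * (v j + v (Suc j))))"
      unfolding m True by (rule ext) (simp add: cobar_full_square[OF lt(2)])
    then show ?thesis by (simp only: coefficient_sum_full) simp
  next
    case False
    then have "i = 0" "j = 1" using ij(1) lt n by auto
    have "cobar n (\<lambda>v. full n v * monomial M v) = (\<lambda>v. full (Suc n) v * (2 * (v 0 - v 2)))"
      unfolding m \<open>i = 0\<close> \<open>j = 1\<close>
      using lt \<open>j = 1\<close> by (intro ext, subst cobar_full_mixed) (auto simp: numeral_2_eq_2)
    then show ?thesis by (simp add: coefficient_sum_full)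
  qed
qed

text \<open>The differential of \<open>full n v * v i\<close> is \<open>\<plusminus>2\<close> times the product of all variables, with alternating
  signs.\<close>

lemma alternating_sum_zero:
  assumes z: "\<And>v. cobar n (\<lambda>v. full n v * (\<Sum>i<n. c i * v i)) v = 0"
  shows "(\<Sum>i<n. (- 1) ^ i * c i) = 0"
proof -
  have lin: "cobar n (\<lambda>v. \<Sum>i\<in>A. c i * (full n v * v i)) v = (\<Sum>i\<in>A. c i * cobar n (\<lambda>v. full n v * v i) v)" for A v
    by (induction A rule: infinite_finite_induct) (auto simp: cobar_add cobar_scale, auto simp: cobar_def)
  have "0 = cobar n (\<lambda>v. \<Sum>i<n. c i * (full n v * v i)) (\<lambda>_. 1)"
    using z[of "\<lambda>_. 1"] by (simp add: sum_distrib_left mult.left_commute)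
  also have "\<dots> = (\<Sum>i<n. c i * ((- 1) ^ Suc i * 2 * full (Suc n) (\<lambda>_. 1)))"
    unfolding lin by (intro sum.cong refl) (simp add: cobar_full_var)
  also have "\<dots> = - 2 * (\<Sum>i<n. (- 1) ^ i * c i)"
    unfolding sum_distrib_left by (intro sum.cong refl) (simp add: full_def)
  finally show ?thesis by simp
qed

lemma full_square_cobar:
  assumes "j < n"
  shows "(\<lambda>v. 3 * (full (Suc n) v * (v j + v (Suc j)))) \<in> cobars n (n + 2)"
proof (rule cobarsI[of "\<lambda>v. (- 1) ^ Suc j * (full n v * (v j * v j))"])
  show "(\<lambda>v. (- 1) ^ Suc j * (full n v * (v j * v j))) \<in> forms n (n + 2)"
    using forms_scale[OF forms_full[of "{#j, j#}" n], of "(- 1) ^ Suc j"] assms by (simp add: numeral_2_eq_2)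
  show "3 * (full (Suc n) v * (v j + v (Suc j))) = cobar n (\<lambda>v. (- 1) ^ Suc j * (full n v * (v j * v j))) v" for v
    unfolding cobar_scale cobar_full_square[OF assms] by (simp flip: mult.assoc power_mult_distrib)
qed

lemma full_mixed_cobar:
  assumes "i < j" "j < n"
  shows "(\<lambda>v. 2 * (full (Suc n) v * (v (Suc j) + (- 1) ^ (j - i) * v i))) \<in> cobars n (n + 2)"
proof (rule cobarsI[of "\<lambda>v. (- 1) ^ Suc i * (full n v * (v i * v j))"])
  show "(\<lambda>v. (- 1) ^ Suc i * (full n v * (v i * v j))) \<in> forms n (n + 2)"
    using forms_scale[OF forms_full[of "{#i, j#}" n], of "(- 1) ^ Suc i"] assms by (simp add: numeral_2_eq_2)
  have "(- 1 :: int) ^ j = (- 1) ^ i * (- 1) ^ (j - i)" using assms by (simp flip: power_add)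
  then show "2 * (full (Suc n) v * (v (Suc j) + (- 1) ^ (j - i) * v i))
     = cobar n (\<lambda>v. (- 1) ^ Suc i * (full n v * (v i * v j))) v" for v
    unfolding cobar_scale cobar_full_mixed[OF assms]
    by (cases "even i") (simp_all add: minus_one_power_iff algebra_simps)
qed

text \<open>Let \<open>b i\<close> be the class of the form. Squares give \<open>3 b i = 0\<close> and neighbours give
  \<open>2 b (i + 1) = 2 b i\<close>, so all \<open>b i\<close> are equal. The product \<open>v\<^sub>0 v\<^sub>2\<close>, available from three variables
  on, gives \<open>2 (b 0 - b 1 + b 2) = 0\<close>, that is \<open>2 b 0 = 0\<close>.\<close>

lemma neighbour_sum_cobar:
  assumes n: "3 \<le> n" and i: "i < n"
  shows "(\<lambda>v. full (Suc n) v * (v i + v (Suc i))) \<in> cobars n (n + 2)"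
proof -
  let ?b = "\<lambda>i v. full (Suc n) v * (v i + v (Suc i))"
  have diff: "(\<lambda>v. ?b (Suc i) v - ?b i v) \<in> cobars n (n + 2)" if "Suc i < n" for i
  proof -
    have "(\<lambda>v. (3 * ?b (Suc i) v - 3 * ?b i v) - 2 * (full (Suc n) v * (v (Suc (Suc i)) + (- 1) ^ (Suc i - i) * v i))) \<in> cobars n (n + 2)"
      using that by (intro cobars_diff full_square_cobar full_mixed_cobar) auto
    also have "(\<lambda>v. (3 * ?b (Suc i) v - 3 * ?b i v) - 2 * (full (Suc n) v * (v (Suc (Suc i)) + (- 1) ^ (Suc i - i) * v i)))
      = (\<lambda>v. ?b (Suc i) v - ?b i v)"
      by (rule ext) (simp add: algebra_simps)
    finally show ?thesis .
  qed
  have b0: "?b 0 \<in> cobars n (n + 2)"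
  proof -
    have m: "(\<lambda>v. 2 * (full (Suc n) v * (v (Suc 2) + v 0))) \<in> cobars n (n + 2)"
      using full_mixed_cobar[of 0 2 n] n by simp
    have d: "(\<lambda>v. 2 * (?b 2 v - ?b 1 v)) \<in> cobars n (n + 2)"
      using cobars_scale[OF diff[of 1], of 2] n by (simp add: numeral_2_eq_2)
    have s: "(\<lambda>v. 3 * ?b 0 v) \<in> cobars n (n + 2)" using full_square_cobar[of 0 n] n by simp
    have "(\<lambda>v. 3 * ?b 0 v - (2 * (full (Suc n) v * (v (Suc 2) + v 0)) - 2 * (?b 2 v - ?b 1 v))) \<in> cobars n (n + 2)"
      by (intro cobars_diff m d s)
    also have "(\<lambda>v. 3 * ?b 0 v - (2 * (full (Suc n) v * (v (Suc 2) + v 0)) - 2 * (?b 2 v - ?b 1 v))) = ?b 0"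
      by (rule ext) (simp add: numeral_2_eq_2 algebra_simps)
    finally show ?thesis .
  qed
  show ?thesis using i
  proof (induction i)
    case (Suc i)
    then show ?case using cobars_add[OF diff[of i] Suc.IH] by simp
  qed (use b0 in simp)
qed

lemma three_dvd_double:
  fixes x :: int
  assumes "3 dvd 2 * x"
  obtains k where "x = 3 * k"
proof -
  have "3 dvd x" using assms by presburger
  then show thesis using that by (auto elim: dvdE)
qed

text \<open>Here \<open>n + 2\<close> is the degree and \<open>n + 1\<close> the number of variables. A normalised cocycle is
  \<open>\<Sum> c\<^sub>i P v\<^sub>i\<close> with vanishing alternating sum of coefficients, so it is zero for \<open>n = 0\<close>. For \<open>n \<ge> 3\<close> all neighbour sums
  are coboundaries, so it is equivalent to the alternating sum times \<open>P v\<^sub>0\<close>, which is zero. For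
  \<open>n = 1\<close> and \<open>n = 2\<close> the coefficient sum is \<open>2 c\<^sub>1\<close>, and a cochain with the given boundary is written
  down when \<open>c\<^sub>1\<close> is divisible by three.\<close>

theorem codimension_1:
  fixes n :: nat
  defines "p \<equiv> (if n \<in> {1, 2} then 3 else 1 :: int)"
  assumes f: "f \<in> forms (Suc n) (n + 2)" and z: "\<And>v. cobar (Suc n) f v = 0"
  shows "p dvd coefficient_sum (Suc n) f \<longleftrightarrow> f \<in> cobars n (n + 2)"
proof
  assume "f \<in> cobars n (n + 2)"
  then show "p dvd coefficient_sum (Suc n) f"
    using coefficient_sum_cobar_dvd_3[of _ n] by (auto simp: cobars_def p_def)
next
  assume dvd: "p dvd coefficient_sum (Suc n) f"
  obtain f' where f': "f' \<in> forms (Suc n) (n + 2)" "\<And>v. normal_part (Suc n) f' v = f' v"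
      "(\<lambda>v. f v - f' v) \<in> cobars n (n + 2)" "\<And>v. cobar (Suc n) f' v = 0"
    by (rule normal_representative[OF f z]) auto
  obtain q where q: "q \<in> forms (Suc n) 1" "\<And>v. f' v = full (Suc n) v * q v"
    using normal_part_form[of f' "Suc n" 1] f'(1,2) by auto
  then obtain c where "\<And>v. f' v = full (Suc n) v * (\<Sum>i<Suc n. c i * v i)" using forms_linear[OF q(1)] by auto
  then have c: "f' = (\<lambda>v. full (Suc n) v * (\<Sum>i<Suc n. c i * v i))" by (rule ext)
  have alt: "(\<Sum>i<Suc n. (- 1) ^ i * c i) = 0"
    by (rule alternating_sum_zero) (use f'(4) c in simp)
  have "p dvd coefficient_sum (Suc n) (\<lambda>v. f v - f' v)"
    using f'(3) coefficient_sum_cobar_dvd_3[of _ n] by (auto simp: cobars_def p_def)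
  moreover have "coefficient_sum (Suc n) f = coefficient_sum (Suc n) (\<lambda>v. f v - f' v) + coefficient_sum (Suc n) f'"
    using coefficient_sum_add[of "Suc n" "\<lambda>v. f v - f' v" f'] by simp
  moreover have "coefficient_sum (Suc n) f' = (\<Sum>i<Suc n. c i)"
    unfolding c coefficient_sum_full by simp
  ultimately have dvd': "p dvd (\<Sum>i<Suc n. c i)" using dvd by (simp add: dvd_add_right_iff)
  have "f' \<in> cobars n (n + 2)"
  proof -
    consider "n = 0" | "n = 1" | "n = 2" | "3 \<le> n" by linarith
    then show ?thesis
    proof cases
      case 1
      then have "f' = (\<lambda>v. 0)" using alt by (simp add: c)
      then show ?thesis using cobarsI[OF forms.zero] by (simp add: cobar_def)
    next
      case 2
      then have "c 0 = c 1" "3 dvd 2 * c 1" using alt dvd' by (auto simp: p_def)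
      moreover from this(2) obtain k where "c 1 = 3 * k" by (rule three_dvd_double)
      ultimately have "c 0 = 3 * k" "c 1 = 3 * k" by auto
      then have "f' = (\<lambda>v. k * (3 * (full (Suc n) v * (v 0 + v (Suc 0)))))"
        using 2 by (simp add: c algebra_simps)
      then show ?thesis using cobars_scale[OF full_square_cobar[of 0 n]] 2 by simp
    next
      case 3
      have c2: "c 2 = c 1 - c 0" using 3 alt by (simp add: numeral_2_eq_2)
      have "3 dvd c 0 + c 1 + c 2" using 3 dvd' by (simp add: p_def numeral_2_eq_2)
      then have "3 dvd 2 * c 1" by (simp add: c2)
      with c2 have "c 2 = c 1 - c 0" "3 dvd 2 * c 1" by auto
      moreover from this(2) obtain k where "c 1 = 3 * k" by (rule three_dvd_double)
      ultimately have k: "c 1 = 3 * k" "c 2 = 3 * k - c 0" by auto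
      \<comment> \<open>With c 1 = 3 k and c 2 = 3 k - c 0 the form is P (c 0 (v 0 - v 2) + 3 k (v 1 + v 2)),
        and v 0 - v 2 is 3 (v 0 + v 1) - 3 (v 1 + v 2) - 2 (v 0 - v 2).\<close>
      have "(\<lambda>v. (c 0 * (3 * (full (Suc n) v * (v 0 + v (Suc 0))))
         + (k - c 0) * (3 * (full (Suc n) v * (v 1 + v (Suc 1)))))
         + c 0 * (2 * (full (Suc n) v * (v (Suc 1) + (- 1) ^ (1 - 0) * v 0)))) \<in> cobars n (n + 2)"
        using 3 by (intro cobars_add cobars_scale full_square_cobar full_mixed_cobar) auto
      also have "(\<lambda>v. (c 0 * (3 * (full (Suc n) v * (v 0 + v (Suc 0))))
         + (k - c 0) * (3 * (full (Suc n) v * (v 1 + v (Suc 1)))))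
         + c 0 * (2 * (full (Suc n) v * (v (Suc 1) + (- 1) ^ (1 - 0) * v 0)))) = f'"
      proof -
        have s: "(\<Sum>i<Suc n. c i * v i) = c 0 * v 0 + 3 * k * v 1 + (3 * k - c 0) * v (Suc 1)" for v
          using k 3 by (simp add: numeral_2_eq_2)
        show ?thesis unfolding c s by (intro ext) (simp add: algebra_simps)
      qed
      finally show ?thesis .
    next
      case 4
      have e: "(\<lambda>v. full (Suc n) v * (v i - (- 1) ^ i * v 0)) \<in> cobars n (n + 2)" if "i \<le> n" for i
        using that
      proof (induction i)
        case 0
        then show ?case using cobarsI[OF forms.zero] by (simp add: cobar_def)
      next
        case (Suc i)
        then show ?case
          using cobars_diff[OF neighbour_sum_cobar[OF 4, of i] Suc.IH] by (simp add: algebra_simps)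
      qed
      have "(\<lambda>v. \<Sum>i<Suc n. c i * (full (Suc n) v * (v i - (- 1) ^ i * v 0))) \<in> cobars n (n + 2)"
        using e by (intro cobars_sum cobars_scale) auto
      also have "(\<lambda>v. \<Sum>i<Suc n. c i * (full (Suc n) v * (v i - (- 1) ^ i * v 0))) = f'"
      proof
        fix v
        have "(\<Sum>i<Suc n. c i * (full (Suc n) v * (v i - (- 1) ^ i * v 0)))
          = full (Suc n) v * (\<Sum>i<Suc n. c i * v i) - full (Suc n) v * v 0 * (\<Sum>i<Suc n. (- 1) ^ i * c i)"
          unfolding sum_distrib_left sum_subtractf[symmetric] by (intro sum.cong refl) (simp add: algebra_simps)
        then show "(\<Sum>i<Suc n. c i * (full (Suc n) v * (v i - (- 1) ^ i * v 0))) = f' v"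
          unfolding alt c by simp
      qed
      finally show ?thesis .
    qed
  qed
  from cobars_add[OF f'(3) this] show "f \<in> cobars n (n + 2)" by simp
qed

text \<open>Twice the neighbour sum is used since its coefficient sum is one modulo three.\<close>

lemma codimension_1_cocycle:
  assumes "0 < n"
  shows "(\<lambda>v. full (Suc n) v * (2 * (v 0 + v 1))) \<in> forms (Suc n) (n + 2)"
    "cobar (Suc n) (\<lambda>v. full (Suc n) v * (2 * (v 0 + v 1))) v = 0"
    "coefficient_sum (Suc n) (\<lambda>v. full (Suc n) v * (2 * (v 0 + v 1))) = 4"
proof -
  have e: "(\<lambda>v. full (Suc n) v * (2 * (v 0 + v 1))) = (\<lambda>v. 2 * (full (Suc n) v * v 0 + full (Suc n) v * v 1))"
    by (auto simp: algebra_simps)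
  show "(\<lambda>v. full (Suc n) v * (2 * (v 0 + v 1))) \<in> forms (Suc n) (n + 2)"
    unfolding e using forms_full[of "{#0#}" "Suc n"] forms_full[of "{#1#}" "Suc n"] assms
    by (intro forms_scale forms_add) auto
  show "cobar (Suc n) (\<lambda>v. full (Suc n) v * (2 * (v 0 + v 1))) v = 0"
    unfolding e cobar_scale cobar_add using assms by (simp add: cobar_full_var del: One_nat_def)
  show "coefficient_sum (Suc n) (\<lambda>v. full (Suc n) v * (2 * (v 0 + v 1))) = 4"
    by (simp add: coefficient_sum_full)
qed

section \<open>Evaluation of symmetric powers\<close>

definition sym_proj :: "nat \<Rightarrow> 'a monoid \<Rightarrow> ('a list \<Rightarrow>\<^sub>0 int) \<Rightarrow> ('a list \<Rightarrow>\<^sub>0 int) set set" where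
  "sym_proj d A c = coinvariant_rels d A #>\<^bsub>tensor_power d A\<^esub>
     (multilinear_rels d A #>\<^bsub>free_Abelian_group (tuples d A)\<^esub> c)"

definition sym_class :: "nat \<Rightarrow> 'a monoid \<Rightarrow> 'a list \<Rightarrow> ('a list \<Rightarrow>\<^sub>0 int) set set" where
  "sym_class d A xs = sym_proj d A (frag_of xs)"

definition product_eval :: "('a \<Rightarrow> int) \<Rightarrow> ('a list \<Rightarrow>\<^sub>0 int) \<Rightarrow> int" where
  "product_eval \<chi> = free_lift integer_group (\<lambda>xs. prod_list (map \<chi> xs))"

text \<open>A homomorphism \<open>\<chi>\<close> to the integers evaluates symmetric tensors by multiplying its values. The two
  nested applications of \<open>quot_lift\<close> go through the tensor power and then through its coinvariants.\<close>

definition sym_eval :: "('a \<Rightarrow> int) \<Rightarrow> ('a list \<Rightarrow>\<^sub>0 int) set set \<Rightarrow> int" where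
  "sym_eval \<chi> = quot_lift (quot_lift (product_eval \<chi>))"

lemma quotient_hom:
  assumes "N \<lhd> G" shows "(\<lambda>x. N #>\<^bsub>G\<^esub> x) \<in> hom G (G Mod N)"
  using assms by (rule normal.r_coset_hom_Mod)

lemma hom_generate_trivial:
  assumes "group G" "group H" "h \<in> hom G H" "S \<subseteq> carrier G" "\<And>s. s \<in> S \<Longrightarrow> h s = \<one>\<^bsub>H\<^esub>" "x \<in> generate G S"
  shows "h x = \<one>\<^bsub>H\<^esub>"
proof -
  interpret h: group_hom G H h using assms by (simp add: group_hom_def group_hom_axioms_def)
  from assms(6) show ?thesis
  proof induction
    case (inv s) then show ?case using assms(4,5) by auto
  next
    case (eng a b)
    then have "a \<in> carrier G" "b \<in> carrier G" using h.G.generate_in_carrier[OF assms(4)] by auto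
    then show ?case using eng by simp
  qed (use assms(5) in auto)
qed

context
  fixes A :: "'a monoid" and d :: nat
  assumes A: "group A"
begin

interpretation A: group A by (rule A)

lemma tensor_hom: "(\<lambda>c. multilinear_rels d A #>\<^bsub>free_Abelian_group (tuples d A)\<^esub> c)
   \<in> hom (free_Abelian_group (tuples d A)) (tensor_power d A)"
  unfolding tensor_power_def by (rule quotient_hom[OF normal_multilinear_rels[OF A]])

lemma sym_proj_hom: "sym_proj d A \<in> hom (free_Abelian_group (tuples d A)) (sym_power d A)"
  using Group.hom_compose[OF tensor_hom quotient_hom[OF normal_coinvariant_rels[OF A]]]
  by (simp add: sym_power_def sym_proj_def[abs_def] comp_def)

lemma sym_proj_surj:
  assumes "t \<in> carrier (sym_power d A)"
  obtains c where "supp c \<subseteq> tuples d A" "t = sym_proj d A c"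
proof -
  obtain s where s: "s \<in> carrier (tensor_power d A)" "t = coinvariant_rels d A #>\<^bsub>tensor_power d A\<^esub> s"
    using assms by (auto simp: sym_power_def carrier_FactGroup)
  obtain c where "c \<in> carrier (free_Abelian_group (tuples d A))" "s = multilinear_rels d A #>\<^bsub>free_Abelian_group (tuples d A)\<^esub> c"
    using s(1) by (auto simp: tensor_power_def carrier_FactGroup)
  then show ?thesis using s(2) by (intro that[of c]) (auto simp: sym_proj_def)
qed

lemma sym_class_closed: "xs \<in> tuples d A \<Longrightarrow> sym_class d A xs \<in> carrier (sym_power d A)"
  using hom_in_carrier[OF sym_proj_hom, of "frag_of xs"] by (simp add: sym_class_def)

text \<open>The classes of tuples generate the symmetric power.\<close>

lemma sym_hom_eqI:
  assumes H: "group H" "h \<in> hom (sym_power d A) H" "k \<in> hom (sym_power d A) H"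
    and eq: "\<And>xs. xs \<in> tuples d A \<Longrightarrow> h (sym_class d A xs) = k (sym_class d A xs)"
    and t: "t \<in> carrier (sym_power d A)"
  shows "h t = k t"
proof -
  obtain c where c: "supp c \<subseteq> tuples d A" "t = sym_proj d A c" by (rule sym_proj_surj[OF t])
  have "(\<lambda>c. h (sym_proj d A c)) c = (\<lambda>c. k (sym_proj d A c)) c"
    by (rule hom_free_eqI[OF H(1) _ _ _ c(1)])
      (use Group.hom_compose[OF sym_proj_hom H(2)] Group.hom_compose[OF sym_proj_hom H(3)] eq
        in \<open>simp_all add: comp_def sym_class_def\<close>)
  then show ?thesis by (simp add: c(2))
qed

lemma sym_class_mult:
  assumes xs: "xs \<in> tuples d A" and i: "i < d" and xy: "x \<in> carrier A" "y \<in> carrier A"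
  shows "sym_class d A (xs[i := x \<otimes>\<^bsub>A\<^esub> y])
    = sym_class d A (xs[i := x]) \<otimes>\<^bsub>sym_power d A\<^esub> sym_class d A (xs[i := y])"
proof -
  let ?F = "free_Abelian_group (tuples d A)" and ?M = "multilinear_rels d A"
  interpret M: normal ?M ?F by (rule normal_multilinear_rels[OF A])
  have t: "xs[i := x \<otimes>\<^bsub>A\<^esub> y] \<in> tuples d A" "xs[i := x] \<in> tuples d A" "xs[i := y] \<in> tuples d A"
    using xs xy by (simp_all add: tuples_update)
  define a b c where "a = frag_of (xs[i := x \<otimes>\<^bsub>A\<^esub> y])" "b = frag_of (xs[i := x])" "c = frag_of (xs[i := y])"
  have abc: "a \<in> carrier ?F" "b \<in> carrier ?F" "c \<in> carrier ?F" "b + c \<in> carrier ?F"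
    using t keys_add[of b c] by (auto simp: a_b_c_def)
  have "a - b - c \<in> ?M"
    unfolding multilinear_rels_def a_b_c_def
    by (rule generate.incl) (use xs i xy in \<open>auto simp: multilinear_gens_def\<close>)
  moreover have "a = (a - b - c) \<otimes>\<^bsub>?F\<^esub> (b + c)" by simp
  ultimately have "a \<in> ?M #>\<^bsub>?F\<^esub> (b + c)" unfolding r_coset_def by blast
  then have "?M #>\<^bsub>?F\<^esub> a = ?M #>\<^bsub>?F\<^esub> (b + c)"
    using M.repr_independence[OF _ abc(4) M.subgroup_axioms] by simp
  then have "sym_proj d A a = sym_proj d A (b + c)" by (simp add: sym_proj_def)
  then show ?thesis
    using hom_mult[OF sym_proj_hom, of b c] abc by (simp add: sym_class_def a_b_c_def)
qed

lemma tensor_map_permute: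
  assumes s: "\<sigma> permutes {..<d}" and c: "c \<in> carrier (free_Abelian_group (tuples d A))"
  shows "tensor_map d A (permute_list \<sigma>) (multilinear_rels d A #>\<^bsub>free_Abelian_group (tuples d A)\<^esub> c)
    = multilinear_rels d A #>\<^bsub>free_Abelian_group (tuples d A)\<^esub> frag_extend (\<lambda>xs. frag_of (permute_list \<sigma> xs)) c"
  unfolding tensor_map_def
  by (rule quot_map_coset) (use c permute_multilinear[OF A s] frag_map_hom in
    \<open>auto simp: normal_imp_subgroup normal_multilinear_rels[OF A]\<close>)

lemma sym_class_permute:
  assumes xs: "xs \<in> tuples d A" and m: "mset ys = mset xs"
  shows "sym_class d A ys = sym_class d A xs"
proof -
  have len: "length xs = d" using xs by (simp add: tuples_def)
  obtain \<sigma> where s: "\<sigma> permutes {..<d}" "permute_list \<sigma> xs = ys"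
    using mset_eq_permutation[OF m] len by auto
  let ?T = "tensor_power d A" and ?N = "coinvariant_rels d A"
  interpret N: normal ?N ?T by (rule normal_coinvariant_rels[OF A])
  define t where "t = multilinear_rels d A #>\<^bsub>free_Abelian_group (tuples d A)\<^esub> frag_of xs"
  have t: "t \<in> carrier ?T" unfolding t_def by (rule hom_in_carrier[OF tensor_hom]) (simp add: xs)
  let ?u = "tensor_map d A (permute_list \<sigma>) t"
  have u: "?u = multilinear_rels d A #>\<^bsub>free_Abelian_group (tuples d A)\<^esub> frag_of ys"
    unfolding t_def by (subst tensor_map_permute[OF s(1)]) (use xs s(2) in auto)
  have uc: "?u \<in> carrier ?T"
    by (rule hom_in_carrier[OF tensor_map_hom[OF A A permute_multilinear[OF A s(1)]] t])
  have "?u \<otimes>\<^bsub>?T\<^esub> inv\<^bsub>?T\<^esub> t \<in> ?N"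
    unfolding coinvariant_rels_def by (rule generate.incl) (use s(1) t in auto)
  moreover have "?u = (?u \<otimes>\<^bsub>?T\<^esub> inv\<^bsub>?T\<^esub> t) \<otimes>\<^bsub>?T\<^esub> t" using t uc by (simp add: N.m_assoc)
  ultimately have "?u \<in> ?N #>\<^bsub>?T\<^esub> t" unfolding r_coset_def by blast
  then have "?N #>\<^bsub>?T\<^esub> ?u = ?N #>\<^bsub>?T\<^esub> t"
    using N.repr_independence[OF _ t N.subgroup_axioms] by simp
  then show ?thesis unfolding u by (simp only: sym_class_def sym_proj_def t_def)
qed

context
  fixes \<chi> :: "'a \<Rightarrow> int"
  assumes \<chi>: "\<chi> \<in> hom A integer_group"
begin

lemma prod_update_add:
  assumes "xs \<in> tuples d A" "i < d" "x \<in> carrier A" "y \<in> carrier A"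
  shows "prod_list (map \<chi> (xs[i := x \<otimes>\<^bsub>A\<^esub> y])) = prod_list (map \<chi> (xs[i := x])) + prod_list (map \<chi> (xs[i := y]))"
proof -
  have i: "i < length xs" using assms by (simp add: tuples_def)
  have "\<chi> (x \<otimes>\<^bsub>A\<^esub> y) = \<chi> x + \<chi> y" using hom_mult[OF \<chi> assms(3,4)] by simp
  then show ?thesis using i by (simp add: upd_conv_take_nth_drop algebra_simps)
qed

lemma eval_free_hom:
  "product_eval \<chi> \<in> hom (free_Abelian_group (tuples d A)) integer_group"
  unfolding product_eval_def by (rule comm_group.free_lift_hom[OF abelian_integer_group]) simp

lemma eval_free_of: "product_eval \<chi> (frag_of xs) = prod_list (map \<chi> xs)"
  unfolding product_eval_def by (rule comm_group.free_lift_of[OF abelian_integer_group]) simp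

lemma eval_free_rels:
  assumes "c \<in> multilinear_rels d A"
  shows "product_eval \<chi> c = \<one>\<^bsub>integer_group\<^esub>"
proof (rule hom_generate_trivial[OF _ _ eval_free_hom multilinear_gens_carrier[OF A] _ assms[unfolded multilinear_rels_def]])
  let ?e = "product_eval \<chi>"
  fix g assume "g \<in> multilinear_gens d A"
  then obtain xs i x y where g: "g = frag_of (xs[i := x \<otimes>\<^bsub>A\<^esub> y]) - frag_of (xs[i := x]) - frag_of (xs[i := y])"
    "xs \<in> tuples d A" "i < d" "x \<in> carrier A" "y \<in> carrier A" by (auto simp: multilinear_gens_def)
  have t: "xs[i := x \<otimes>\<^bsub>A\<^esub> y] \<in> tuples d A" "xs[i := x] \<in> tuples d A" "xs[i := y] \<in> tuples d A"
    using g by (simp_all add: tuples_update)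
  have diff: "?e (a - b) = ?e a - ?e b"
    if "supp a \<subseteq> tuples d A" "supp b \<subseteq> tuples d A" for a b
    using hom_free_diff[OF group_integer_group eval_free_hom that] by simp
  show "?e g = \<one>\<^bsub>integer_group\<^esub>"
    unfolding g(1) using t prod_update_add[OF g(2-5)]
    by (simp add: diff keys_frag_diff eval_free_of)
qed auto

lemma eval_tensor_hom:
  "quot_lift (product_eval \<chi>) \<in> hom (tensor_power d A) integer_group"
  unfolding tensor_power_def
  by (rule quot_lift_hom[OF normal_multilinear_rels[OF A] group_integer_group eval_free_hom eval_free_rels])

lemma eval_tensor_coset:
  assumes "c \<in> carrier (free_Abelian_group (tuples d A))"
  shows "quot_lift (product_eval \<chi>)
      (multilinear_rels d A #>\<^bsub>free_Abelian_group (tuples d A)\<^esub> c) = product_eval \<chi> c"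
  by (rule quot_lift_coset[OF normal_multilinear_rels[OF A] group_integer_group eval_free_hom eval_free_rels assms])

lemma eval_tensor_rels:
  assumes "t \<in> coinvariant_rels d A"
  shows "quot_lift (product_eval \<chi>) t = \<one>\<^bsub>integer_group\<^esub>"
proof (rule hom_generate_trivial[OF group_tensor_power[OF A] group_integer_group eval_tensor_hom _ _ assms[unfolded coinvariant_rels_def]])
  let ?F = "free_Abelian_group (tuples d A)" and ?T = "tensor_power d A"
  let ?e = "product_eval \<chi>"
  interpret e: group_hom ?T integer_group "quot_lift ?e"
    using eval_tensor_hom group_tensor_power[OF A] by (simp add: group_hom_def group_hom_axioms_def)
  show "{tensor_map d A (permute_list \<sigma>) t \<otimes>\<^bsub>?T\<^esub> inv\<^bsub>?T\<^esub> t |\<sigma> t. \<sigma> permutes {..<d} \<and> t \<in> carrier ?T} \<subseteq> carrier ?T"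
    by (auto intro: coinvariant_gens_carrier[OF A])
  fix s assume "s \<in> {tensor_map d A (permute_list \<sigma>) t \<otimes>\<^bsub>?T\<^esub> inv\<^bsub>?T\<^esub> t |\<sigma> t. \<sigma> permutes {..<d} \<and> t \<in> carrier ?T}"
  then obtain \<sigma> t where s: "s = tensor_map d A (permute_list \<sigma>) t \<otimes>\<^bsub>?T\<^esub> inv\<^bsub>?T\<^esub> t" "\<sigma> permutes {..<d}" "t \<in> carrier ?T"
    by blast
  obtain c where c: "c \<in> carrier ?F" "t = multilinear_rels d A #>\<^bsub>?F\<^esub> c"
    using s(3) by (auto simp: tensor_power_def carrier_FactGroup)
  let ?p = "frag_extend (\<lambda>xs. frag_of (permute_list \<sigma> xs))"
  have p: "?p \<in> hom ?F ?F" by (rule frag_map_hom[OF permute_multilinear(1)[OF A s(2)]])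
  have "(\<lambda>c. ?e (?p c)) c = ?e c"
  proof (rule hom_free_eqI[OF group_integer_group _ eval_free_hom])
    show "(\<lambda>c. ?e (?p c)) \<in> hom ?F integer_group"
      using Group.hom_compose[OF p eval_free_hom] by (simp add: comp_def)
    fix xs assume "xs \<in> tuples d A"
    then have "mset (permute_list \<sigma> xs) = mset xs" using s(2) by (simp add: tuples_def)
    then have "prod_mset (image_mset \<chi> (mset (permute_list \<sigma> xs))) = prod_mset (image_mset \<chi> (mset xs))" by simp
    then show "?e (?p (frag_of xs)) = ?e (frag_of xs)"
      by (simp only: frag_extend_of eval_free_of) (simp add: prod_mset_prod_list flip: mset_map)
  qed (use c in simp)
  moreover have "?p c \<in> carrier ?F" by (rule hom_in_carrier[OF p c(1)])
  ultimately have "quot_lift ?e (tensor_map d A (permute_list \<sigma>) t) = quot_lift ?e t"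
    using c(1) unfolding c(2) tensor_map_permute[OF s(2) c(1)] by (simp only: eval_tensor_coset)
  moreover have "tensor_map d A (permute_list \<sigma>) t \<in> carrier ?T"
    by (rule hom_in_carrier[OF tensor_map_hom[OF A A permute_multilinear[OF A s(2)]] s(3)])
  ultimately show "quot_lift ?e s = \<one>\<^bsub>integer_group\<^esub>" using s(3) by (simp add: s(1))
qed

lemma sym_eval_hom: "sym_eval \<chi> \<in> hom (sym_power d A) integer_group"
  unfolding sym_power_def sym_eval_def
  by (rule quot_lift_hom[OF normal_coinvariant_rels[OF A] group_integer_group eval_tensor_hom eval_tensor_rels])

lemma sym_eval_class:
  assumes "xs \<in> tuples d A"
  shows "sym_eval \<chi> (sym_class d A xs) = prod_list (map \<chi> xs)"
proof -
  have f: "frag_of xs \<in> carrier (free_Abelian_group (tuples d A))" using assms by simp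
  show ?thesis
    unfolding sym_eval_def sym_class_def sym_proj_def
    by (subst quot_lift_coset[OF normal_coinvariant_rels[OF A] group_integer_group eval_tensor_hom eval_tensor_rels])
      (simp_all only: hom_in_carrier[OF tensor_hom f] eval_tensor_coset[OF f] eval_free_of)
qed

end

end

lemma sym_map_class:
  assumes A: "group A" and B: "group B" and f: "f \<in> hom A B" and xs: "xs \<in> tuples d A"
  shows "sym_map d B f (sym_class d A xs) = sym_class d B (map f xs)"
proof -
  let ?t = "multilinear_rels d A #>\<^bsub>free_Abelian_group (tuples d A)\<^esub> frag_of xs"
  have t: "?t \<in> carrier (tensor_power d A)" by (rule hom_in_carrier[OF tensor_hom[OF A]]) (simp add: xs)
  have "sym_map d B f (sym_class d A xs) = coinvariant_rels d B #>\<^bsub>tensor_power d B\<^esub> tensor_map d B (map f) ?t"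
    unfolding sym_map_def sym_class_def sym_proj_def
    by (rule quot_map_coset[OF group_tensor_power[OF A] group_tensor_power[OF B] normal_imp_subgroup[OF normal_coinvariant_rels[OF A]]
          normal_imp_subgroup[OF normal_coinvariant_rels[OF B]] tensor_map_hom[OF A B map_multilinear[OF A B f]]
          coinvariant_rels_image[OF A B f] t])
  also have "tensor_map d B (map f) ?t = multilinear_rels d B #>\<^bsub>free_Abelian_group (tuples d B)\<^esub>
      frag_extend (\<lambda>xs. frag_of (map f xs)) (frag_of xs)"
    unfolding tensor_map_def
    by (rule quot_map_coset[OF group_free_Abelian_group group_free_Abelian_group normal_imp_subgroup[OF normal_multilinear_rels[OF A]]
          normal_imp_subgroup[OF normal_multilinear_rels[OF B]] frag_map_hom[OF map_multilinear(1)[OF A B f]]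
          map_multilinear(2)[OF A B f]]) (simp add: xs)
  finally show ?thesis by (simp add: sym_class_def sym_proj_def)
qed

section \<open>Abelianization and exponent sums\<close>

definition exponent_value :: "(nat \<Rightarrow> int) \<Rightarrow> word \<Rightarrow> int" where
  "exponent_value v w = (\<Sum>x\<leftarrow>w. if snd x then v (fst x) else - v (fst x))"

definition ab_class :: "nat \<Rightarrow> word \<Rightarrow> word set" where
  "ab_class n w = derived (free_group n) (carrier (free_group n)) #>\<^bsub>free_group n\<^esub> w"

definition ab_value :: "(nat \<Rightarrow> int) \<Rightarrow> word set \<Rightarrow> int" where
  "ab_value v = quot_lift (exponent_value v)"

abbreviation gr_gen :: "nat \<Rightarrow> word" where
  "gr_gen i \<equiv> [(i, True)]"

lemma exponent_value_gen [simp]: "exponent_value v [(i, b)] = (if b then v i else - v i)"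
  by (simp add: exponent_value_def)

lemma exponent_value_cons_reduce:
  "exponent_value v (cons_reduce x w) = exponent_value v [x] + exponent_value v w"
  by (cases w) (auto simp: exponent_value_def inv_letter_def)

lemma exponent_value_mult:
  "exponent_value v (foldr cons_reduce u w) = exponent_value v u + exponent_value v w"
proof (induction u)
  case (Cons x u)
  then show ?case using exponent_value_cons_reduce[of v x] by (simp add: exponent_value_def)
qed (simp add: exponent_value_def)

lemma exponent_value_hom: "exponent_value v \<in> hom (free_group n) integer_group"
  by (rule homI) (simp_all add: free_group_simps exponent_value_mult)

lemma ab_obj: "obj ab_functor n = free_group n Mod derived (free_group n) (carrier (free_group n))"
  by (simp add: ab_functor_def abelianization_def)

lemma derived_normal: "derived (free_group n) (carrier (free_group n)) \<lhd> free_group n"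
  by (rule group.derived_self_is_normal[OF group_free_group])

lemma derived_trivial:
  assumes G: "group G" and H: "comm_group H" and h: "h \<in> hom G H" and x: "x \<in> derived G (carrier G)"
  shows "h x = \<one>\<^bsub>H\<^esub>"
proof -
  have gH: "group H" using H by (simp add: comm_group_def)
  have "h x \<in> derived H (carrier H)" using derived_image[OF G gH h] x by blast
  then show ?thesis using comm_group.derived_eq_singleton[OF H, of "carrier H"] by simp
qed

lemma ab_class_hom: "ab_class n \<in> hom (free_group n) (obj ab_functor n)"
  unfolding ab_obj ab_class_def[abs_def] by (rule quotient_hom[OF derived_normal])

lemma ab_class_surj: "C \<in> carrier (obj ab_functor n) \<Longrightarrow> \<exists>w \<in> carrier (free_group n). C = ab_class n w"
  by (auto simp: ab_obj ab_class_def carrier_FactGroup)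

lemma ab_value_hom: "ab_value v \<in> hom (obj ab_functor n) integer_group"
  unfolding ab_value_def ab_obj
  by (rule quot_lift_hom[OF derived_normal group_integer_group exponent_value_hom
        derived_trivial[OF group_free_group abelian_integer_group exponent_value_hom]])

lemma ab_value_class: "w \<in> carrier (free_group n) \<Longrightarrow> ab_value v (ab_class n w) = exponent_value v w"
  unfolding ab_value_def ab_class_def
  by (rule quot_lift_coset[OF derived_normal group_integer_group exponent_value_hom
        derived_trivial[OF group_free_group abelian_integer_group exponent_value_hom]])

lemma ab_mor_class:
  assumes f: "f \<in> gr_hom m n" and w: "w \<in> carrier (free_group m)"
  shows "mor ab_functor m n f (ab_class m w) = ab_class n (f w)"
  using quot_map_coset[OF group_free_group group_free_group normal_imp_subgroup[OF derived_normal]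
      normal_imp_subgroup[OF derived_normal] gr_homD(1)[OF f] derived_image[OF group_free_group group_free_group gr_homD(1)[OF f]] w]
  by (simp add: ab_functor_def ab_class_def)

lemma gr_gen_carrier [simp]: "gr_gen i \<in> carrier (free_group n) \<longleftrightarrow> i < n"
  by (simp add: free_group_simps reduced_Cons)

lemma free_group_hom_eqI:
  assumes H: "group H" and h: "h \<in> hom (free_group n) H" "k \<in> hom (free_group n) H"
    and eq: "\<And>i. i < n \<Longrightarrow> h (gr_gen i) = k (gr_gen i)" and w: "w \<in> carrier (free_group n)"
  shows "h w = k w"
proof -
  let ?r = "\<lambda>h. restrict h (carrier (free_group n))"
  have r: "?r f \<in> hom (free_group n) H \<inter> extensional (carrier (free_group n))" if "f \<in> hom (free_group n) H" for f
    using that group.is_monoid[OF group_free_group, of n] by (auto simp: hom_def monoid.m_closed)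
  have "\<exists>!g. g \<in> hom (free_group n) H \<inter> extensional (carrier (free_group n)) \<and>
      (\<forall>i<n. g (gr_gen i) = h (gr_gen i))"
    by (rule free_group_universal[OF H]) (rule hom_in_carrier[OF h(1)], simp)
  moreover have "\<forall>i<n. ?r h (gr_gen i) = h (gr_gen i)" "\<forall>i<n. ?r k (gr_gen i) = h (gr_gen i)"
    using eq by simp_all
  ultimately have "?r h = ?r k" using r[OF h(1)] r[OF h(2)] by blast
  then show ?thesis using w by (metis restrict_apply')
qed

lemma exponent_value_pullback:
  assumes f: "f \<in> gr_hom m n" and w: "w \<in> carrier (free_group m)"
  shows "exponent_value v (f w) = exponent_value (\<lambda>i. exponent_value v (f (gr_gen i))) w"
proof -
  have "(\<lambda>w. exponent_value v (f w)) w = exponent_value (\<lambda>i. exponent_value v (f (gr_gen i))) w"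
    by (rule free_group_hom_eqI[OF group_integer_group _ exponent_value_hom _ w])
      (use Group.hom_compose[OF gr_homD(1)[OF f] exponent_value_hom] in \<open>simp_all add: comp_def\<close>)
  then show ?thesis by simp
qed

section \<open>Symmetric powers as forms\<close>

abbreviation sym_ab :: "nat \<Rightarrow> (word set list \<Rightarrow>\<^sub>0 int) set set gr_functor" where
  "sym_ab d \<equiv> sym_functor d ab_functor"

text \<open>The vector \<open>v\<close> is regarded as the homomorphism that sends the \<open>i\<close>-th generator to \<open>v i\<close>.\<close>

definition form_of :: "(word set list \<Rightarrow>\<^sub>0 int) set set \<Rightarrow> (nat \<Rightarrow> int) \<Rightarrow> int" where
  "form_of x v = sym_eval (ab_value v) x"

lemma sym_ab_obj: "obj (sym_ab d) n = sym_power d (obj ab_functor n)"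
  by (simp add: sym_functor_def)

lemma is_gr_functor_sym_ab: "is_gr_functor (sym_ab d)"
  by (rule is_gr_functor_sym[OF is_gr_functor_ab])

lemma group_ab: "group (obj ab_functor n)"
  by (rule gr_functorD(2)[OF is_gr_functor_ab])

lemma form_of_hom: "(\<lambda>x. form_of x v) \<in> hom (obj (sym_ab d) n) integer_group"
  unfolding form_of_def sym_ab_obj by (rule sym_eval_hom[OF group_ab ab_value_hom])

lemma form_of_mult:
  "x \<in> carrier (obj (sym_ab d) n) \<Longrightarrow> y \<in> carrier (obj (sym_ab d) n) \<Longrightarrow>
   form_of (x \<otimes>\<^bsub>obj (sym_ab d) n\<^esub> y) v = form_of x v + form_of y v"
  using hom_mult[OF form_of_hom] by simp

lemma form_of_one: "form_of \<one>\<^bsub>obj (sym_ab d) n\<^esub> v = 0"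
  using hom_one[OF form_of_hom gr_functorD(2)[OF is_gr_functor_sym_ab] group_integer_group] by simp

lemma form_of_class: "xs \<in> tuples d (obj ab_functor n) \<Longrightarrow>
   form_of (sym_class d (obj ab_functor n) xs) v = prod_list (map (ab_value v) xs)"
  unfolding form_of_def by (rule sym_eval_class[OF group_ab ab_value_hom])

text \<open>Both sides are homomorphisms in \<open>x\<close>, and on the class of a tuple both are the product of the values of
  the pulled back homomorphism.\<close>

lemma form_of_mor:
  assumes f: "f \<in> gr_hom m n" and x: "x \<in> carrier (obj (sym_ab d) m)"
  shows "form_of (mor (sym_ab d) m n f x) v = form_of x (\<lambda>i. exponent_value v (f (gr_gen i)))"
proof -
  let ?w = "\<lambda>i. exponent_value v (f (gr_gen i))"
  have fh: "mor ab_functor m n f \<in> hom (obj ab_functor m) (obj ab_functor n)"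
    by (rule gr_functorD(3)[OF is_gr_functor_ab f])
  have val: "ab_value v (mor ab_functor m n f C) = ab_value ?w C" if C: "C \<in> carrier (obj ab_functor m)" for C
  proof -
    obtain w where w: "w \<in> carrier (free_group m)" "C = ab_class m w" using ab_class_surj[OF C] by blast
    have "f w \<in> carrier (free_group n)" using gr_homD(3)[OF f] w by blast
    then show ?thesis using exponent_value_pullback[OF f w(1)] by (simp add: w ab_mor_class[OF f] ab_value_class)
  qed
  have "(\<lambda>x. form_of (mor (sym_ab d) m n f x) v) x = (\<lambda>x. form_of x ?w) x"
  proof (rule sym_hom_eqI[OF group_ab group_integer_group _ _ _ x[unfolded sym_ab_obj]])
    show "(\<lambda>x. form_of (mor (sym_ab d) m n f x) v) \<in> hom (sym_power d (obj ab_functor m)) integer_group"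
      using Group.hom_compose[OF gr_functorD(3)[OF is_gr_functor_sym_ab f] form_of_hom]
      by (simp add: comp_def sym_ab_obj)
    show "(\<lambda>x. form_of x ?w) \<in> hom (sym_power d (obj ab_functor m)) integer_group"
      using form_of_hom by (simp add: sym_ab_obj)
    fix xs assume xs: "xs \<in> tuples d (obj ab_functor m)"
    have m: "map (mor ab_functor m n f) xs \<in> tuples d (obj ab_functor n)"
      using map_multilinear(1)[OF group_ab group_ab fh] xs by blast
    have "form_of (mor (sym_ab d) m n f (sym_class d (obj ab_functor m) xs)) v
      = form_of (sym_class d (obj ab_functor n) (map (mor ab_functor m n f) xs)) v"
      using sym_map_class[OF group_ab group_ab fh xs] by (simp add: sym_functor_def)
    also have "\<dots> = prod_list (map (ab_value ?w) xs)"
      unfolding form_of_class[OF m] map_map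
      by (intro arg_cong[of _ _ prod_list] map_cong refl) (use xs in \<open>auto simp: val tuples_def\<close>)
    finally show "form_of (mor (sym_ab d) m n f (sym_class d (obj ab_functor m) xs)) v
      = form_of (sym_class d (obj ab_functor m) xs) ?w" by (simp add: form_of_class[OF xs])
  qed
  then show ?thesis by simp
qed

text \<open>The preimage of a monomial. A multiset has no order, so its sorted list is used; by symmetry any
  other list gives the same class.\<close>

definition monomial_class :: "nat \<Rightarrow> nat \<Rightarrow> nat multiset \<Rightarrow> (word set list \<Rightarrow>\<^sub>0 int) set set" where
  "monomial_class d n M = sym_class d (obj ab_functor n)
     (map (\<lambda>i. ab_class n (gr_gen i)) (sorted_list_of_multiset M))"

definition monomials :: "nat \<Rightarrow> nat \<Rightarrow> nat multiset set" where
  "monomials d n = {M. set_mset M \<subseteq> {..<n} \<and> size M = d}"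

lemma ab_class_closed: "w \<in> carrier (free_group n) \<Longrightarrow> ab_class n w \<in> carrier (obj ab_functor n)"
  by (rule hom_in_carrier[OF ab_class_hom])

lemma gen_tuple:
  "set zs \<subseteq> {..<n} \<Longrightarrow> set ys \<subseteq> carrier (obj ab_functor n) \<Longrightarrow> length zs + length ys = d \<Longrightarrow>
   map (\<lambda>i. ab_class n (gr_gen i)) zs @ ys \<in> tuples d (obj ab_functor n)"
  by (auto simp: tuples_def intro!: ab_class_closed)

lemma monomial_tuple:
  "M \<in> monomials d n \<Longrightarrow> map (\<lambda>i. ab_class n (gr_gen i)) (sorted_list_of_multiset M) \<in> tuples d (obj ab_functor n)"
  using gen_tuple[of "sorted_list_of_multiset M" n "[]" d]
  by (simp add: monomials_def) (metis mset_sorted_list_of_multiset size_mset)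

lemma monomial_class_closed: "M \<in> monomials d n \<Longrightarrow> monomial_class d n M \<in> carrier (obj (sym_ab d) n)"
  unfolding monomial_class_def sym_ab_obj by (rule sym_class_closed[OF group_ab monomial_tuple])

lemma form_of_monomial_class:
  assumes M: "M \<in> monomials d n"
  shows "form_of (monomial_class d n M) v = monomial M v"
proof -
  have e: "map (ab_value v) (map (\<lambda>i. ab_class n (gr_gen i)) (sorted_list_of_multiset M)) = map v (sorted_list_of_multiset M)"
    unfolding map_map by (rule map_cong) (use M in \<open>auto simp: monomials_def ab_value_class\<close>)
  have "form_of (monomial_class d n M) v = prod_list (map v (sorted_list_of_multiset M))"
    unfolding monomial_class_def form_of_class[OF monomial_tuple[OF M]] e ..
  also have "\<dots> = monomial M v"
    unfolding monomial_def by (metis mset_map mset_sorted_list_of_multiset prod_mset_prod_list)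
  finally show ?thesis .
qed

lemma monomial_span_of:
  assumes "M \<in> monomials d n"
  shows "free_lift (obj (sym_ab d) n) (monomial_class d n) (frag_of M) = monomial_class d n M"
  by (rule comm_group.free_lift_of[of _ "monomial_class d n"])
    (simp_all add: gr_functorD(1)[OF is_gr_functor_sym_ab] monomial_class_closed[OF assms])

lemma monomial_span_hom:
  "free_lift (obj (sym_ab d) n) (monomial_class d n) \<in> hom (free_Abelian_group (monomials d n)) (obj (sym_ab d) n)"
  by (rule comm_group.free_lift_hom[OF gr_functorD(1)[OF is_gr_functor_sym_ab]]) (auto intro: monomial_class_closed)

text \<open>The entries \<open>zs\<close> have already been replaced by generators. The next entry \<open>y\<close> is a word; the class is
  additive in it, so it lies in the span because it does so for every letter, by the induction
  hypothesis.\<close>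

lemma sym_class_in_span:
  assumes "set zs \<subseteq> {..<n}" "set ys \<subseteq> carrier (obj ab_functor n)" "length zs + length ys = d"
  shows "sym_class d (obj ab_functor n) (map (\<lambda>i. ab_class n (gr_gen i)) zs @ ys)
    \<in> free_lift (obj (sym_ab d) n) (monomial_class d n) ` carrier (free_Abelian_group (monomials d n))"
    (is "_ \<in> ?I")
  using assms
proof (induction ys arbitrary: zs)
  case Nil
  let ?g = "\<lambda>i. ab_class n (gr_gen i)"
  have M: "mset zs \<in> monomials d n" using Nil by (auto simp: monomials_def)
  have "sym_class d (obj ab_functor n) (map ?g zs @ []) = monomial_class d n (mset zs)"
    unfolding monomial_class_def
    by (rule sym_class_permute[OF group_ab monomial_tuple[OF M]]) simp
  also have "\<dots> = free_lift (obj (sym_ab d) n) (monomial_class d n) (frag_of (mset zs))"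
    by (rule monomial_span_of[OF M, symmetric])
  finally show ?case using M by (intro image_eqI) auto
next
  case (Cons y ys)
  let ?A = "obj ab_functor n" and ?S = "obj (sym_ab d) n" and ?g = "\<lambda>i. ab_class n (gr_gen i)"
  interpret L: group_hom "free_Abelian_group (monomials d n)" ?S "free_lift ?S (monomial_class d n)"
    using monomial_span_hom gr_functorD(2)[OF is_gr_functor_sym_ab] by (simp add: group_hom_def group_hom_axioms_def)
  interpret I: subgroup ?I ?S by (rule L.img_is_subgroup)
  let ?h = "\<lambda>a. sym_class d ?A (map ?g zs @ a # ys)"
  have t: "map ?g zs @ a # ys \<in> tuples d ?A" if "a \<in> carrier ?A" for a
    using Cons.prems that by (intro gen_tuple) auto
  have upd: "(map ?g zs @ y # ys)[length zs := a] = map ?g zs @ a # ys" for a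
    using list_update_length[of "map ?g zs" y ys a] by simp
  have y: "y \<in> carrier ?A" using Cons.prems by simp
  have h: "?h \<in> hom ?A ?S"
  proof (rule homI)
    show "?h a \<in> carrier ?S" if "a \<in> carrier ?A" for a
      unfolding sym_ab_obj by (rule sym_class_closed[OF group_ab t[OF that]])
    show "?h (a \<otimes>\<^bsub>?A\<^esub> b) = ?h a \<otimes>\<^bsub>?S\<^esub> ?h b" if "a \<in> carrier ?A" "b \<in> carrier ?A" for a b
      using sym_class_mult[OF group_ab t[OF y] _ that, of "length zs"] Cons.prems(3) unfolding upd sym_ab_obj by simp
  qed
  have hg: "(\<lambda>w. ?h (ab_class n w)) \<in> hom (free_group n) ?S"
    using Group.hom_compose[OF ab_class_hom h] by (simp add: comp_def)
  interpret H: group_hom "free_group n" ?S "\<lambda>w. ?h (ab_class n w)"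
    using hg group_free_group L.H.group_axioms by (simp add: group_hom_def group_hom_axioms_def)
  have gen: "?h (ab_class n (gr_gen i)) \<in> ?I" if "i < n" for i
    using Cons.IH[of "zs @ [i]"] Cons.prems that by simp
  have letter: "?h (ab_class n [x]) \<in> ?I" if x: "fst x < n" for x
  proof (cases "snd x")
    case True
    then have "[x] = gr_gen (fst x)" by (cases x) simp
    then show ?thesis using gen[OF x] by simp
  next
    case False
    have xc: "[x] \<in> carrier (free_group n)" using x by (simp add: free_group_simps reduced_Cons)
    have "[x] \<otimes>\<^bsub>free_group n\<^esub> gr_gen (fst x) = \<one>\<^bsub>free_group n\<^esub>"
      using False by (cases x) (simp add: free_group_simps inv_letter_def)
    then have "[x] = inv\<^bsub>free_group n\<^esub> gr_gen (fst x)"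
      using xc x H.G.inv_equality[of "[x]" "gr_gen (fst x)"] by simp
    then have "?h (ab_class n [x]) = inv\<^bsub>?S\<^esub> ?h (ab_class n (gr_gen (fst x)))"
      using H.hom_inv[of "gr_gen (fst x)"] x by simp
    then show ?thesis using gen[OF x] by simp
  qed
  have "?h (ab_class n w) \<in> ?I" if "w \<in> carrier (free_group n)" for w
    using that
  proof (induction w)
    case Nil
    then show ?case using H.hom_one I.one_closed by (simp add: free_group_simps)
  next
    case (Cons x w)
    have c: "[x] \<in> carrier (free_group n)" "w \<in> carrier (free_group n)" "fst x < n"
      using Cons.prems by (auto simp: free_group_simps reduced_Cons)
    have "x # w = [x] \<otimes>\<^bsub>free_group n\<^esub> w"
      using Cons.prems by (cases w) (auto simp: free_group_simps reduced_Cons)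
    then have "?h (ab_class n (x # w)) = ?h (ab_class n [x]) \<otimes>\<^bsub>?S\<^esub> ?h (ab_class n w)"
      using H.hom_mult[OF c(1,2)] by simp
    then show ?case using I.m_closed[OF letter[OF c(3)] Cons.IH[OF c(2)]] by simp
  qed
  then show ?case using ab_class_surj[OF y] by auto
qed

lemma sym_ab_span:
  assumes x: "x \<in> carrier (obj (sym_ab d) n)"
  shows "\<exists>c. supp c \<subseteq> monomials d n \<and> x = free_lift (obj (sym_ab d) n) (monomial_class d n) c"
proof -
  let ?S = "obj (sym_ab d) n" and ?A = "obj ab_functor n"
  let ?I = "free_lift ?S (monomial_class d n) ` carrier (free_Abelian_group (monomials d n))"
  interpret L: group_hom "free_Abelian_group (monomials d n)" ?S "free_lift ?S (monomial_class d n)"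
    using monomial_span_hom gr_functorD(2)[OF is_gr_functor_sym_ab] by (simp add: group_hom_def group_hom_axioms_def)
  interpret I: subgroup ?I ?S by (rule L.img_is_subgroup)
  obtain c where c: "supp c \<subseteq> tuples d ?A" "x = sym_proj d ?A c"
    by (rule sym_proj_surj[OF group_ab x[unfolded sym_ab_obj]])
  have p: "sym_proj d ?A \<in> hom (free_Abelian_group (tuples d ?A)) ?S"
    unfolding sym_ab_obj by (rule sym_proj_hom[OF group_ab])
  have "sym_proj d ?A c \<in> ?I" using c(1)
  proof (rule free_Abelian_group_induct)
    show "sym_proj d ?A 0 \<in> ?I"
      using hom_one[OF p _ L.H.group_axioms] I.one_closed by simp
    show "sym_proj d ?A (a - b) \<in> ?I"
      if "supp a \<subseteq> tuples d ?A" "supp b \<subseteq> tuples d ?A" "sym_proj d ?A a \<in> ?I" "sym_proj d ?A b \<in> ?I" for a b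
      using hom_free_diff[OF L.H.group_axioms p that(1,2)] that(3,4) by simp
    show "sym_proj d ?A (frag_of xs) \<in> ?I" if "xs \<in> tuples d ?A" for xs
      using sym_class_in_span[of "[]" n xs d] that by (simp add: tuples_def sym_class_def)
  qed
  then obtain e where "supp e \<subseteq> monomials d n" "sym_proj d ?A c = free_lift ?S (monomial_class d n) e"
    by auto
  then show ?thesis using c(2) by (intro exI[of _ e]) simp
qed

lemma free_lift_integer:
  fixes f :: "'a \<Rightarrow> int"
  shows "free_lift integer_group f c = (\<Sum>a\<in>supp c. Poly_Mapping.lookup c a * f a)"
proof -
  interpret comm_group integer_group by (rule abelian_integer_group)
  have "finprod integer_group g K = sum g K" if "finite K" for g :: "'a \<Rightarrow> int" and K
    using that by (induction K rule: finite_induct) (simp_all add: finprod_empty finprod_insert)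
  from this[OF finite_keys] show ?thesis unfolding free_lift_def group_int_pow_integer_group .
qed

lemma form_of_span:
  assumes c: "supp c \<subseteq> monomials d n"
  shows "form_of (free_lift (obj (sym_ab d) n) (monomial_class d n) c) v
    = (\<Sum>M\<in>supp c. Poly_Mapping.lookup c M * monomial M v)"
proof -
  have "(\<lambda>c. form_of (free_lift (obj (sym_ab d) n) (monomial_class d n) c) v) c = free_lift integer_group (\<lambda>M. monomial M v) c"
  proof (rule hom_free_eqI[OF group_integer_group _ _ _ c])
    show "(\<lambda>c. form_of (free_lift (obj (sym_ab d) n) (monomial_class d n) c) v) \<in> hom (free_Abelian_group (monomials d n)) integer_group"
      using Group.hom_compose[OF monomial_span_hom form_of_hom] by (simp add: comp_def)
    show "free_lift integer_group (\<lambda>M. monomial M v) \<in> hom (free_Abelian_group (monomials d n)) integer_group"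
      by (rule comm_group.free_lift_hom[OF abelian_integer_group]) simp
    fix M assume M: "M \<in> monomials d n"
    show "form_of (free_lift (obj (sym_ab d) n) (monomial_class d n) (frag_of M)) v = free_lift integer_group (\<lambda>M. monomial M v) (frag_of M)"
      by (simp add: monomial_span_of[OF M]
          form_of_monomial_class[OF M] comm_group.free_lift_of[OF abelian_integer_group])
  qed
  then show ?thesis by (simp add: free_lift_integer)
qed

lemma form_of_forms:
  assumes "x \<in> carrier (obj (sym_ab d) n)"
  shows "form_of x \<in> forms n d"
proof -
  obtain c where c: "supp c \<subseteq> monomials d n" "x = free_lift (obj (sym_ab d) n) (monomial_class d n) c"
    using sym_ab_span[OF assms] by blast
  have "(\<lambda>v. \<Sum>M\<in>supp c. Poly_Mapping.lookup c M * monomial M v) \<in> forms n d"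
    by (rule forms_sum, rule forms_monomial) (use c(1) in \<open>auto simp: monomials_def\<close>)
  also have "(\<lambda>v. \<Sum>M\<in>supp c. Poly_Mapping.lookup c M * monomial M v) = form_of x"
    unfolding c(2) form_of_span[OF c(1)] ..
  finally show ?thesis .
qed

lemma forms_form_of:
  assumes "f \<in> forms n d"
  shows "\<exists>x \<in> carrier (obj (sym_ab d) n). form_of x = f"
  using assms
proof (induction f rule: forms.induct)
  case zero
  show ?case using form_of_one group.is_monoid[OF gr_functorD(2)[OF is_gr_functor_sym_ab]] monoid.one_closed by blast
next
  case (step f M k)
  let ?S = "obj (sym_ab d) n"
  interpret S: group ?S by (rule gr_functorD(2)[OF is_gr_functor_sym_ab])
  obtain x where x: "x \<in> carrier ?S" "form_of x = f" using step.IH by blast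
  have M: "M \<in> monomials d n" using step.hyps by (simp add: monomials_def)
  have c: "supp (frag_cmul k (frag_of M)) \<subseteq> monomials d n" using M by auto
  let ?y = "free_lift ?S (monomial_class d n) (frag_cmul k (frag_of M))"
  have y: "?y \<in> carrier ?S" using hom_in_carrier[OF monomial_span_hom, of "frag_cmul k (frag_of M)"] c by simp
  have "form_of ?y v = k * monomial M v" for v
  proof (cases "k = 0")
    case False
    then have "supp (frag_cmul k (frag_of M)) = {M}" by (auto simp: in_keys_iff split: if_splits)
    then show ?thesis unfolding form_of_span[OF c] by simp
  qed (use form_of_span[of 0 d n v] in simp)
  then have "form_of (x \<otimes>\<^bsub>?S\<^esub> ?y) = (\<lambda>v. f v + k * monomial M v)"
    using form_of_mult[OF x(1) y] x(2) by auto
  then show ?case using x(1) y by blast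
qed

section \<open>Linear independence of monomials\<close>

lemma digits_unique:
  fixes e e' :: "nat \<Rightarrow> nat"
  assumes "\<And>i. e i < b" "\<And>i. e' i < b" "(\<Sum>i<n. e i * b ^ i) = (\<Sum>i<n. e' i * b ^ i)" "i < n"
  shows "e i = e' i"
  using assms
proof (induction n arbitrary: e e' i)
  case (Suc n)
  have split: "(\<Sum>i<Suc n. e i * b ^ i) = e 0 + b * (\<Sum>i<n. e (Suc i) * b ^ i)" for e :: "nat \<Rightarrow> nat"
    by (subst sum.lessThan_Suc_shift) (simp add: sum_distrib_left mult_ac)
  have b: "0 < b" using Suc.prems(1)[of 0] by simp
  have eq: "e 0 + b * (\<Sum>i<n. e (Suc i) * b ^ i) = e' 0 + b * (\<Sum>i<n. e' (Suc i) * b ^ i)"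
    using Suc.prems(3) by (simp only: split)
  have "(e 0 + b * (\<Sum>i<n. e (Suc i) * b ^ i)) mod b = (e' 0 + b * (\<Sum>i<n. e' (Suc i) * b ^ i)) mod b"
    by (simp only: eq)
  then have 0: "e 0 = e' 0" using Suc.prems(1,2) by simp
  then have "(\<Sum>i<n. e (Suc i) * b ^ i) = (\<Sum>i<n. e' (Suc i) * b ^ i)" using eq b by simp
  with Suc.IH[of "\<lambda>i. e (Suc i)" "\<lambda>i. e' (Suc i)"] Suc.prems have "e (Suc j) = e' (Suc j)" if "j < n" for j
    using that by simp
  with 0 Suc.prems(4) show ?case by (cases i) auto
qed simp

text \<open>Substituting \<open>t ^ b ^ i\<close> for the \<open>i\<close>-th variable turns a monomial into a power of \<open>t\<close> whose exponent
  has the exponents of the monomial as its digits in base \<open>b\<close>.\<close>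

lemma monomial_powers:
  assumes "set_mset M \<subseteq> {..<n}"
  shows "monomial M (\<lambda>i. t ^ (b ^ i)) = t ^ (\<Sum>i<n. count M i * b ^ i)"
  using assms
proof (induction M)
  case (add j M)
  have "(\<Sum>i<n. count (add_mset j M) i * b ^ i) = (\<Sum>i<n. count M i * b ^ i + (if i = j then b ^ i else 0))"
    by (intro sum.cong refl) simp
  also have "\<dots> = (\<Sum>i<n. count M i * b ^ i) + b ^ j" using add.prems by (simp add: sum.distrib)
  finally show ?case using add by (simp add: power_add)
qed simp

text \<open>In base \<open>d + 1\<close> different monomials of degree \<open>d\<close> become different powers of \<open>t\<close>, and a polynomial
  function in one variable that is zero everywhere has zero coefficients.\<close>

lemma monomials_independent:
  assumes K: "finite K" "K \<subseteq> monomials d n"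
    and z: "\<And>v. (\<Sum>M\<in>K. c M * monomial M v) = 0" and M: "M \<in> K"
  shows "c M = 0"
proof -
  let ?wt = "\<lambda>M. \<Sum>i<n. count M i * Suc d ^ i"
  define p where "p = (\<Sum>M\<in>K. Polynomial.monom (c M) (?wt M))"
  have inj: "?wt L \<noteq> ?wt M" if "L \<in> K" "L \<noteq> M" for L
  proof
    assume eq: "?wt L = ?wt M"
    have lt: "count N i < Suc d" if "N \<in> K" for N i
      using that K(2) count_le_size[of N i] by (auto simp: monomials_def less_Suc_eq_le)
    have "count L i = count M i" if "i < n" for i
      by (rule digits_unique[OF lt[OF \<open>L \<in> K\<close>] lt[OF M] eq that])
    moreover have "count L i = count M i" if "\<not> i < n" for i
      using that \<open>L \<in> K\<close> M K(2) by (auto simp: monomials_def subset_iff simp flip: not_in_iff)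
        (metis lessThan_iff not_in_iff subset_iff)
    ultimately show False using that(2) by (metis multiset_eqI)
  qed
  have "poly p t = 0" for t
  proof -
    have "poly p t = (\<Sum>M\<in>K. c M * monomial M (\<lambda>i. t ^ (Suc d ^ i)))"
      unfolding p_def poly_sum
      by (intro sum.cong refl) (use K(2) in \<open>auto simp: poly_monom monomials_def monomial_powers\<close>)
    then show ?thesis using z by simp
  qed
  then have "p = 0" using poly_all_0_iff_0 by blast
  then have "0 = coeff p (?wt M)" by simp
  also have "\<dots> = (\<Sum>L\<in>K. if L = M then c M else 0)"
    unfolding p_def coeff_sum by (intro sum.cong refl) (use inj in auto)
  also have "\<dots> = c M" using K(1) M by simp
  finally show ?thesis by simp
qed

lemma form_of_injective:
  assumes x: "x \<in> carrier (obj (sym_ab d) n)" and z: "\<And>v. form_of x v = 0"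
  shows "x = \<one>\<^bsub>obj (sym_ab d) n\<^esub>"
proof -
  obtain c where c: "supp c \<subseteq> monomials d n" "x = free_lift (obj (sym_ab d) n) (monomial_class d n) c"
    using sym_ab_span[OF x] by blast
  have "Poly_Mapping.lookup c M = 0" if "M \<in> supp c" for M
    by (rule monomials_independent[OF _ c(1) _ that])
      (use z form_of_span[OF c(1)] c(2) in auto)
  then have "c = 0" by (metis in_keys_iff keys_eq_empty all_not_in_conv)
  then show ?thesis
    using hom_one[OF monomial_span_hom _ gr_functorD(2)[OF is_gr_functor_sym_ab]] c(2) by simp
qed

lemma form_of_inject:
  assumes "x \<in> carrier (obj (sym_ab d) n)" "y \<in> carrier (obj (sym_ab d) n)" "form_of x = form_of y"
  shows "x = y"
proof -
  interpret S: group "obj (sym_ab d) n" by (rule gr_functorD(2)[OF is_gr_functor_sym_ab])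
  have inv: "form_of (inv\<^bsub>obj (sym_ab d) n\<^esub> y) v = - form_of y v" for v
    using form_of_mult[OF assms(2) S.inv_closed[OF assms(2)], of v] form_of_one[of d n v] assms(2) by simp
  have "form_of (x \<otimes>\<^bsub>obj (sym_ab d) n\<^esub> inv\<^bsub>obj (sym_ab d) n\<^esub> y) v = 0" for v
    using form_of_mult[OF assms(1) S.inv_closed[OF assms(2)], of v] inv assms(3) by simp
  then have "x \<otimes>\<^bsub>obj (sym_ab d) n\<^esub> inv\<^bsub>obj (sym_ab d) n\<^esub> y = \<one>\<^bsub>obj (sym_ab d) n\<^esub>"
    using assms by (intro form_of_injective) auto
  then show ?thesis using assms(1,2) by (metis S.inv_equality S.inv_inv S.inv_closed)
qed

section \<open>The bar resolution of the abelianization functor\<close>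

definition word_hom :: "nat \<Rightarrow> nat \<Rightarrow> word list \<Rightarrow> word \<Rightarrow> word" where
  "word_hom m n us = (THE h. h \<in> gr_hom m n \<and> (\<forall>i<m. h (gr_gen i) = us ! i))"

definition gr_gens :: "nat \<Rightarrow> word list" where
  "gr_gens m = map gr_gen [0..<m]"

lemma gr_hom_eqI:
  assumes "h \<in> gr_hom m n" "k \<in> gr_hom m n" "\<And>i. i < m \<Longrightarrow> h (gr_gen i) = k (gr_gen i)"
  shows "h = k"
proof (rule extensionalityI[OF gr_homD(2)[OF assms(1)] gr_homD(2)[OF assms(2)]])
  show "h w = k w" if "w \<in> carrier (free_group m)" for w
    by (rule free_group_hom_eqI[OF group_free_group gr_homD(1)[OF assms(1)] gr_homD(1)[OF assms(2)] assms(3) that])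
qed

lemma word_hom:
  assumes "us \<in> tuples m (free_group n)"
  shows "word_hom m n us \<in> gr_hom m n" "i < m \<Longrightarrow> word_hom m n us (gr_gen i) = us ! i"
proof -
  have "\<exists>!h. h \<in> gr_hom m n \<and> (\<forall>i<m. h (gr_gen i) = us ! i)"
    unfolding gr_hom_def
    by (rule free_group_universal[OF group_free_group]) (use assms in \<open>auto simp: tuples_def\<close>)
  from theI'[OF this] show "word_hom m n us \<in> gr_hom m n" "i < m \<Longrightarrow> word_hom m n us (gr_gen i) = us ! i"
    by (auto simp: word_hom_def)
qed

lemma gr_gens_tuple: "gr_gens m \<in> tuples m (free_group m)"
  by (auto simp: tuples_def gr_gens_def)

lemma map_tuple: "h \<in> gr_hom m n \<Longrightarrow> us \<in> tuples k (free_group m) \<Longrightarrow> map h us \<in> tuples k (free_group n)"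
  using gr_homD(3)[of h m n] by (auto simp: tuples_def)

lemma word_hom_gens: "h \<in> gr_hom m n \<Longrightarrow> word_hom m n (map h (gr_gens m)) = h"
  using word_hom[OF map_tuple[OF _ gr_gens_tuple]] by (intro gr_hom_eqI[of _ m n]) (auto simp: gr_gens_def)

lemma map_word_hom_gens: "us \<in> tuples m (free_group n) \<Longrightarrow> map (word_hom m n us) (gr_gens m) = us"
  using word_hom(2)[of us m n] by (intro nth_equalityI) (auto simp: gr_gens_def tuples_def)

lemma gr_comp_word_hom:
  assumes f: "f \<in> gr_hom m n" and us: "us \<in> tuples k (free_group m)"
  shows "gr_comp k f (word_hom k m us) = word_hom k n (map f us)"
proof (rule gr_hom_eqI[OF gr_comp[OF word_hom(1)[OF us] f] word_hom(1)[OF map_tuple[OF f us]]])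
  fix i assume i: "i < k"
  then show "gr_comp k f (word_hom k m us) (gr_gen i) = word_hom k n (map f us) (gr_gen i)"
    using us by (simp add: word_hom(2)[OF us] word_hom(2)[OF map_tuple[OF f us]] gr_comp_def compose_def tuples_def)
qed

text \<open>The generator in degree \<open>k\<close> has rank \<open>k + 1\<close> and stands for the tuple of the free generators. The
  standard resolution labels a generator by a list that presents its boundary; any list that presents
  the bar boundary will do.\<close>

fun bar_gen :: "nat \<Rightarrow> word set gen" where
  "bar_gen 0 = Elt 1 (ab_class 1 (gr_gen 0))"
| "bar_gen (Suc k) = Cyc (Suc (Suc k)) (SOME L.
     (\<forall>(c, g, h) \<in> set L. (g, h) \<in> cells {bar_gen k} (Suc (Suc k))) \<and>
     lincomb L = frag_extend (\<lambda>us. frag_of (bar_gen k, word_hom (Suc k) (Suc (Suc k)) us))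
       (bar_face_sum (free_group (Suc (Suc k))) (gr_gens (Suc (Suc k)))))"

definition bar_embed :: "nat \<Rightarrow> nat \<Rightarrow> (word list \<Rightarrow>\<^sub>0 int) \<Rightarrow> word set chain" where
  "bar_embed k n = frag_extend (\<lambda>us. frag_of (bar_gen k, word_hom (Suc k) n us))"

lemma rank_bar_gen [simp]: "rank (bar_gen k) = Suc k"
  by (cases k) auto

lemma bar_embed_of [simp]: "bar_embed k n (frag_of us) = frag_of (bar_gen k, word_hom (Suc k) n us)"
  by (simp add: bar_embed_def)

lemma bar_embed_0 [simp]: "bar_embed k n 0 = 0"
  by (simp add: bar_embed_def)

lemma bar_embed_diff: "bar_embed k n (c - e) = bar_embed k n c - bar_embed k n e"
  by (simp add: bar_embed_def frag_extend_diff)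

lemma bar_embed_hom: "bar_embed k n \<in> hom (free_Abelian_group (tuples (Suc k) (free_group n))) (free_Abelian_group (cells {bar_gen k} n))"
  unfolding bar_embed_def by (rule frag_extend_hom) (auto simp: cells_def word_hom)

lemma keys_bar_embed:
  "supp c \<subseteq> tuples (Suc k) (free_group n) \<Longrightarrow> supp (bar_embed k n c) \<subseteq> cells {bar_gen k} n"
  using hom_in_carrier[OF bar_embed_hom, of c k n] by simp

lemma monoid_free_group: "monoid (free_group n)"
  by (rule group.is_monoid[OF group_free_group])

text \<open>Unfolds the choice that is made in the definition of \<open>bar_gen\<close>.\<close>

lemma bar_gen_list:
  fixes k :: nat
  defines "n \<equiv> Suc (Suc k)"
  obtains L where "bar_gen (Suc k) = Cyc n L" "\<forall>(c, g, h) \<in> set L. (g, h) \<in> cells {bar_gen k} n"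
    "lincomb L = bar_embed k n (bar_face_sum (free_group n) (gr_gens n))"
proof -
  let ?P = "\<lambda>L. (\<forall>(c, g, h) \<in> set L. (g, h) \<in> cells {bar_gen k} n) \<and>
      lincomb L = bar_embed k n (bar_face_sum (free_group n) (gr_gens n))"
  have "gr_gens n \<in> tuples (Suc (Suc k)) (free_group n)" unfolding n_def by (rule gr_gens_tuple)
  then have "supp (bar_embed k n (bar_face_sum (free_group n) (gr_gens n))) \<subseteq> cells {bar_gen k} n"
    by (intro keys_bar_embed keys_bar_face_sum[OF monoid_free_group])
  from someI_ex[OF ex_lincomb[OF this]] have "?P (SOME L. ?P L)" .
  moreover have "bar_gen (Suc k) = Cyc n (SOME L. ?P L)"
    unfolding bar_gen.simps bar_embed_def n_def ..
  ultimately show ?thesis using that by blast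
qed

lemma gen_boundary_bar_gen:
  "gen_boundary (bar_gen (Suc k)) = bar_embed k (Suc (Suc k)) (bar_face_sum (free_group (Suc (Suc k))) (gr_gens (Suc (Suc k))))"
  by (rule bar_gen_list[of k]) simp

lemma push_bar_embed:
  assumes f: "f \<in> gr_hom m n" and c: "supp c \<subseteq> tuples (Suc k) (free_group m)"
  shows "push f (bar_embed k m c) = bar_embed k n (frag_extend (\<lambda>l. frag_of (map f l)) c)"
  using c
proof (rule frag_induction)
  show "push f (bar_embed k m (frag_of us)) = bar_embed k n (frag_extend (\<lambda>l. frag_of (map f l)) (frag_of us))"
    if "us \<in> tuples (Suc k) (free_group m)" for us
    using gr_comp_word_hom[OF f that] by simp
qed (simp_all add: push_diff bar_embed_diff frag_extend_diff)

text \<open>The formula holds for the tuple of free generators by the choice of \<open>bar_gen\<close>, and every tuple is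
  the image of that one under a homomorphism.\<close>

lemma boundary_bar_embed:
  assumes c: "supp c \<subseteq> tuples (Suc (Suc k)) (free_group n)"
  shows "boundary (bar_embed (Suc k) n c) = bar_embed k n (bar_boundary (free_group n) c)"
  using c
proof (rule frag_induction)
  fix us assume us: "us \<in> tuples (Suc (Suc k)) (free_group n)"
  let ?m = "Suc (Suc k)" and ?h = "word_hom (Suc (Suc k)) n us"
  have "boundary (bar_embed (Suc k) n (frag_of us)) = push ?h (bar_embed k ?m (bar_face_sum (free_group ?m) (gr_gens ?m)))"
    by (simp only: bar_embed_of boundary_of gen_boundary_bar_gen)
  also have "\<dots> = bar_embed k n (frag_extend (\<lambda>l. frag_of (map ?h l)) (bar_face_sum (free_group ?m) (gr_gens ?m)))"
    by (rule push_bar_embed[OF word_hom(1)[OF us] keys_bar_face_sum[OF monoid_free_group gr_gens_tuple]])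
  also have "frag_extend (\<lambda>l. frag_of (map ?h l)) (bar_face_sum (free_group ?m) (gr_gens ?m)) = bar_face_sum (free_group n) (map ?h (gr_gens ?m))"
    by (rule bar_face_sum_map[OF gr_homD(1)[OF word_hom(1)[OF us]]]) (use gr_gens_tuple[of ?m] in \<open>simp add: tuples_def\<close>)
  finally show "boundary (bar_embed (Suc k) n (frag_of us)) = bar_embed k n (bar_boundary (free_group n) (frag_of us))"
    by (simp only: map_word_hom_gens[OF us] bar_boundary_of)
qed (simp_all add: boundary_diff bar_embed_diff bar_boundary_diff)

lemma bar_embed_surj:
  assumes p: "supp p \<subseteq> cells {bar_gen k} n"
  obtains c where "supp c \<subseteq> tuples (Suc k) (free_group n)" "p = bar_embed k n c"
proof -
  let ?r = "frag_extend (\<lambda>(g, h). frag_of (map h (gr_gens (Suc k))))"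
  have "?r \<in> hom (free_Abelian_group (cells {bar_gen k} n)) (free_Abelian_group (tuples (Suc k) (free_group n)))"
    by (rule frag_extend_hom) (auto simp: cells_def map_tuple[OF _ gr_gens_tuple])
  from hom_in_carrier[OF this, of p] p have "supp (?r p) \<subseteq> tuples (Suc k) (free_group n)" by simp
  moreover have "bar_embed k n (?r p) = p"
    using p
  proof (rule frag_induction)
    show "bar_embed k n (?r (frag_of a)) = frag_of a" if "a \<in> cells {bar_gen k} n" for a
      using that word_hom_gens by (auto simp: cells_def)
  qed (simp_all add: frag_extend_diff bar_embed_diff)
  ultimately show ?thesis using that by metis
qed

lemma bar_embed_inj:
  assumes c: "supp c \<subseteq> tuples (Suc k) (free_group n)" and z: "bar_embed k n c = 0"
  shows "c = 0"
proof -
  let ?r = "frag_extend (\<lambda>(g, h). frag_of (map h (gr_gens (Suc k))))"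
  have "?r (bar_embed k n c) = c"
    using c
  proof (rule frag_induction)
    show "?r (bar_embed k n (frag_of us)) = frag_of us" if "us \<in> tuples (Suc k) (free_group n)" for us
      using map_word_hom_gens[OF that] by simp
  qed (simp_all add: frag_extend_diff bar_embed_diff)
  then show ?thesis using z by simp
qed

lemma bar_gen_0_res: "bar_gen 0 \<in> res_gens ab_functor 0"
  using ab_class_closed[of "gr_gen 0" 1] by (simp add: res_gens.simps)

lemma bar_cells_0: "cells {bar_gen 0} n \<subseteq> cells (res_gens ab_functor 0) n"
  using bar_gen_0_res by (auto simp: cells_def)

lemma augmentation_bar_hom:
  "(\<lambda>c. augmentation ab_functor n (bar_embed 0 n c)) \<in> hom (free_Abelian_group (tuples 1 (free_group n))) (obj ab_functor n)"
  using Group.hom_compose[OF bar_embed_hom[of 0 n] hom_free_subset[OF augmentation_hom[OF is_gr_functor_ab] bar_cells_0]]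
  by (simp add: comp_def)

lemma augmentation_bar_of:
  assumes u: "u \<in> carrier (free_group n)"
  shows "augmentation ab_functor n (bar_embed 0 n (frag_of [u])) = ab_class n u"
proof -
  have t: "[u] \<in> tuples 1 (free_group n)" using u by (simp add: tuples_def)
  let ?h = "word_hom 1 n [u]"
  have "augmentation ab_functor n (bar_embed 0 n (frag_of [u])) = mor ab_functor 1 n ?h (ab_class 1 (gr_gen 0))"
    using augmentation_of[OF is_gr_functor_ab ab_class_closed[of "gr_gen 0" 1] word_hom(1)[OF t]] by simp
  also have "\<dots> = ab_class n (?h (gr_gen 0))" by (rule ab_mor_class[OF word_hom(1)[OF t]]) simp
  also have "?h (gr_gen 0) = u" using word_hom(2)[OF t, of 0] by simp
  finally show ?thesis .
qed

lemma augmentation_bar_boundary: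
  assumes u: "u \<in> carrier (free_group n)" and w: "w \<in> carrier (free_group n)"
  shows "augmentation ab_functor n (bar_embed 0 n (bar_face_sum (free_group n) [u, w])) = \<one>\<^bsub>obj ab_functor n\<^esub>"
proof -
  interpret Q: comm_group "obj ab_functor n" by (rule gr_functorD(1)[OF is_gr_functor_ab])
  let ?a = "\<lambda>c. augmentation ab_functor n (bar_embed 0 n c)" and ?uw = "u \<otimes>\<^bsub>free_group n\<^esub> w"
  have uw: "?uw \<in> carrier (free_group n)" by (rule monoid.m_closed[OF monoid_free_group u w])
  have k: "supp (frag_of [x]) \<subseteq> tuples 1 (free_group n)" if "x \<in> carrier (free_group n)" for x
    using that by (simp add: tuples_def)
  note d = hom_free_diff[OF Q.group_axioms augmentation_bar_hom]
  have "?a (bar_face_sum (free_group n) [u, w]) = ?a (frag_of [w] - (frag_of [?uw] - frag_of [u]))" by simp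
  also have "\<dots> = ?a (frag_of [w]) \<otimes>\<^bsub>obj ab_functor n\<^esub> inv\<^bsub>obj ab_functor n\<^esub>
      (?a (frag_of [?uw]) \<otimes>\<^bsub>obj ab_functor n\<^esub> inv\<^bsub>obj ab_functor n\<^esub> ?a (frag_of [u]))"
    by (simp only: d[OF k[OF w] keys_frag_diff[OF k[OF uw] k[OF u]]] d[OF k[OF uw] k[OF u]])
  also have "\<dots> = \<one>\<^bsub>obj ab_functor n\<^esub>"
    unfolding augmentation_bar_of[OF u] augmentation_bar_of[OF w] augmentation_bar_of[OF uw] hom_mult[OF ab_class_hom u w]
  proof -
    let ?a = "ab_class n u" and ?b = "ab_class n w"
    have ab: "?a \<in> carrier (obj ab_functor n)" "?b \<in> carrier (obj ab_functor n)"
      using ab_class_closed u w by auto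
    then have "?a \<otimes>\<^bsub>obj ab_functor n\<^esub> ?b \<otimes>\<^bsub>obj ab_functor n\<^esub> inv\<^bsub>obj ab_functor n\<^esub> ?a = ?b"
      by (simp add: Q.m_comm[of ?a ?b] Q.m_assoc)
    then show "?b \<otimes>\<^bsub>obj ab_functor n\<^esub> inv\<^bsub>obj ab_functor n\<^esub>
      (?a \<otimes>\<^bsub>obj ab_functor n\<^esub> ?b \<otimes>\<^bsub>obj ab_functor n\<^esub> inv\<^bsub>obj ab_functor n\<^esub> ?a) = \<one>\<^bsub>obj ab_functor n\<^esub>"
      using ab by simp
  qed
  finally show ?thesis .
qed

text \<open>The boundary of \<open>bar_gen (k + 1)\<close> is a cycle because the square of the bar boundary is zero.\<close>

lemma bar_gen_res: "bar_gen k \<in> res_gens ab_functor k"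
proof (induction k)
  case 0 show ?case by (rule bar_gen_0_res)
next
  case (Suc k)
  let ?n = "Suc (Suc k)"
  obtain L where L: "bar_gen (Suc k) = Cyc ?n L" "\<forall>(c, g, h) \<in> set L. (g, h) \<in> cells {bar_gen k} ?n"
    "lincomb L = bar_embed k ?n (bar_face_sum (free_group ?n) (gr_gens ?n))" by (rule bar_gen_list)
  have "\<forall>(c, g, h) \<in> set L. (g, h) \<in> cells (res_gens ab_functor k) ?n"
    using L(2) Suc.IH by (auto simp: cells_def)
  moreover have "if k = 0 then augmentation ab_functor ?n (lincomb L) = \<one>\<^bsub>obj ab_functor ?n\<^esub> else boundary (lincomb L) = 0"
  proof (cases k)
    case 0
    have "gr_gens 2 = [gr_gen 0, gr_gen 1]" by (simp add: gr_gens_def upt_rec numeral_2_eq_2)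
    then show ?thesis using 0 augmentation_bar_boundary[of "gr_gen 0" 2 "gr_gen 1"] by (simp add: L(3) numeral_2_eq_2)
  next
    case (Suc j)
    have t: "supp (frag_of (gr_gens ?n)) \<subseteq> tuples ?n (free_group ?n)" using gr_gens_tuple by simp
    have "boundary (lincomb L) = bar_embed j ?n (bar_boundary (free_group ?n) (bar_face_sum (free_group ?n) (gr_gens ?n)))"
      unfolding L(3) Suc by (rule boundary_bar_embed[OF keys_bar_face_sum[OF monoid_free_group]]) (use gr_gens_tuple Suc in simp)
    also have "bar_boundary (free_group ?n) (bar_face_sum (free_group ?n) (gr_gens ?n)) = 0"
      using bar_boundary_boundary[OF monoid_free_group t] by simp
    finally show ?thesis using Suc by simp
  qed
  ultimately show ?case unfolding L(1) res_gens.simps by blast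
qed

text \<open>Modulo boundaries \<open>[g] + [h] = [gh]\<close>, so \<open>g \<mapsto> [g]\<close> is a homomorphism to an abelian group and factors
  through the abelianization. Hence the class of a chain modulo boundaries is determined by its
  augmentation.\<close>

lemma bar_exact_low:
  assumes c: "supp c \<subseteq> tuples 1 (free_group n)"
    and z: "augmentation ab_functor n (bar_embed 0 n c) = \<one>\<^bsub>obj ab_functor n\<^esub>"
  shows "\<exists>e. supp e \<subseteq> tuples 2 (free_group n) \<and> bar_boundary (free_group n) e = c"
proof -
  let ?G = "free_group n"
  let ?A = "free_Abelian_group (tuples 1 ?G)" and ?E = "free_Abelian_group (tuples 2 ?G)"
  let ?B = "bar_boundary ?G ` carrier ?E"
  have "bar_boundary ?G \<in> hom ?E ?A"
    using keys_bar_boundary[OF monoid_free_group, of _ 1 n] by (intro homI) (simp_all add: bar_boundary_add numeral_2_eq_2)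
  then interpret D: group_hom ?E ?A "bar_boundary ?G" by (simp add: group_hom_def group_hom_axioms_def)
  have sub: "subgroup ?B ?A" by (rule D.img_is_subgroup)
  have nB: "?B \<lhd> ?A" by (rule comm_group.subgroup_imp_normal[OF abelian_free_Abelian_group sub])
  interpret B: normal ?B ?A by (rule nB)
  have Q: "comm_group (?A Mod ?B)" by (rule comm_group.abelian_FactGroup[OF abelian_free_Abelian_group sub])
  have gQ: "group (?A Mod ?B)" using Q by (simp add: comm_group_def)
  let ?q = "\<lambda>g. ?B #>\<^bsub>?A\<^esub> frag_of [g]"
  have t: "frag_of [g] \<in> carrier ?A" if "g \<in> carrier ?G" for g using that by (simp add: tuples_def)
  have q: "?q \<in> hom ?G (?A Mod ?B)"
  proof (rule homI)
    show "?q g \<in> carrier (?A Mod ?B)" if "g \<in> carrier ?G" for g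
      by (rule hom_in_carrier[OF quotient_hom[OF nB] t[OF that]])
    fix g h assume gh: "g \<in> carrier ?G" "h \<in> carrier ?G"
    let ?s = "frag_of [g] + frag_of [h]"
    have s: "?s \<in> carrier ?A" using D.H.m_closed[OF t[OF gh(1)] t[OF gh(2)]] by simp
    have "bar_boundary ?G (frag_of [g, h]) \<in> ?B" by (rule imageI) (use gh in \<open>simp add: tuples_def\<close>)
    then have b: "frag_of [h] - (frag_of [g \<otimes>\<^bsub>?G\<^esub> h] - frag_of [g]) \<in> ?B" by simp
    have "?s = (frag_of [h] - (frag_of [g \<otimes>\<^bsub>?G\<^esub> h] - frag_of [g])) \<otimes>\<^bsub>?A\<^esub> frag_of [g \<otimes>\<^bsub>?G\<^esub> h]" by simp
    then have "?s \<in> ?B #>\<^bsub>?A\<^esub> frag_of [g \<otimes>\<^bsub>?G\<^esub> h]" unfolding r_coset_def using b by blast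
    then have "?q (g \<otimes>\<^bsub>?G\<^esub> h) = ?B #>\<^bsub>?A\<^esub> ?s"
      using D.H.repr_independence[OF _ t[OF monoid.m_closed[OF monoid_free_group gh]] sub] by simp
    then show "?q (g \<otimes>\<^bsub>?G\<^esub> h) = ?q g \<otimes>\<^bsub>?A Mod ?B\<^esub> ?q h"
      using hom_mult[OF quotient_hom[OF nB] t[OF gh(1)] t[OF gh(2)]] by simp
  qed
  note triv = derived_trivial[OF group_free_group Q q]
  have l: "quot_lift ?q \<in> hom (obj ab_functor n) (?A Mod ?B)"
    unfolding ab_obj by (rule quot_lift_hom[OF derived_normal gQ q triv])
  have l_class: "quot_lift ?q (ab_class n g) = ?q g" if "g \<in> carrier ?G" for g
    unfolding ab_class_def by (rule quot_lift_coset[OF derived_normal gQ q triv that])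
  have "(\<lambda>c. quot_lift ?q (augmentation ab_functor n (bar_embed 0 n c))) c = (\<lambda>c. ?B #>\<^bsub>?A\<^esub> c) c"
  proof (rule hom_free_eqI[OF gQ _ quotient_hom[OF nB] _ c])
    show "(\<lambda>c. quot_lift ?q (augmentation ab_functor n (bar_embed 0 n c))) \<in> hom ?A (?A Mod ?B)"
      using Group.hom_compose[OF augmentation_bar_hom l] by (simp add: comp_def)
    fix us assume "us \<in> tuples 1 ?G"
    then obtain u where "us = [u]" "u \<in> carrier ?G" by (auto simp: tuples_def length_Suc_conv)
    then show "quot_lift ?q (augmentation ab_functor n (bar_embed 0 n (frag_of us))) = ?B #>\<^bsub>?A\<^esub> frag_of us"
      by (simp only: augmentation_bar_of l_class)
  qed
  then have "?B #>\<^bsub>?A\<^esub> c = quot_lift ?q \<one>\<^bsub>obj ab_functor n\<^esub>" by (simp only: z)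
  also have "\<dots> = ?B" using hom_one[OF l group_ab gQ] by (simp add: FactGroup_def)
  finally have "?B #>\<^bsub>?A\<^esub> c = ?B" .
  then have "c \<in> ?B" using D.H.rcos_self[OF _ sub, of c] c by simp
  then obtain e where "e \<in> carrier ?E" "c = bar_boundary ?G e" by (elim imageE)
  then show ?thesis by (intro exI[of _ e]) simp
qed

interpretation bar: one_generator_resolution ab_functor bar_gen
proof
  show "is_gr_functor ab_functor" by (rule is_gr_functor_ab)
  show "bar_gen k \<in> res_gens ab_functor k" for k by (rule bar_gen_res)
  show "supp (gen_boundary (bar_gen (Suc k))) \<subseteq> cells {bar_gen k} (rank (bar_gen (Suc k)))" for k
    unfolding gen_boundary_bar_gen rank_bar_gen
    by (rule keys_bar_embed[OF keys_bar_face_sum[OF monoid_free_group gr_gens_tuple]])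
  show "\<exists>p. supp p \<subseteq> cells {bar_gen 0} n \<and> augmentation ab_functor n p = x"
    if x: "x \<in> carrier (obj ab_functor n)" for n x
  proof -
    obtain w where w: "w \<in> carrier (free_group n)" "x = ab_class n w" using ab_class_surj[OF x] by blast
    have "supp (bar_embed 0 n (frag_of [w])) \<subseteq> cells {bar_gen 0} n"
      using w by (intro keys_bar_embed) (simp add: tuples_def)
    then show ?thesis using augmentation_bar_of[OF w(1)] w(2) by blast
  qed
  show "\<exists>q. supp q \<subseteq> cells {bar_gen (Suc k)} n \<and> boundary q = p"
    if p: "supp p \<subseteq> cells {bar_gen k} n"
      and z: "if k = 0 then augmentation ab_functor n p = \<one>\<^bsub>obj ab_functor n\<^esub> else boundary p = 0" for k n p
  proof -
    obtain c where c: "supp c \<subseteq> tuples (Suc k) (free_group n)" "p = bar_embed k n c"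
      by (rule bar_embed_surj[OF p])
    have "\<exists>e. supp e \<subseteq> tuples (Suc (Suc k)) (free_group n) \<and> bar_boundary (free_group n) e = c"
    proof (cases k)
      case 0
      then show ?thesis using bar_exact_low[of c n] c z by (simp add: numeral_2_eq_2)
    next
      case (Suc j)
      have "bar_embed j n (bar_boundary (free_group n) c) = 0"
        using boundary_bar_embed[of c j n] c z Suc by simp
      then have "bar_boundary (free_group n) c = 0"
        using keys_bar_boundary[OF monoid_free_group, of c "Suc j" n] c(1) Suc by (intro bar_embed_inj[of _ j n]) auto
      then show ?thesis using bar_exact[of c j n] c(1) Suc by simp
    qed
    then obtain e where e: "supp e \<subseteq> tuples (Suc (Suc k)) (free_group n)" "bar_boundary (free_group n) e = c" by blast
    then show ?thesis using keys_bar_embed[OF e(1)] boundary_bar_embed[OF e(1)] c(2) by (intro exI[of _ "bar_embed (Suc k) n e"]) simp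
  qed
qed

section \<open>The cochain complex of forms\<close>

text \<open>The faces that make up \<open>bar_act G g hs\<close>: entry \<open>a\<close> of \<open>g # hs\<close> is multiplied with the next one, and for
  \<open>a = length hs\<close> the last entry is dropped.\<close>

fun bar_merge :: "('a, 'm) monoid_scheme \<Rightarrow> nat \<Rightarrow> 'a \<Rightarrow> 'a list \<Rightarrow> 'a list" where
  "bar_merge G a g [] = []"
| "bar_merge G 0 g (h # hs) = (g \<otimes>\<^bsub>G\<^esub> h) # hs"
| "bar_merge G (Suc a) g (h # hs) = g # bar_merge G a h hs"

lemma integer_lift_of: "free_lift integer_group F (frag_of l) = F l"
  by (rule comm_group.free_lift_of[OF abelian_integer_group]) simp

lemma integer_lift_hom: "free_lift integer_group F \<in> hom (free_Abelian_group S) integer_group"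
  by (rule comm_group.free_lift_hom[OF abelian_integer_group]) simp

lemma integer_lift_diff: "free_lift integer_group F (c - e) = free_lift integer_group F c - free_lift integer_group F e"
  using hom_free_diff[OF group_integer_group integer_lift_hom[of F UNIV], of c e] by simp

lemma integer_lift_prefix: "free_lift integer_group F (bar_prefix g c) = free_lift integer_group (\<lambda>l. F (g # l)) c"
proof (rule frag_induction[of c UNIV])
  show "free_lift integer_group F (bar_prefix g 0) = free_lift integer_group (\<lambda>l. F (g # l)) 0"
    by (simp add: free_lift_integer)
qed (simp_all add: integer_lift_diff bar_prefix_diff integer_lift_of)

lemma integer_lift_act:
  "free_lift integer_group F (bar_act G g hs) = (\<Sum>a\<le>length hs. (- 1) ^ a * F (bar_merge G a g hs))"
proof (induction hs arbitrary: g F)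
  case (Cons h hs)
  have "free_lift integer_group F (bar_act G g (h # hs))
    = F ((g \<otimes>\<^bsub>G\<^esub> h) # hs) - (\<Sum>a\<le>length hs. (- 1) ^ a * F (g # bar_merge G a h hs))"
    by (simp add: integer_lift_diff integer_lift_of integer_lift_prefix Cons.IH)
  then show ?case by (simp add: sum.atMost_Suc_shift sum_negf del: sum.atMost_Suc)
qed (simp add: integer_lift_of)

lemma bar_merge_nth:
  "i < length hs \<Longrightarrow> bar_merge G a g hs ! i =
     (if i < a then (g # hs) ! i else if i = a then (g # hs) ! i \<otimes>\<^bsub>G\<^esub> hs ! i else hs ! i)"
proof (induction hs arbitrary: a g i)
  case (Cons h hs)
  show ?case
  proof (cases a)
    case 0 then show ?thesis by (cases i) auto
  next
    case (Suc b)
    then show ?thesis using Cons by (cases i) auto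
  qed
qed simp

lemma form_of_value:
  assumes x: "x \<in> carrier (obj (sym_ab d) (Suc k))" and c: "supp c \<subseteq> tuples (Suc k) (free_group n)"
  shows "gen_value_at (sym_ab d) x n (bar_embed k n c) \<in> carrier (obj (sym_ab d) n)"
    "form_of (gen_value_at (sym_ab d) x n (bar_embed k n c)) v
      = free_lift integer_group (\<lambda>us. form_of x (\<lambda>i. exponent_value v (us ! i))) c"
proof -
  let ?S = "sym_ab d" and ?T = "free_Abelian_group (tuples (Suc k) (free_group n))"
  let ?f = "\<lambda>(g, h). mor ?S (rank g) n h x"
  note S = is_gr_functor_sym_ab
  have v: "?f ` cells {bar_gen k} n \<subseteq> carrier (obj ?S n)"
    using x by (auto simp: cells_def intro: hom_in_carrier[OF gr_functorD(3)[OF S]])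
  have h: "gen_value_at ?S x n \<in> hom (free_Abelian_group (cells {bar_gen k} n)) (obj ?S n)"
    unfolding gen_value_at_def by (rule comm_group.free_lift_hom[OF gr_functorD(1)[OF S] v])
  then show "gen_value_at ?S x n (bar_embed k n c) \<in> carrier (obj ?S n)"
    by (rule hom_in_carrier) (use keys_bar_embed[OF c] in simp)
  have h': "(\<lambda>c. gen_value_at ?S x n (bar_embed k n c)) \<in> hom ?T (obj ?S n)"
    using Group.hom_compose[OF bar_embed_hom h] by (simp add: comp_def)
  have "(\<lambda>c. form_of (gen_value_at ?S x n (bar_embed k n c)) v) c
    = free_lift integer_group (\<lambda>us. form_of x (\<lambda>i. exponent_value v (us ! i))) c"
  proof (rule hom_free_eqI[OF group_integer_group _ integer_lift_hom _ c])
    show "(\<lambda>c. form_of (gen_value_at ?S x n (bar_embed k n c)) v) \<in> hom ?T integer_group"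
      using Group.hom_compose[OF h' form_of_hom] by (simp add: comp_def)
    fix us assume us: "us \<in> tuples (Suc k) (free_group n)"
    let ?h = "word_hom (Suc k) n us"
    have "?f (bar_gen k, ?h) \<in> carrier (obj ?S n)"
      using v word_hom(1)[OF us] by (auto simp: cells_def image_subset_iff)
    then have "gen_value_at ?S x n (bar_embed k n (frag_of us)) = mor ?S (Suc k) n ?h x"
      unfolding gen_value_at_def bar_embed_of by (subst comm_group.free_lift_of[OF gr_functorD(1)[OF S]]) auto
    then have "form_of (gen_value_at ?S x n (bar_embed k n (frag_of us))) v = form_of x (\<lambda>i. exponent_value v (?h (gr_gen i)))"
      by (simp add: form_of_mor[OF word_hom(1)[OF us] x])
    also have "\<dots> = form_of x (\<lambda>i. exponent_value v (us ! i))"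
      by (rule forms_cong[OF form_of_forms[OF x]]) (simp add: word_hom(2)[OF us])
    finally show "form_of (gen_value_at ?S x n (bar_embed k n (frag_of us))) v
      = free_lift integer_group (\<lambda>us. form_of x (\<lambda>i. exponent_value v (us ! i))) (frag_of us)"
      by (simp add: integer_lift_of)
  qed
  then show "form_of (gen_value_at ?S x n (bar_embed k n c)) v
    = free_lift integer_group (\<lambda>us. form_of x (\<lambda>i. exponent_value v (us ! i))) c" by simp
qed

lemma exponent_value_prod: "exponent_value v (u \<otimes>\<^bsub>free_group n\<^esub> w) = exponent_value v u + exponent_value v w"
  by (simp add: free_group_simps exponent_value_mult)

abbreviation bar_differential :: "nat \<Rightarrow> nat \<Rightarrow> (word set list \<Rightarrow>\<^sub>0 int) set set \<Rightarrow> (word set list \<Rightarrow>\<^sub>0 int) set set" where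
  "bar_differential d k \<equiv> bar.gen_differential (sym_ab d) k"

lemma form_of_differential:
  assumes x: "x \<in> carrier (obj (sym_ab d) (Suc k))"
  shows "bar_differential d k x \<in> carrier (obj (sym_ab d) (Suc (Suc k)))"
    "form_of (bar_differential d k x) v = cobar (Suc k) (form_of x) v"
proof -
  let ?n = "Suc (Suc k)"
  let ?F = "\<lambda>us. form_of x (\<lambda>i. exponent_value v (us ! i))"
  have diff: "bar_differential d k x = gen_value_at (sym_ab d) x ?n (bar_embed k ?n (bar_face_sum (free_group ?n) (gr_gens ?n)))"
    by (simp only: bar.gen_differential_def[OF is_gr_functor_sym_ab] gen_boundary_bar_gen rank_bar_gen)
  have keys: "supp (bar_face_sum (free_group ?n) (gr_gens ?n)) \<subseteq> tuples (Suc k) (free_group ?n)"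
    by (rule keys_bar_face_sum[OF monoid_free_group gr_gens_tuple])
  show "bar_differential d k x \<in> carrier (obj (sym_ab d) ?n)" unfolding diff by (rule form_of_value(1)[OF x keys])
  define hs where "hs = map gr_gen [1..<?n]"
  have gens: "gr_gens ?n = gr_gen 0 # hs" unfolding gr_gens_def hs_def by (simp add: upt_conv_Cons)
  have hs: "length hs = Suc k" "\<And>i. i < Suc k \<Longrightarrow> hs ! i = gr_gen (Suc i)" "\<And>i. i \<le> Suc k \<Longrightarrow> (gr_gen 0 # hs) ! i = gr_gen i"
    by (auto simp: hs_def nth_Cons' simp del: upt_Suc)
  have "form_of (bar_differential d k x) v = free_lift integer_group ?F (bar_face_sum (free_group ?n) (gr_gens ?n))"
    unfolding diff by (rule form_of_value(2)[OF x keys])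
  also have "\<dots> = ?F hs - (\<Sum>a\<le>Suc k. (- 1) ^ a * ?F (bar_merge (free_group ?n) a (gr_gen 0) hs))"
    by (simp only: gens bar_face_sum.simps integer_lift_diff integer_lift_of integer_lift_act hs(1))
  also have "?F hs = form_of x (coface 0 v)"
    by (rule forms_cong[OF form_of_forms[OF x]]) (simp add: hs coface_def)
  also have "(\<Sum>a\<le>Suc k. (- 1) ^ a * ?F (bar_merge (free_group ?n) a (gr_gen 0) hs))
     = (\<Sum>a\<le>Suc k. (- 1) ^ a * form_of x (coface (Suc a) v))"
  proof (intro sum.cong refl arg_cong2[where f = times])
    fix a
    show "?F (bar_merge (free_group ?n) a (gr_gen 0) hs) = form_of x (coface (Suc a) v)"
    proof (rule forms_cong[OF form_of_forms[OF x]])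
      fix i assume "i < Suc k"
      then show "exponent_value v (bar_merge (free_group ?n) a (gr_gen 0) hs ! i) = coface (Suc a) v i"
        using bar_merge_nth[of i hs "free_group ?n" a "gr_gen 0"] hs
        by (simp add: coface_def exponent_value_prod)
    qed
  qed
  also have "form_of x (coface 0 v) - (\<Sum>a\<le>Suc k. (- 1) ^ a * form_of x (coface (Suc a) v)) = cobar (Suc k) (form_of x) v"
    unfolding cobar_def by (subst sum.atMost_Suc_shift) (simp add: sum_negf del: sum.atMost_Suc)
  finally show "form_of (bar_differential d k x) v = cobar (Suc k) (form_of x) v" .
qed

text \<open>The isomorphism is induced by the coefficient sum modulo \<open>p\<close>. In degree \<open>k = 0\<close> the coboundaries
  are trivial by definition, which agrees with \<open>cobars 0 d\<close> because there are no nonzero forms of positive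
  degree without variables.\<close>

theorem Ext_sym_ab:
  fixes p :: nat
  assumes d: "0 < d" and p: "0 < p"
    and exact: "\<And>f. f \<in> forms (Suc k) d \<Longrightarrow> (\<And>v. cobar (Suc k) f v = 0) \<Longrightarrow>
        int p dvd coefficient_sum (Suc k) f \<longleftrightarrow> f \<in> cobars k d"
    and gen: "c \<in> forms (Suc k) d" "\<And>v. cobar (Suc k) c v = 0" "coefficient_sum (Suc k) c mod int p = 1 mod int p"
  shows "Ext k ab_functor (sym_ab d) \<cong> integer_mod_group p"
proof -
  let ?S = "sym_ab d" and ?tau = "\<lambda>x. coefficient_sum (Suc k) (form_of x)"
  have cocycle: "x \<in> bar.gen_cocycles (sym_ab d) k \<longleftrightarrow>
      x \<in> carrier (obj ?S (Suc k)) \<and> (\<forall>v. cobar (Suc k) (form_of x) v = 0)" for x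
  proof -
    have "bar_differential d k x = \<one>\<^bsub>obj ?S (Suc (Suc k))\<^esub> \<longleftrightarrow> (\<forall>v. cobar (Suc k) (form_of x) v = 0)"
      if x: "x \<in> carrier (obj ?S (Suc k))"
      using form_of_differential[OF x] form_of_injective[OF form_of_differential(1)[OF x]] form_of_one by metis
    then show ?thesis by (auto simp: bar.gen_cocycles_def[OF is_gr_functor_sym_ab])
  qed
  have coboundaries: "bar.gen_coboundaries (sym_ab d) k = (if k = 0 then {\<one>\<^bsub>obj ?S 1\<^esub>}
      else bar_differential d (k - 1) ` carrier (obj ?S (Suc (k - 1))))"
    by (simp add: bar.gen_coboundaries_def[OF is_gr_functor_sym_ab])
  have H: "carrier (integer_mod_group p) = {0..<int p}" using p by (simp add: carrier_integer_mod_group)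
  show ?thesis
  proof (rule bar.Ext_iso[OF is_gr_functor_sym_ab group_integer_mod_group, where k = k and \<theta> = "\<lambda>x. ?tau x mod int p"], unfold rank_bar_gen)
    show "?tau (x \<otimes>\<^bsub>obj ?S (Suc k)\<^esub> y) mod int p = (?tau x mod int p) \<otimes>\<^bsub>integer_mod_group p\<^esub> (?tau y mod int p)"
      if xy: "x \<in> carrier (obj ?S (Suc k))" "y \<in> carrier (obj ?S (Suc k))" for x y
    proof -
      have "form_of (x \<otimes>\<^bsub>obj ?S (Suc k)\<^esub> y) = (\<lambda>v. form_of x v + form_of y v)"
        by (rule ext) (rule form_of_mult[OF xy])
      then show ?thesis by (simp add: coefficient_sum_add mod_simps)
    qed
    show "(\<lambda>x. ?tau x mod int p) ` bar.gen_cocycles (sym_ab d) k = carrier (integer_mod_group p)"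
    proof (intro equalityI subsetI)
      fix z assume z: "z \<in> carrier (integer_mod_group p)"
      obtain x where x: "x \<in> carrier (obj ?S (Suc k))" "form_of x = (\<lambda>v. z * c v)"
        using forms_form_of[OF forms_scale[OF gen(1)]] by blast
      have "?tau x mod int p = z * (coefficient_sum (Suc k) c mod int p) mod int p"
        by (simp add: x(2) coefficient_sum_scale mod_mult_right_eq)
      also have "\<dots> = z" using z by (simp add: gen(3) H mod_mult_right_eq)
      finally show "z \<in> (\<lambda>x. ?tau x mod int p) ` bar.gen_cocycles (sym_ab d) k"
        using x gen(2) by (intro rev_image_eqI[of x]) (simp_all add: cocycle cobar_scale)
    qed (use p in \<open>auto simp: H\<close>)
    show "?tau x mod int p = \<one>\<^bsub>integer_mod_group p\<^esub> \<longleftrightarrow> x \<in> bar.gen_coboundaries (sym_ab d) k"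
      if xz: "x \<in> bar.gen_cocycles (sym_ab d) k" for x
    proof -
      have x: "x \<in> carrier (obj ?S (Suc k))" and z: "cobar (Suc k) (form_of x) v = 0" for v
        using xz by (simp_all add: cocycle)
      have "?tau x mod int p = \<one>\<^bsub>integer_mod_group p\<^esub> \<longleftrightarrow> form_of x \<in> cobars k d"
        unfolding exact[OF form_of_forms[OF x] z, symmetric] by (simp only: dvd_eq_mod_eq_0 one_integer_mod_group)
      also have "\<dots> \<longleftrightarrow> x \<in> bar.gen_coboundaries (sym_ab d) k"
      proof (cases k)
        case 0
        obtain e where e: "d = Suc e" using d by (cases d) auto
        have "form_of x \<in> cobars 0 d \<longleftrightarrow> form_of x = (\<lambda>v. 0)"
          by (simp add: e cobars_0)
        also have "\<dots> \<longleftrightarrow> x = \<one>\<^bsub>obj ?S (Suc k)\<^esub>"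
        proof
          assume "form_of x = (\<lambda>v. 0)"
          then show "x = \<one>\<^bsub>obj ?S (Suc k)\<^esub>" by (intro form_of_injective[OF x]) simp
        next
          assume "x = \<one>\<^bsub>obj ?S (Suc k)\<^esub>"
          then show "form_of x = (\<lambda>v. 0)" by (intro ext) (simp add: form_of_one)
        qed
        finally show ?thesis unfolding coboundaries by (simp add: 0)
      next
        case (Suc j)
        have "form_of x \<in> cobars (Suc j) d \<longleftrightarrow> (\<exists>y \<in> carrier (obj ?S (Suc j)). x = bar_differential d j y)"
        proof
          assume "form_of x \<in> cobars (Suc j) d"
          then obtain h where h: "h \<in> forms (Suc j) d" "form_of x = cobar (Suc j) h" by (auto simp: cobars_def)
          obtain y where y: "y \<in> carrier (obj ?S (Suc j))" "form_of y = h" using forms_form_of[OF h(1)] by blast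
          have "x = bar_differential d j y"
            by (rule form_of_inject[of _ d "Suc k"])
              (use x Suc form_of_differential[OF y(1)] y(2) h(2) in auto)
          then show "\<exists>y \<in> carrier (obj ?S (Suc j)). x = bar_differential d j y" using y(1) by blast
        next
          assume "\<exists>y \<in> carrier (obj ?S (Suc j)). x = bar_differential d j y"
          then obtain y where y: "y \<in> carrier (obj ?S (Suc j))" "x = bar_differential d j y" by blast
          show "form_of x \<in> cobars (Suc j) d"
            by (rule cobarsI[OF form_of_forms[OF y(1)]]) (simp add: y(2) form_of_differential(2)[OF y(1)])
        qed
        then show ?thesis unfolding coboundaries by (auto simp: Suc)
      qed
      finally show ?thesis .
    qed
  qed
qed

section \<open>The two Ext groups\<close>

theorem theorem3:
  fixes d :: nat
  assumes "d \<ge> 2"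
  shows "Ext (d - 1) ab_functor (sym_functor d ab_functor) \<cong> integer_mod_group 2 \<and>
    (if d \<in> {3, 4}
     then Ext (d - 2) ab_functor (sym_functor d ab_functor) \<cong> integer_mod_group 3
     else trivial_group (Ext (d - 2) ab_functor (sym_functor d ab_functor)))"
proof
  obtain n where n: "d = n + 2" using assms by (metis add.commute le_iff_add)
  have "Ext (Suc n) ab_functor (sym_ab (Suc (Suc n))) \<cong> integer_mod_group 2"
  proof (rule Ext_sym_ab[where c = "full (Suc (Suc n))"])
    show "int 2 dvd coefficient_sum (Suc (Suc n)) f \<longleftrightarrow> f \<in> cobars (Suc n) (Suc (Suc n))"
      if "f \<in> forms (Suc (Suc n)) (Suc (Suc n))" "\<And>v. cobar (Suc (Suc n)) f v = 0" for f
      using codimension_0[OF that] by simp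
    show "full (Suc (Suc n)) \<in> forms (Suc (Suc n)) (Suc (Suc n))"
      using forms_full[of "{#}" "Suc (Suc n)"] by simp
    show "coefficient_sum (Suc (Suc n)) (full (Suc (Suc n))) mod int 2 = 1 mod int 2"
      using coefficient_sum_full[of "Suc (Suc n)" "\<lambda>_. 1"] by simp
  qed (simp_all add: cobar_full_1)
  then show "Ext (d - 1) ab_functor (sym_functor d ab_functor) \<cong> integer_mod_group 2" by (simp add: n)
  define p :: nat where "p = (if n \<in> {1, 2} then 3 else 1)"
  have ext: "Ext n ab_functor (sym_ab (n + 2)) \<cong> integer_mod_group p"
  proof (rule Ext_sym_ab[where c = "\<lambda>v. if 0 < n then full (Suc n) v * (2 * (v 0 + v 1)) else 0"])
    show "int p dvd coefficient_sum (Suc n) f \<longleftrightarrow> f \<in> cobars n (n + 2)"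
      if "f \<in> forms (Suc n) (n + 2)" "\<And>v. cobar (Suc n) f v = 0" for f
    proof -
      have "int p = (if n \<in> {1, 2} then 3 else 1)" by (simp add: p_def)
      then show ?thesis using codimension_1[OF that] by (simp only:)
    qed
    show "(\<lambda>v. if 0 < n then full (Suc n) v * (2 * (v 0 + v 1)) else 0) \<in> forms (Suc n) (n + 2)"
      using codimension_1_cocycle(1)[of n] forms.zero by (cases "0 < n") simp_all
    show "cobar (Suc n) (\<lambda>v. if 0 < n then full (Suc n) v * (2 * (v 0 + v 1)) else 0) v = 0" for v
      using codimension_1_cocycle(2)[of n v] by (cases "0 < n") (simp_all add: cobar_def)
    show "coefficient_sum (Suc n) (\<lambda>v. if 0 < n then full (Suc n) v * (2 * (v 0 + v 1)) else 0) mod int p = 1 mod int p"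
      using codimension_1_cocycle(3)[of n] by (cases "0 < n") (simp_all add: p_def)
  qed (simp_all add: p_def)
  show "if d \<in> {3, 4} then Ext (d - 2) ab_functor (sym_functor d ab_functor) \<cong> integer_mod_group 3
     else trivial_group (Ext (d - 2) ab_functor (sym_functor d ab_functor))"
  proof (cases "n \<in> {1, 2}")
    case True
    then show ?thesis using ext by (auto simp: n p_def)
  next
    case False
    have "group (Ext n ab_functor (sym_ab (n + 2)))"
      using comm_group_Ext[OF is_gr_functor_ab is_gr_functor_sym_ab] by (simp add: comm_group_def)
    then have "trivial_group (Ext n ab_functor (sym_ab (n + 2)))"
      using isomorphic_group_triviality[OF ext] False by (simp add: p_def trivial_integer_mod_group)
    then show ?thesis using False by (simp add: n)
  qed
qed

end
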